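(* Let $1\le p<q<\infty$. Let $(\mu_n)_n\subset\mathcal{D}_p\cap\mathcal{D}_q$ be a sequence of q-tame measures and let $\mu\in\mathcal{D}_p\cap\mathcal{D}_q$ be a q-tame measure. Suppose there is a function $g:\,]0,\infty[\,\to\mathbb{R}_+$ with $\mu_n(\Delta_\varepsilon^c)\le g(\varepsilon)$ for all $n$ and all $\varepsilon>0$, such that $g(\varepsilon)=O(\varepsilon^{-p})$ as $\varepsilon\to0$ and $g(\varepsilon)=O(\varepsilon^{-q})$ as $\varepsilon\to\infty$. Then the following are equivalent: 1. There exists $r$ with $p<r<q$ such that $d_r(\mu_n,\mu)\to0$ as $n\to\infty$. 2. There exists $r$ with $p<r<q$ such that $\mu_n\to\mu$ vaguely and $\zeta_{\mu_n}(r)\to\zeta_\mu(r)$. 3. For almost every $x\in\mathbb{R}$ and $\varepsilon>0$, $\mu_n(\Delta_\varepsilon^c)\to\mu(\Delta_\varepsilon^c)$ and $\mu_n(R_{x,\varepsilon})\to\mu(R_{x,\varepsilon})$. 4. For almost every $x\in\mathbb{R}$, $\zeta^x_{\mu_n}\to\zeta^x_\mu$ and $\zeta_{\mu_n}\to\zeta_\mu$ uniformly on every compact subset of $\{s\in\mathbb{C}:p<\mathrm{Re}(s)<q\}$. 5. For all $r$ with $p<r<q$, $d_r(\mu_n,\mu)\to0$ as $n\to\infty$.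
   Context: Let $\mathcal{X}=\{(x,y)\in\mathbb{R}^2: y>x\}$, $\Delta=\{(x,x):x\in\mathbb{R}\}$, $\overline{\mathcal{X}}=\mathcal{X}\cup\Delta$, with the metric $d_{\mathbb{R}^2,\infty}((a,b),(c,d))=\max\{|a-c|,|b-d|\}$. $\Delta_\varepsilon\subset\overline{\mathcal{X}}$ is the open tubular neighbourhood of radius $\varepsilon$ of $\Delta$ and $\Delta_\varepsilon^c$ its complement in $\mathcal{X}$; $R_{x,\varepsilon}=\,]-\infty,x]\times[x+\varepsilon,\infty[$. $\mathcal{D}$ is the space of (Radon, possibly infinite) measures on $\mathcal{X}$. A measure is q-tame if it gives finite mass to $R_{x,\varepsilon}$ for all $x\in\mathbb{R}$, $\varepsilon>0$ (the letter q in "q-tame" is unrelated to the exponent $q$). $\Gamma(\mu,\nu)$ is the set of measures $\pi$ on $\overline{\mathcal{X}}^2$ with $\pi(A\times\overline{\mathcal{X}})=\mu(A)$ and $\pi(\overline{\mathcal{X}}\times A)=\nu(A)$ for all Borel $A\subset\mathcal{X}$ (the diagonal acts as a source of infinite mass), and for $1\le p<\infty$, $d_p(\mu,\nu)=[\inf_{\pi\in\Gamma(\mu,\nu)}\int d_{\mathbb{R}^2,\infty}^p\,d\pi]^{1/p}$. $\mathrm{Pers}_p(\mu)^p=\int_{\mathcal{X}}d_{\mathbb{R}^2,\infty}(z,\Delta)^p\,d\mu(z)$ and $\mathcal{D}_p=\{\mu\in\mathcal{D}:\mathrm{Pers}_p(\mu)<\infty\}$. For $p<\mathrm{Re}(s)<q$: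 $\zeta_\mu(s)=s\int_0^\infty\varepsilon^{s-1}\mu(\Delta_\varepsilon^c)\,d\varepsilon$ (equal to $\mathrm{Pers}_s^s(\mu)$ for real $s$) and $\zeta_\mu^x(s)=s\int_0^\infty\varepsilon^{s-1}\mu(R_{x,\varepsilon})\,d\varepsilon$. Vague convergence means convergence of integrals against continuous compactly supported functions on $\mathcal{X}$. *)

theory Defs
  imports "HOL-Analysis.Analysis" "HOL-Library.Landau_Symbols"
begin

definition dinf :: "real \<times> real \<Rightarrow> real \<times> real \<Rightarrow> real" where
  "dinf z w = max \<bar>fst z - fst w\<bar> \<bar>snd z - snd w\<bar>"

definition halfplane :: "(real \<times> real) set" where
  "halfplane = {(x, y). y > x}"

definition diagonal :: "(real \<times> real) set" where
  "diagonal = {(x, x) | x. True}"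

definition halfplane_bar :: "(real \<times> real) set" where
  "halfplane_bar = halfplane \<union> diagonal"

definition dist_diag :: "real \<times> real \<Rightarrow> real" where
  "dist_diag z = (INF w\<in>diagonal. dinf z w)"

definition diag_nbhd :: "real \<Rightarrow> (real \<times> real) set" where
  "diag_nbhd \<epsilon> = {z \<in> halfplane_bar. dist_diag z < \<epsilon>}"

definition diag_compl :: "real \<Rightarrow> (real \<times> real) set" where
  "diag_compl \<epsilon> = halfplane - diag_nbhd \<epsilon>"

definition quadrant :: "real \<Rightarrow> real \<Rightarrow> (real \<times> real) set" where
  "quadrant x \<epsilon> = {..x} \<times> {x + \<epsilon>..}"

definition radon_measures :: "(real \<times> real) measure set" where
  "radon_measures = {\<mu>. sets \<mu> = sets (restrict_space borel halfplane)
     \<and> (\<forall>K. compact K \<and> K \<subseteq> halfplane \<longrightarrow> emeasure \<mu> K < \<infinity>)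
     \<and> (\<forall>A\<in>sets \<mu>. emeasure \<mu> A = (SUP K\<in>{K. compact K \<and> K \<subseteq> A}. emeasure \<mu> K))}"

definition q_tame :: "(real \<times> real) measure \<Rightarrow> bool" where
  "q_tame \<mu> \<longleftrightarrow> (\<forall>x \<epsilon>. \<epsilon> > 0 \<longrightarrow> emeasure \<mu> (quadrant x \<epsilon>) < \<infinity>)"

text \<open>The library has no real powers on \<^typ>\<open>ennreal\<close>; this is
  \<open>a\<close> to the power \<open>1 / p\<close>, for \<open>p > 0\<close>, with value \<open>\<infinity>\<close> at \<open>\<infinity>\<close>.\<close>

definition ennroot :: "real \<Rightarrow> ennreal \<Rightarrow> ennreal" where
  "ennroot p a = (if a = \<infinity> then \<infinity> else ennreal (enn2real a powr (1 / p)))"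

definition Pers :: "real \<Rightarrow> (real \<times> real) measure \<Rightarrow> ennreal" where
  "Pers p \<mu> = ennroot p (\<integral>\<^sup>+ z. ennreal (dist_diag z powr p) \<partial>\<mu>)"

definition persistence_measures :: "real \<Rightarrow> (real \<times> real) measure set" where
  "persistence_measures p = {\<mu> \<in> radon_measures. Pers p \<mu> < \<infinity>}"

text \<open>The marginals are prescribed on subsets of the open half-plane only, so that the diagonal
  can give and receive arbitrary mass. A coupling need not be finite on compact sets: for a measure with
  infinite mass near a point of the diagonal, no coupling of finite cost is.\<close>

definition couplings ::
  "(real \<times> real) measure \<Rightarrow> (real \<times> real) measure
     \<Rightarrow> ((real \<times> real) \<times> (real \<times> real)) measure set" where
  "couplings \<mu> \<nu> = {\<pi>. sets \<pi> = sets (restrict_space borel (halfplane_bar \<times> halfplane_bar))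
     \<and> (\<forall>A\<in>sets borel. A \<subseteq> halfplane \<longrightarrow>
          emeasure \<pi> (A \<times> halfplane_bar) = emeasure \<mu> A
        \<and> emeasure \<pi> (halfplane_bar \<times> A) = emeasure \<nu> A)}"

definition dpers :: "real \<Rightarrow> (real \<times> real) measure \<Rightarrow> (real \<times> real) measure \<Rightarrow> ennreal" where
  "dpers p \<mu> \<nu> =
     ennroot p (INF \<pi>\<in>couplings \<mu> \<nu>. \<integral>\<^sup>+ (z, w). ennreal (dinf z w powr p) \<partial>\<pi>)"

text \<open>For q-tame measures with finite \<open>Pers p\<close> and \<open>Pers q\<close>, the masses occurring in the next two
  definitions are finite, and the integrals converge absolutely for \<open>p < Re s < q\<close>.\<close>

definition zeta :: "(real \<times> real) measure \<Rightarrow> complex \<Rightarrow> complex" where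
  "zeta \<mu> s = s * (LINT \<epsilon>:{0<..}|lborel.
     complex_of_real \<epsilon> powr (s - 1) * complex_of_real (measure \<mu> (diag_compl \<epsilon>)))"

definition zeta_at :: "real \<Rightarrow> (real \<times> real) measure \<Rightarrow> complex \<Rightarrow> complex" where
  "zeta_at x \<mu> s = s * (LINT \<epsilon>:{0<..}|lborel.
     complex_of_real \<epsilon> powr (s - 1) * complex_of_real (measure \<mu> (quadrant x \<epsilon>)))"

definition vague_converges ::
  "(nat \<Rightarrow> (real \<times> real) measure) \<Rightarrow> (real \<times> real) measure \<Rightarrow> bool" where
  "vague_converges M \<mu> \<longleftrightarrow>
     (\<forall>f :: real \<times> real \<Rightarrow> real.
        continuous_on halfplane f
        \<and> (\<exists>K. compact K \<and> K \<subseteq> halfplane \<and> (\<forall>z\<in>halfplane - K. f z = 0))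
        \<longrightarrow> (\<lambda>n. LINT z|M n. f z) \<longlonglongrightarrow> (LINT z|\<mu>. f z))"

definition all_equivalent :: "bool list \<Rightarrow> bool" where
  "all_equivalent Ps \<longleftrightarrow> (\<forall>P\<in>set Ps. \<forall>Q\<in>set Ps. P \<longleftrightarrow> Q)"

end

theory Submission
  imports Defs "HOL-Probability.Probability"
begin

text \<open>All measures involved satisfy one tail bound
  \<open>\<mu>(\<Delta>\<^sub>\<epsilon>\<^sup>c) \<le> C min(\<epsilon>\<^sup>-\<^sup>p, \<epsilon>\<^sup>-\<^sup>q)\<close>, so the moments \<open>Pers\<^sub>s\<^sup>s = \<zeta>(s)\<close> with \<open>p < s < q\<close> are uniformly
  bounded and neither the neighbourhood of the diagonal nor the points far from it matter.

  A coupling of small cost moves little mass far, which yields vague convergence, convergence of the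
  moments (through \<open>a\<^sup>r \<le> (1 + t)\<^sup>r b\<^sup>r + (1 + 1/t)\<^sup>r \<bar>a - b\<bar>\<^sup>r\<close>) and convergence of the masses of closed sets with
  null boundary; dominated convergence then gives the zeta functions. For the way back from the zeta
  functions, Levy's continuity theorem on a vertical line recovers, for almost every \<open>x\<close>, the weak
  convergence of \<open>\<epsilon> \<mapsto> \<mu>\<^sub>n(R\<^sub>x\<^sub>,\<^sub>\<epsilon>)\<close>, and every test function is a limit of integrals of indicators of quadrants
  against second differences. Finally, vague convergence and convergence of one moment give tightness
  away from a compact cutoff; on its support a partition of unity of small mesh tells which masses to
  exchange, and the remaining mass is sent to the diagonal at small cost.\<close>

section \<open>The half-plane and test functions\<close>

text \<open>The total masses may be infinite near the diagonal, so weak convergence of probability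
  measures is not at hand on the half-plane. It enters only in one dimension: a tail function times
  \<open>\<epsilon> powr (\<sigma> - 1)\<close> with \<open>p < \<sigma> < q\<close> is integrable,
  hence can be normalised, unless its integral vanishes in the limit, which is a case of its own.
  The bound \<open>g\<close> is controlled only near 0 and near infinity; monotonicity of the tail
  masses fills the gap and yields one constant \<open>C\<close> for the whole sequence. The limit
  measure gets its own tail bound from its two finite persistences by Markov's inequality. One
  exponent \<open>r\<close> implies all exponents \<open>s\<close> through
  \<open>t powr s \<le> \<eta> * (t powr a + t powr b) + K * t powr r\<close> with
  \<open>a < s < b\<close>: the first term is absorbed by the uniform moment bounds, the second by
  convergence of the moment of order \<open>r\<close>. Quadrant masses are integrals of the measure
  over corners, so testing them against \<open>f\<close> recovers \<open>f\<close> only after two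
  differentiations. Test functions are merely continuous, which is why finite second differences
  with a small fixed step replace the mixed derivative.\<close>

lemma dinf_nonneg [simp]: "0 \<le> dinf z w"
  by (simp add: dinf_def)

lemma dinf_commute: "dinf z w = dinf w z"
  by (simp add: dinf_def abs_minus_commute)

lemma abs_fst_le_dinf: "\<bar>fst z - fst w\<bar> \<le> dinf z w"
  and abs_snd_le_dinf: "\<bar>snd z - snd w\<bar> \<le> dinf z w"
  by (simp_all add: dinf_def)

lemma dinf_le_dist: "dinf z w \<le> dist z w"
  unfolding dinf_def
  by (metis dist_fst_le dist_real_def dist_snd_le max.bounded_iff)

lemma dist_le_dinf: "dist z w \<le> 2 * dinf z w"
proof -
  have "dist z w = sqrt ((dist (fst z) (fst w))\<^sup>2 + (dist (snd z) (snd w))\<^sup>2)"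
    by (metis dist_Pair_Pair prod.collapse)
  also have "\<dots> \<le> dist (fst z) (fst w) + dist (snd z) (snd w)"
    by (simp add: sqrt_sum_squares_le_sum)
  also have "\<dots> \<le> 2 * dinf z w"
    using abs_fst_le_dinf[of z w] abs_snd_le_dinf[of z w] unfolding dist_real_def by linarith
  finally show ?thesis .
qed

text \<open>The minimiser of \<open>dinf z\<close> over the diagonal. Unmatched mass is sent here,
  so that the cost per unit is a power of \<open>dist_diag z\<close>.\<close>

definition diag_proj :: "real \<times> real \<Rightarrow> real \<times> real" where
  "diag_proj z = ((fst z + snd z) / 2, (fst z + snd z) / 2)"

lemma dinf_diag_proj: "dinf z (diag_proj z) = \<bar>snd z - fst z\<bar> / 2"
proof -
  have "\<bar>fst z - (fst z + snd z) / 2\<bar> = \<bar>snd z - fst z\<bar> / 2"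
    "\<bar>snd z - (fst z + snd z) / 2\<bar> = \<bar>snd z - fst z\<bar> / 2"
    by (auto simp: abs_if field_simps)
  then show ?thesis by (simp add: dinf_def diag_proj_def)
qed

lemma diag_proj_in_diagonal: "diag_proj z \<in> diagonal"
  unfolding diag_proj_def diagonal_def by blast

text \<open>A diagonal point \<open>(a, a)\<close> splits \<open>snd z - fst z\<close> into
  \<open>(snd z - a) + (a - fst z)\<close>, so one of the two summands has at least half its size;
  the midpoint attains one half in both.\<close>

lemma dist_diag_eq: "dist_diag z = \<bar>snd z - fst z\<bar> / 2"
  unfolding dist_diag_def
proof (rule cInf_eq_minimum)
  show "\<bar>snd z - fst z\<bar> / 2 \<in> dinf z ` diagonal"
    using dinf_diag_proj[of z] diag_proj_in_diagonal[of z] by (metis imageI)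
  show "\<bar>snd z - fst z\<bar> / 2 \<le> x" if "x \<in> dinf z ` diagonal" for x
  proof -
    from that obtain a where "x = dinf z (a, a)" by (auto simp: diagonal_def)
    then show ?thesis
      using abs_fst_le_dinf[of z "(a, a)"] abs_snd_le_dinf[of z "(a, a)"] by simp
  qed
qed

lemma dist_diag_nonneg [simp]: "0 \<le> dist_diag z"
  by (simp add: dist_diag_eq)

lemma dist_diag_le_add_dinf: "dist_diag z \<le> dist_diag w + dinf z w"
proof -
  have "\<bar>snd z - fst z\<bar> = \<bar>(snd w - fst w) + ((snd z - snd w) - (fst z - fst w))\<bar>" by simp
  also have "\<dots> \<le> \<bar>snd w - fst w\<bar> + (\<bar>snd z - snd w\<bar> + \<bar>fst z - fst w\<bar>)"
    by (intro order_trans[OF abs_triangle_ineq] add_left_mono abs_triangle_ineq4)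
  finally show ?thesis
    using abs_fst_le_dinf[of z w] abs_snd_le_dinf[of z w] by (simp add: dist_diag_eq)
qed

lemma continuous_on_dist_diag [continuous_intros]: "continuous_on A dist_diag"
  unfolding dist_diag_eq[abs_def] by (intro continuous_intros) auto

lemma borel_measurable_dist_diag [measurable]: "dist_diag \<in> borel_measurable borel"
  by (intro borel_measurable_continuous_onI continuous_intros)

lemma borel_measurable_dinf [measurable]:
  "(\<lambda>(z, w). dinf z w) \<in> borel_measurable (borel \<Otimes>\<^sub>M borel)"
  "(\<lambda>(z, w). dinf z w) \<in> borel_measurable borel"
proof -
  have "continuous_on UNIV (\<lambda>(z, w). dinf z w)"
    unfolding dinf_def[abs_def] case_prod_unfold by (intro continuous_intros)
  then show "(\<lambda>(z, w). dinf z w) \<in> borel_measurable borel"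
    by (rule borel_measurable_continuous_onI)
  then show "(\<lambda>(z, w). dinf z w) \<in> borel_measurable (borel \<Otimes>\<^sub>M borel)"
    by (simp only: borel_prod)
qed

lemma halfplane_eq: "halfplane = {z. fst z < snd z}"
  by (auto simp: halfplane_def)

lemma halfplane_bar_eq: "halfplane_bar = {z. fst z \<le> snd z}"
  by (auto simp: halfplane_def halfplane_bar_def diagonal_def)

lemma halfplane_subset_bar: "halfplane \<subseteq> halfplane_bar"
  by (auto simp: halfplane_bar_def)

lemma diag_proj_in_bar [simp]: "diag_proj z \<in> halfplane_bar" "diag_proj z \<notin> halfplane"
  by (auto simp: diag_proj_def halfplane_bar_eq halfplane_eq)

lemma open_halfplane: "open halfplane"
  unfolding halfplane_eq by (intro open_Collect_less continuous_intros)

lemma closed_halfplane_bar: "closed halfplane_bar"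
  unfolding halfplane_bar_eq by (intro closed_Collect_le continuous_intros)

lemma sets_halfplane [measurable]: "halfplane \<in> sets borel" "halfplane_bar \<in> sets borel"
  using open_halfplane closed_halfplane_bar by auto

lemma diag_compl_eq: "diag_compl \<epsilon> = {z \<in> halfplane. \<epsilon> \<le> dist_diag z}"
  by (auto simp: diag_compl_def diag_nbhd_def halfplane_bar_def)

text \<open>For positive \<open>\<epsilon>\<close> the inequality already forces the point into the
  open half-plane and removes the absolute value. This exhibits the set as closed in the
  plane.\<close>

lemma diag_compl_eq': "\<epsilon> > 0 \<Longrightarrow> diag_compl \<epsilon> = {z. 2 * \<epsilon> \<le> snd z - fst z}"
  by (auto simp: diag_compl_eq dist_diag_eq halfplane_eq)

lemma diag_compl_iff:
  "z \<in> halfplane_bar \<Longrightarrow> \<epsilon> > 0 \<Longrightarrow> z \<in> diag_compl \<epsilon> \<longleftrightarrow> \<epsilon> \<le> dist_diag z"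
  by (auto simp: diag_compl_eq' dist_diag_eq halfplane_bar_eq)

lemma diag_compl_subset: "diag_compl \<epsilon> \<subseteq> halfplane"
  by (auto simp: diag_compl_eq)

lemma closed_diag_compl: "\<epsilon> > 0 \<Longrightarrow> closed (diag_compl \<epsilon>)"
  unfolding diag_compl_eq' by (intro closed_Collect_le continuous_intros)

lemma sets_diag_compl [measurable]: "diag_compl \<epsilon> \<in> sets borel"
  unfolding diag_compl_eq by measurable

lemma diag_compl_antimono: "\<epsilon> \<le> \<delta> \<Longrightarrow> diag_compl \<delta> \<subseteq> diag_compl \<epsilon>"
  by (auto simp: diag_compl_eq)

lemma closed_quadrant: "closed (quadrant x \<epsilon>)"
  unfolding quadrant_def by (intro closed_Times) auto

text \<open>The corner \<open>(x, x + \<epsilon>)\<close> is the point of the quadrant nearest to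
  the diagonal, at distance \<open>\<epsilon> / 2\<close>. This halving is the source of the factor
  \<open>2 powr q\<close> in the envelopes below.\<close>

lemma quadrant_subset_diag_compl: "\<epsilon> > 0 \<Longrightarrow> quadrant x \<epsilon> \<subseteq> diag_compl (\<epsilon> / 2)"
  by (auto simp: quadrant_def diag_compl_eq')

lemma dist_diag_pos: "z \<in> halfplane \<Longrightarrow> 0 < dist_diag z"
  by (auto simp: halfplane_eq dist_diag_eq)

text \<open>Functions on the whole plane instead of the half-plane, so that continuity and Borel
  measurability are global statements; extension by zero makes this equivalent, see
  \<open>vague_converges_iff\<close>.\<close>

definition test_fun :: "(real \<times> real \<Rightarrow> real) \<Rightarrow> bool" where
  "test_fun f \<longleftrightarrow> continuous_on UNIV f
     \<and> (\<exists>K. compact K \<and> K \<subseteq> halfplane \<and> (\<forall>z. z \<notin> K \<longrightarrow> f z = 0))"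

lemma test_funI:
  assumes "continuous_on UNIV f" "compact K" "K \<subseteq> halfplane" "\<And>z. z \<notin> K \<Longrightarrow> f z = 0"
  shows "test_fun f"
  using assms by (auto simp: test_fun_def)

lemma test_fun_continuous: "test_fun f \<Longrightarrow> continuous_on A f"
  by (auto simp: test_fun_def intro: continuous_on_subset)

lemma test_fun_measurable: "test_fun f \<Longrightarrow> f \<in> borel_measurable borel"
  by (intro borel_measurable_continuous_onI test_fun_continuous)

lemma test_fun_bounded:
  assumes "test_fun f"
  obtains B where "0 \<le> B" "\<And>z. \<bar>f z\<bar> \<le> B"
proof -
  obtain K where K: "compact K" "\<And>z. z \<notin> K \<Longrightarrow> f z = 0"
    using assms by (auto simp: test_fun_def)
  have "bounded (f ` K)"
    by (intro compact_imp_bounded compact_continuous_image K test_fun_continuous assms)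
  then obtain B where B: "\<And>z. z \<in> K \<Longrightarrow> \<bar>f z\<bar> \<le> B"
    by (auto simp: bounded_iff)
  show ?thesis
  proof (rule that[of "\<bar>B\<bar>"])
    show "\<bar>f z\<bar> \<le> \<bar>B\<bar>" for z using B[of z] K(2)[of z] by (cases "z \<in> K") auto
  qed auto
qed

text \<open>\<open>dist_diag\<close> is continuous and positive on \<open>K\<close>, hence has a
  positive minimum. Test functions therefore live on a set of finite mass, under the tail
  bound.\<close>

lemma compact_subset_diag_compl:
  assumes "compact K" "K \<subseteq> halfplane"
  obtains \<delta> where "\<delta> > 0" "K \<subseteq> diag_compl \<delta>"
proof (cases "K = {}")
  case True
  then show ?thesis using that[of 1] by auto
next
  case False
  obtain w where w: "w \<in> K" "\<And>z. z \<in> K \<Longrightarrow> dist_diag w \<le> dist_diag z"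
    using continuous_attains_inf[OF assms(1) False continuous_on_dist_diag] by auto
  show ?thesis
    by (rule that[of "dist_diag w"]) (use w assms(2) dist_diag_pos[of w] in \<open>auto simp: diag_compl_eq\<close>)
qed

lemma test_fun_support:
  assumes "test_fun f"
  obtains \<delta> where "\<delta> > 0" "\<And>z. z \<notin> diag_compl \<delta> \<Longrightarrow> f z = 0"
proof -
  obtain K where K: "compact K" "K \<subseteq> halfplane" "\<And>z. z \<notin> K \<Longrightarrow> f z = 0"
    using assms by (auto simp: test_fun_def)
  obtain \<delta> where "\<delta> > 0" "K \<subseteq> diag_compl \<delta>"
    using compact_subset_diag_compl[OF K(1,2)] .
  then show ?thesis using K(3) by (intro that[of \<delta>]) auto
qed

lemma test_fun_uniformly_continuous:
  assumes "test_fun f" "0 < e"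
  obtains d where "d > 0" "\<And>z w. dinf z w < d \<Longrightarrow> \<bar>f z - f w\<bar> < e"
proof -
  obtain K where K: "compact K" "\<And>z. z \<notin> K \<Longrightarrow> f z = 0"
    using assms by (auto simp: test_fun_def)
  have "\<exists>R. K \<subseteq> cball 0 R"
    using compact_imp_bounded[OF K(1)] by (auto simp: bounded_iff subset_iff)
  then obtain R where R: "K \<subseteq> cball 0 R" ..
  \<comment> \<open>The margin 2 is chosen so that a point at \<open>dinf\<close>-distance less than
    1 from a point of \<open>K\<close> stays in the ball. If neither point is in \<open>K\<close>,
    both values are 0.\<close>
  have "uniformly_continuous_on (cball 0 (R + 2)) f"
    by (intro compact_uniformly_continuous test_fun_continuous assms) auto
  then obtain d where d: "d > 0"
    "\<And>z w. z \<in> cball 0 (R + 2) \<Longrightarrow> w \<in> cball 0 (R + 2) \<Longrightarrow> dist w z < d \<Longrightarrow> dist (f w) (f z) < e"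
    using uniformly_continuous_onE[OF _ \<open>0 < e\<close>] by blast
  show ?thesis
  proof (rule that[of "min 1 (d / 2)"])
    fix z w assume "dinf z w < min 1 (d / 2)"
    then have *: "dist z w < d" "dist z w < 2" using dist_le_dinf[of z w] by auto
    have n: "norm z \<le> norm w + dist z w" "norm w \<le> norm z + dist z w"
      using norm_triangle_sub[of z w] norm_triangle_sub[of w z]
      by (auto simp: dist_norm norm_minus_commute)
    show "\<bar>f z - f w\<bar> < e"
    proof (cases "z \<in> K \<or> w \<in> K")
      case True
      then have "norm z \<le> R + 2 \<and> norm w \<le> R + 2" using R n * by force
      then show ?thesis using d(2)[of w z] * by (auto simp: dist_real_def)
    next
      case False
      then show ?thesis using K(2) \<open>0 < e\<close> by auto
    qed
  qed (use d(1) in auto)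
qed

text \<open>Extension by zero is continuous because the half-plane and the complement of the compact
  support are two open sets covering the plane; the spaces of the measures are the half-plane, so
  the integrals do not see the extension.\<close>

lemma vague_converges_iff:
  assumes "\<And>n. space (M n) = halfplane" "space \<mu> = halfplane"
  shows "vague_converges M \<mu> \<longleftrightarrow>
    (\<forall>f. test_fun f \<longrightarrow> (\<lambda>n. LINT z|M n. f z) \<longlonglongrightarrow> (LINT z|\<mu>. f z))"
proof
  assume L: "vague_converges M \<mu>"
  show "\<forall>f. test_fun f \<longrightarrow> (\<lambda>n. LINT z|M n. f z) \<longlonglongrightarrow> (LINT z|\<mu>. f z)"
  proof (intro allI impI)
    fix f assume f: "test_fun f"
    then obtain K where "compact K" "K \<subseteq> halfplane" "\<forall>z. z \<notin> K \<longrightarrow> f z = 0"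
      by (auto simp: test_fun_def)
    then show "(\<lambda>n. LINT z|M n. f z) \<longlonglongrightarrow> (LINT z|\<mu>. f z)"
      using L[unfolded vague_converges_def, rule_format, of f] test_fun_continuous[OF f, of halfplane]
      by (metis DiffD2)
  qed
next
  assume R: "\<forall>f. test_fun f \<longrightarrow> (\<lambda>n. LINT z|M n. f z) \<longlonglongrightarrow> (LINT z|\<mu>. f z)"
  show "vague_converges M \<mu>"
    unfolding vague_converges_def
  proof (intro allI impI, elim conjE exE)
    fix f :: "real \<times> real \<Rightarrow> real" and K
    assume f: "continuous_on halfplane f" and K: "compact K" "K \<subseteq> halfplane"
      "\<forall>z\<in>halfplane - K. f z = 0"
    define h where "h z = (if z \<in> halfplane then f z else 0)" for z
    have "continuous_on (halfplane \<union> - K) h"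
    proof (rule continuous_on_open_Un)
      show "continuous_on halfplane h"
        using f by (rule continuous_on_eq) (simp add: h_def)
      show "continuous_on (- K) h"
        by (rule continuous_on_eq[of _ "\<lambda>_. 0"]) (use K in \<open>auto simp: h_def\<close>)
    qed (use K open_halfplane in \<open>auto intro: compact_imp_closed\<close>)
    moreover have "halfplane \<union> - K = UNIV" using K by auto
    ultimately have "test_fun h"
      using K by (intro test_funI[of h K]) (auto simp: h_def)
    with R have "(\<lambda>n. LINT z|M n. h z) \<longlonglongrightarrow> (LINT z|\<mu>. h z)" by blast
    moreover have "(LINT z|N. h z) = (LINT z|N. f z)" if "space N = halfplane" for N
      using that by (intro Bochner_Integration.integral_cong) (auto simp: h_def)
    ultimately show "(\<lambda>n. LINT z|M n. f z) \<longlonglongrightarrow> (LINT z|\<mu>. f z)"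
      using assms by simp
  qed
qed

text \<open>Both growth rates in one formula: \<open>\<epsilon> powr (- p)\<close> up to 1 and
  \<open>\<epsilon> powr (- q)\<close> from 1 on.\<close>

definition envelope :: "real \<Rightarrow> real \<Rightarrow> real \<Rightarrow> real" where
  "envelope p q \<epsilon> = min (\<epsilon> powr (- p)) (\<epsilon> powr (- q))"

text \<open>The one estimate on which integrability rests. What is derived from it depends on the
  measure only through \<open>C\<close>, hence is uniform along a sequence. No sign is imposed on
  \<open>C\<close>, and \<open>ennreal\<close> truncates at 0, so real bounds carry
  \<open>\<bar>C\<bar>\<close>.\<close>

locale tail_bounded =
  fixes p q C :: real and \<mu> :: "(real \<times> real) measure"
  assumes p_ge_1: "1 \<le> p" and p_less_q: "p < q"
    and sets_eq: "sets \<mu> = sets (restrict_space borel halfplane)"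
    and tail: "\<And>\<epsilon>. \<epsilon> > 0 \<Longrightarrow>
      emeasure \<mu> (diag_compl \<epsilon>) \<le> ennreal (C * envelope p q \<epsilon>)"
begin

lemma space_eq: "space \<mu> = halfplane"
  using sets_eq_imp_space_eq[OF sets_eq] by (simp add: space_restrict_space)

lemma in_sets: "A \<in> sets borel \<Longrightarrow> A \<subseteq> halfplane \<Longrightarrow> A \<in> sets \<mu>"
  unfolding sets_eq by (subst sets_restrict_space_iff) auto

lemma measurable_of_borel: "f \<in> measurable borel N \<Longrightarrow> f \<in> measurable \<mu> N"
  unfolding measurable_cong_sets[OF sets_eq refl] by (rule measurable_restrict_space1)

lemma measurable_ident_borel [measurable]: "(\<lambda>z. z) \<in> measurable \<mu> borel"
  by (intro measurable_of_borel) simp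

lemma diag_compl_in_sets [measurable]: "diag_compl \<epsilon> \<in> sets \<mu>"
  by (intro in_sets sets_diag_compl diag_compl_subset)

lemma emeasure_diag_compl_finite: "\<epsilon> > 0 \<Longrightarrow> emeasure \<mu> (diag_compl \<epsilon>) < \<infinity>"
  using tail[of \<epsilon>] by (auto intro: le_less_trans)

lemma finite_if_subset:
  "\<epsilon> > 0 \<Longrightarrow> A \<subseteq> diag_compl \<epsilon> \<Longrightarrow> emeasure \<mu> A < \<infinity>"
  using emeasure_mono[of A "diag_compl \<epsilon>" \<mu>] emeasure_diag_compl_finite[of \<epsilon>]
  by (auto intro: le_less_trans)

lemma halfplane_eq_UN: "halfplane = (\<Union>k. diag_compl (1 / real (Suc k)))"
proof -
  have "\<exists>k. 1 / real (Suc k) \<le> dist_diag z" if "z \<in> halfplane" for z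
    using reals_Archimedean[OF dist_diag_pos[OF that]] by (auto simp: inverse_eq_divide intro: less_imp_le)
  then show ?thesis by (auto simp: diag_compl_eq)
qed

text \<open>The half-plane is exhausted by sets of finite mass at distance \<open>1 / Suc k\<close>
  from the diagonal. All later uses of Fubini's theorem go through this.\<close>

lemma sigma_finite: "sigma_finite_measure \<mu>"
proof
  have "emeasure \<mu> (diag_compl (1 / real (Suc k))) \<noteq> \<infinity>" for k
    using emeasure_diag_compl_finite[of "1 / real (Suc k)"] by auto
  then show "\<exists>A. countable A \<and> A \<subseteq> sets \<mu> \<and> \<Union> A = space \<mu> \<and> (\<forall>a\<in>A. emeasure \<mu> a \<noteq> \<infinity>)"
    by (intro exI[of _ "range (\<lambda>k. diag_compl (1 / real (Suc k)))"])
       (auto simp: space_eq halfplane_eq_UN simp del: of_nat_Suc)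
qed

lemma quadrant_in_sets: "\<epsilon> > 0 \<Longrightarrow> quadrant x \<epsilon> \<in> sets \<mu>"
  using quadrant_subset_diag_compl[of \<epsilon> x] diag_compl_subset[of "\<epsilon> / 2"] closed_quadrant[of x \<epsilon>]
  by (intro in_sets) auto

lemma integrable_diag_compl [simp]:
  "\<epsilon> > 0 \<Longrightarrow> integrable \<mu> (indicat_real (diag_compl \<epsilon>))"
  using emeasure_diag_compl_finite[of \<epsilon>] by (simp add: space_eq)

lemma integrable_bounded_support:
  assumes "f \<in> borel_measurable borel" "\<And>z. \<bar>f z\<bar> \<le> B" "\<delta> > 0" "\<And>z. z \<notin> diag_compl \<delta> \<Longrightarrow> f z = 0"
  shows "integrable \<mu> (f :: real \<times> real \<Rightarrow> real)"
proof (rule Bochner_Integration.integrable_bound[of _ "\<lambda>z. B * indicator (diag_compl \<delta>) z"])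
  show "AE z in \<mu>. norm (f z) \<le> norm (B * indicat_real (diag_compl \<delta>) z)"
  proof (intro AE_I2)
    show "norm (f z) \<le> norm (B * indicat_real (diag_compl \<delta>) z)" for z
      using assms(2)[of z] assms(4)[of z] by (cases "z \<in> diag_compl \<delta>") auto
  qed
qed (use assms in \<open>auto intro: measurable_of_borel\<close>)

lemma integrable_test_fun:
  assumes "test_fun f"
  shows "integrable \<mu> f"
proof -
  obtain B where B: "\<And>z. \<bar>f z\<bar> \<le> B" using test_fun_bounded[OF assms] by blast
  obtain \<delta> where "\<delta> > 0" "\<And>z. z \<notin> diag_compl \<delta> \<Longrightarrow> f z = 0"
    using test_fun_support[OF assms] by blast
  with B show ?thesis
    by (intro integrable_bounded_support[of f B \<delta>] test_fun_measurable assms)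
qed

end

section \<open>Moments as Mellin transforms of tail masses\<close>

lemma envelope_nonneg [simp]: "0 \<le> envelope p q \<epsilon>"
  by (simp add: envelope_def)

lemma borel_measurable_envelope [measurable]: "envelope p q \<in> borel_measurable borel"
  unfolding envelope_def[abs_def] by measurable

lemma borel_measurable_fst_snd [measurable]:
  "fst \<in> borel_measurable (borel :: (real \<times> real) measure)"
  "snd \<in> borel_measurable (borel :: (real \<times> real) measure)"
  by (intro borel_measurable_continuous_onI continuous_intros)+

text \<open>The exponent is \<open>a - 1 - p > -1\<close> on \<open>{0..1}\<close> and
  \<open>a - 1 - q < -1\<close> on \<open>{1..}\<close>; the strip \<open>p < a < q\<close> is
  exactly where both pieces converge.\<close>

lemma integrable_powr_envelope:
  assumes "p < a" "a < q"
  shows "integrable lborel (\<lambda>\<epsilon>. indicator {0<..} \<epsilon> * (\<epsilon> powr (a - 1) * envelope p q \<epsilon>))"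
proof (rule integrableI_bounded)
  have "ennreal (norm (indicator {0<..} \<epsilon> * (\<epsilon> powr (a - 1) * envelope p q \<epsilon>))) \<le>
      ennreal (\<epsilon> powr (a - 1 - p)) * indicator {0..1} \<epsilon> + ennreal (\<epsilon> powr (a - 1 - q)) * indicator {1..} \<epsilon>"
    for \<epsilon> :: real
  proof (cases "0 < \<epsilon>")
    case True
    have "\<epsilon> powr (a - 1) * envelope p q \<epsilon> \<le> \<epsilon> powr (a - 1) * \<epsilon> powr (- p)"
      "\<epsilon> powr (a - 1) * envelope p q \<epsilon> \<le> \<epsilon> powr (a - 1) * \<epsilon> powr (- q)"
      by (intro mult_left_mono; simp add: envelope_def)+
    then have "\<epsilon> powr (a - 1) * envelope p q \<epsilon> \<le> \<epsilon> powr (a - 1 - p)"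
      "\<epsilon> powr (a - 1) * envelope p q \<epsilon> \<le> \<epsilon> powr (a - 1 - q)"
      by (simp_all add: powr_add[symmetric])
    then have "ennreal (\<epsilon> powr (a - 1) * envelope p q \<epsilon>) \<le> ennreal (\<epsilon> powr (a - 1 - p))"
      "ennreal (\<epsilon> powr (a - 1) * envelope p q \<epsilon>) \<le> ennreal (\<epsilon> powr (a - 1 - q))"
      by (auto intro: ennreal_leI)
    \<comment> \<open>The two intervals overlap in the point 1, where the right-hand side of the
      bound is \<open>1 + 1\<close>.\<close>
    moreover have "ennreal (envelope p q 1) \<le> 2"
      by (rule order_trans[of _ "ennreal 1"]) (auto intro!: ennreal_leI simp: envelope_def)
    ultimately show ?thesis using True
      by (cases "\<epsilon> < 1"; cases "\<epsilon> = 1") (auto simp: indicator_def intro: add_increasing)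
  qed auto
  then have "(\<integral>\<^sup>+ \<epsilon>. ennreal (norm (indicator {0<..} \<epsilon> * (\<epsilon> powr (a - 1) * envelope p q \<epsilon>))) \<partial>lborel) \<le>
    (\<integral>\<^sup>+ \<epsilon>. ennreal (\<epsilon> powr (a - 1 - p)) * indicator {0..1} \<epsilon> + ennreal (\<epsilon> powr (a - 1 - q)) * indicator {1..} \<epsilon> \<partial>lborel)"
    by (intro nn_integral_mono)
  also have "\<dots> = (\<integral>\<^sup>+ \<epsilon>. ennreal (\<epsilon> powr (a - 1 - p)) * indicator {0..1} \<epsilon> \<partial>lborel)
      + (\<integral>\<^sup>+ \<epsilon>. ennreal (\<epsilon> powr (a - 1 - q)) * indicator {1..} \<epsilon> \<partial>lborel)"
    by (intro nn_integral_add) auto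
  also have "(\<integral>\<^sup>+ \<epsilon>. ennreal (\<epsilon> powr (a - 1 - p)) * indicator {0..1} \<epsilon> \<partial>lborel) =
      ennreal (1 powr (a - 1 - p + 1) / (a - 1 - p + 1))"
    using assms by (intro nn_integral_has_integral_lebesgue' has_integral_powr_from_0) auto
  also have "(\<integral>\<^sup>+ \<epsilon>. ennreal (\<epsilon> powr (a - 1 - q)) * indicator {1..} \<epsilon> \<partial>lborel) =
      ennreal (- (1 powr (a - 1 - q + 1)) / (a - 1 - q + 1))"
    using assms by (intro nn_integral_has_integral_lebesgue' has_integral_powr_to_inf) auto
  finally show "(\<integral>\<^sup>+ \<epsilon>. ennreal (norm (indicator {0<..} \<epsilon> * (\<epsilon> powr (a - 1) * envelope p q \<epsilon>))) \<partial>lborel) < \<infinity>"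
    by (auto intro: le_less_trans)
qed measurable

text \<open>The layer-cake formula for a single value; integrating it over \<open>z\<close> turns
  moments into Mellin integrals of tail masses.\<close>

lemma powr_eq_nn_integral:
  assumes "0 < s" "0 \<le> t"
  shows "ennreal (t powr s) = (\<integral>\<^sup>+ \<epsilon>. ennreal (s * \<epsilon> powr (s - 1)) * indicator {0<..t} \<epsilon> \<partial>lborel)"
proof -
  have "((\<lambda>\<epsilon>. s * \<epsilon> powr (s - 1)) has_integral s * (t powr (s - 1 + 1) / (s - 1 + 1))) {0..t}"
    using assms by (intro has_integral_mult_right has_integral_powr_from_0) auto
  then have "(\<integral>\<^sup>+ \<epsilon>. ennreal (s * \<epsilon> powr (s - 1)) * indicator {0..t} \<epsilon> \<partial>lborel) =
      ennreal (s * (t powr (s - 1 + 1) / (s - 1 + 1)))"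
    using assms by (intro nn_integral_has_integral_lebesgue') auto
  \<comment> \<open>The endpoint 0 needs no null-set argument, because
    \<open>0 powr (s - 1) = 0\<close> by convention.\<close>
  moreover have "(\<integral>\<^sup>+ \<epsilon>. ennreal (s * \<epsilon> powr (s - 1)) * indicator {0..t} \<epsilon> \<partial>lborel) =
      (\<integral>\<^sup>+ \<epsilon>. ennreal (s * \<epsilon> powr (s - 1)) * indicator {0<..t} \<epsilon> \<partial>lborel)"
    by (intro nn_integral_cong) (auto simp: indicator_def)
  ultimately show ?thesis using assms by simp
qed

text \<open>Meeting with the half-plane makes the mass a Borel function of all corners \<open>(x, y)\<close>; for \<open>y \<le> x\<close>
  the full quadrant is not a measurable set of the measures considered here.\<close>

definition half_quadrant :: "real \<Rightarrow> real \<Rightarrow> (real \<times> real) set" where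
  "half_quadrant x y = {z \<in> halfplane. fst z \<le> x \<and> y \<le> snd z}"

lemma half_quadrant_eq: "\<epsilon> > 0 \<Longrightarrow> half_quadrant x (x + \<epsilon>) = quadrant x \<epsilon>"
  by (auto simp: half_quadrant_def quadrant_def halfplane_eq)

context tail_bounded
begin

lemma measure_diag_compl_le: "\<epsilon> > 0 \<Longrightarrow> measure \<mu> (diag_compl \<epsilon>) \<le> \<bar>C\<bar> * envelope p q \<epsilon>"
proof -
  assume "\<epsilon> > 0"
  then have "emeasure \<mu> (diag_compl \<epsilon>) \<le> ennreal (C * envelope p q \<epsilon>)" by (rule tail)
  also have "\<dots> \<le> ennreal (\<bar>C\<bar> * envelope p q \<epsilon>)"
    by (intro ennreal_leI mult_right_mono) auto
  finally show ?thesis unfolding measure_def by (intro enn2real_leI) auto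
qed

lemma emeasure_eq_measure_if:
  "\<epsilon> > 0 \<Longrightarrow> A \<subseteq> diag_compl \<epsilon> \<Longrightarrow> emeasure \<mu> A = ennreal (measure \<mu> A)"
  using finite_if_subset[of \<epsilon> A] by (intro emeasure_eq_ennreal_measure) auto

lemma measure_mono_if:
  "\<epsilon> > 0 \<Longrightarrow> B \<subseteq> diag_compl \<epsilon> \<Longrightarrow> A \<subseteq> B \<Longrightarrow> A \<in> sets \<mu> \<Longrightarrow> B \<in> sets \<mu> \<Longrightarrow> measure \<mu> A \<le> measure \<mu> B"
  using finite_if_subset[of \<epsilon> B] by (intro measure_mono_fmeasurable) (auto simp: fmeasurable_def)

lemma measure_quadrant_le:
  assumes "\<epsilon> > 0"
  shows "measure \<mu> (quadrant x \<epsilon>) \<le> \<bar>C\<bar> * envelope p q (\<epsilon> / 2)"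
proof -
  have "measure \<mu> (quadrant x \<epsilon>) \<le> measure \<mu> (diag_compl (\<epsilon> / 2))"
    using assms by (intro measure_mono_if[of "\<epsilon> / 2"] quadrant_subset_diag_compl quadrant_in_sets) auto
  also have "\<dots> \<le> \<bar>C\<bar> * envelope p q (\<epsilon> / 2)"
    using assms by (intro measure_diag_compl_le) auto
  finally show ?thesis .
qed

text \<open>The sets are the sections of one measurable set in a product, and the masses of sections
  are measurable for a sigma-finite measure.\<close>

lemma borel_measurable_emeasure_diag_compl [measurable]:
  "(\<lambda>\<epsilon>. emeasure \<mu> (diag_compl \<epsilon>)) \<in> borel_measurable borel"
proof -
  define Q where "Q = {w \<in> space (borel \<Otimes>\<^sub>M \<mu>). fst w \<le> dist_diag (snd w)}"
  have "Q \<in> sets (borel \<Otimes>\<^sub>M \<mu>)" unfolding Q_def by measurable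
  from sigma_finite_measure.measurable_emeasure_Pair[OF sigma_finite this]
  have "(\<lambda>\<epsilon>. emeasure \<mu> (Pair \<epsilon> -` Q)) \<in> borel_measurable borel" .
  moreover have "Pair \<epsilon> -` Q = diag_compl \<epsilon>" for \<epsilon>
    by (auto simp: Q_def space_pair_measure space_eq diag_compl_eq)
  ultimately show ?thesis by simp
qed

lemma borel_measurable_emeasure_half_quadrant [measurable]:
  "(\<lambda>w. emeasure \<mu> (half_quadrant (fst w) (snd w))) \<in> borel_measurable borel"
proof -
  define Q where "Q = {w \<in> space ((borel :: (real \<times> real) measure) \<Otimes>\<^sub>M \<mu>).
    fst (snd w) \<le> fst (fst w) \<and> snd (fst w) \<le> snd (snd w)}"
  have "Q \<in> sets (borel \<Otimes>\<^sub>M \<mu>)" unfolding Q_def by measurable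
  from sigma_finite_measure.measurable_emeasure_Pair[OF sigma_finite this]
  have "(\<lambda>w. emeasure \<mu> (Pair w -` Q)) \<in> borel_measurable borel" .
  moreover have "Pair w -` Q = half_quadrant (fst w) (snd w)" for w
    by (auto simp: Q_def space_pair_measure space_eq half_quadrant_def)
  ultimately show ?thesis by simp
qed

text \<open>Layer cake in the variable \<open>dist_diag z\<close>, then exchange of the two
  integrals.\<close>

lemma nn_integral_dist_diag_powr:
  assumes "0 < s"
  shows "(\<integral>\<^sup>+ z. ennreal (dist_diag z powr s) \<partial>\<mu>) =
    (\<integral>\<^sup>+ \<epsilon>. ennreal (s * \<epsilon> powr (s - 1)) * indicator {0<..} \<epsilon> * emeasure \<mu> (diag_compl \<epsilon>) \<partial>lborel)"
proof -
  interpret pair_sigma_finite \<mu> lborel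
    by (intro pair_sigma_finite.intro sigma_finite sigma_finite_lborel)
  have "(\<integral>\<^sup>+ z. ennreal (dist_diag z powr s) \<partial>\<mu>) =
      (\<integral>\<^sup>+ z. (\<integral>\<^sup>+ \<epsilon>. ennreal (s * \<epsilon> powr (s - 1)) * indicator {w. 0 < fst w \<and> fst w \<le> snd w} (\<epsilon>, dist_diag z) \<partial>lborel) \<partial>\<mu>)"
    unfolding powr_eq_nn_integral[OF assms dist_diag_nonneg]
    by (intro nn_integral_cong) (auto simp: indicator_def)
  also have "\<dots> = (\<integral>\<^sup>+ \<epsilon>. (\<integral>\<^sup>+ z. ennreal (s * \<epsilon> powr (s - 1)) * indicator {w. 0 < fst w \<and> fst w \<le> snd w} (\<epsilon>, dist_diag z) \<partial>\<mu>) \<partial>lborel)"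
    by (intro Fubini'[symmetric]) measurable
  also have "\<dots> = (\<integral>\<^sup>+ \<epsilon>. (\<integral>\<^sup>+ z. ennreal (s * \<epsilon> powr (s - 1)) * indicator {0<..} \<epsilon> * indicator (diag_compl \<epsilon>) z \<partial>\<mu>) \<partial>lborel)"
    by (intro nn_integral_cong) (auto simp: indicator_def space_eq diag_compl_eq)
  also have "\<dots> = (\<integral>\<^sup>+ \<epsilon>. ennreal (s * \<epsilon> powr (s - 1)) * indicator {0<..} \<epsilon> * emeasure \<mu> (diag_compl \<epsilon>) \<partial>lborel)"
    by (intro nn_integral_cong nn_integral_cmult_indicator) measurable
  finally show ?thesis .
qed

text \<open>The body does not mention \<open>\<mu>\<close>: the bound is a function of
  \<open>p\<close>, \<open>q\<close>, \<open>C\<close> and \<open>s\<close>, so that the instance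
  for the limit measure also serves every member of the sequence.\<close>

definition moment_bound :: "real \<Rightarrow> real" where
  "moment_bound s = s * (\<bar>C\<bar> * (LINT \<epsilon>|lborel. indicator {0<..} \<epsilon> * (\<epsilon> powr (s - 1) * envelope p q \<epsilon>)))"

lemma nn_integral_dist_diag_powr_le:
  assumes "p < s" "s < q"
  shows "(\<integral>\<^sup>+ z. ennreal (dist_diag z powr s) \<partial>\<mu>) \<le> ennreal (moment_bound s)"
proof -
  have s: "0 < s" using assms p_ge_1 by linarith
  have "(\<integral>\<^sup>+ z. ennreal (dist_diag z powr s) \<partial>\<mu>) \<le>
    (\<integral>\<^sup>+ \<epsilon>. ennreal (s * (\<bar>C\<bar> * (indicator {0<..} \<epsilon> * (\<epsilon> powr (s - 1) * envelope p q \<epsilon>)))) \<partial>lborel)"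
    unfolding nn_integral_dist_diag_powr[OF s]
  proof (intro nn_integral_mono)
    fix \<epsilon> :: real
    show "ennreal (s * \<epsilon> powr (s - 1)) * indicator {0<..} \<epsilon> * emeasure \<mu> (diag_compl \<epsilon>) \<le>
      ennreal (s * (\<bar>C\<bar> * (indicator {0<..} \<epsilon> * (\<epsilon> powr (s - 1) * envelope p q \<epsilon>))))"
    proof (cases "0 < \<epsilon>")
      case True
      have "ennreal (s * \<epsilon> powr (s - 1)) * emeasure \<mu> (diag_compl \<epsilon>) =
          ennreal (s * \<epsilon> powr (s - 1) * measure \<mu> (diag_compl \<epsilon>))"
        using True s by (subst emeasure_eq_measure_if[of \<epsilon>]) (auto simp: ennreal_mult)
      also have "\<dots> \<le> ennreal (s * \<epsilon> powr (s - 1) * (\<bar>C\<bar> * envelope p q \<epsilon>))"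
        using True s by (intro ennreal_leI mult_left_mono measure_diag_compl_le) auto
      finally show ?thesis using True by (simp add: ac_simps)
    qed auto
  qed
  also have "\<dots> = ennreal (moment_bound s)"
    unfolding moment_bound_def using s
    by (subst nn_integral_eq_integral) (auto intro!: integrable_powr_envelope assms)
  finally show ?thesis .
qed

lemma integrable_dist_diag_powr:
  assumes "p < s" "s < q"
  shows "integrable \<mu> (\<lambda>z. dist_diag z powr s)"
  using nn_integral_dist_diag_powr_le[OF assms]
  by (intro integrableI_bounded) (auto intro: le_less_trans)

lemma integral_dist_diag_powr_le:
  assumes "p < s" "s < q"
  shows "(LINT z|\<mu>. dist_diag z powr s) \<le> moment_bound s"
proof -
  have "0 < s" using assms p_ge_1 by linarith
  then have "0 \<le> moment_bound s"
    unfolding moment_bound_def by (auto intro!: mult_nonneg_nonneg integral_nonneg)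
  then show ?thesis
    using nn_integral_dist_diag_powr_le[OF assms] nn_integral_eq_integral[OF integrable_dist_diag_powr[OF assms]]
    by (simp add: ennreal_le_iff)
qed

text \<open>At a real point of the strip the complex powers are nonnegative reals, and the integral
  is the layer-cake integral of the moment. This translates the zeta condition of the theorem into
  convergence of a moment.\<close>

lemma zeta_of_real:
  assumes "p < s" "s < q"
  shows "zeta \<mu> (complex_of_real s) = complex_of_real (LINT z|\<mu>. dist_diag z powr s)"
proof -
  have s: "0 < s" using assms p_ge_1 by linarith
  let ?F = "\<lambda>\<epsilon>. s * (indicator {0<..} \<epsilon> * (\<epsilon> powr (s - 1) * measure \<mu> (diag_compl \<epsilon>)))"
  have "(LINT z|\<mu>. dist_diag z powr s) = enn2real (\<integral>\<^sup>+ z. ennreal (dist_diag z powr s) \<partial>\<mu>)"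
    by (intro integral_eq_nn_integral) auto
  also have "(\<integral>\<^sup>+ z. ennreal (dist_diag z powr s) \<partial>\<mu>) = (\<integral>\<^sup>+ \<epsilon>. ennreal (?F \<epsilon>) \<partial>lborel)"
    unfolding nn_integral_dist_diag_powr[OF s]
  proof (intro nn_integral_cong)
    fix \<epsilon> :: real
    show "ennreal (s * \<epsilon> powr (s - 1)) * indicator {0<..} \<epsilon> * emeasure \<mu> (diag_compl \<epsilon>) = ennreal (?F \<epsilon>)"
    proof (cases "0 < \<epsilon>")
      case True
      then show ?thesis
        using s by (subst emeasure_eq_measure_if[of \<epsilon>]) (auto simp: ennreal_mult ac_simps)
    qed auto
  qed
  also have "enn2real \<dots> = (LINT \<epsilon>|lborel. ?F \<epsilon>)"
    using s by (intro integral_eq_nn_integral[symmetric]) (auto simp: measure_def)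
  also have "\<dots> = s * (LINT \<epsilon>|lborel. indicator {0<..} \<epsilon> * (\<epsilon> powr (s - 1) * measure \<mu> (diag_compl \<epsilon>)))"
    by simp
  finally have *: "(LINT z|\<mu>. dist_diag z powr s) = \<dots>" .
  have "(LINT \<epsilon>:{0<..}|lborel. complex_of_real \<epsilon> powr (complex_of_real s - 1) * complex_of_real (measure \<mu> (diag_compl \<epsilon>)))
    = (LINT \<epsilon>|lborel. complex_of_real (indicator {0<..} \<epsilon> * (\<epsilon> powr (s - 1) * measure \<mu> (diag_compl \<epsilon>))))"
    unfolding set_lebesgue_integral_def
  proof (intro Bochner_Integration.integral_cong refl)
    fix \<epsilon> :: real
    have "complex_of_real s - 1 = complex_of_real (s - 1)" by simp
    then show "indicat_real {0<..} \<epsilon> *\<^sub>R (complex_of_real \<epsilon> powr (complex_of_real s - 1) * complex_of_real (measure \<mu> (diag_compl \<epsilon>))) =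
      complex_of_real (indicator {0<..} \<epsilon> * (\<epsilon> powr (s - 1) * measure \<mu> (diag_compl \<epsilon>)))"
      by (cases "0 < \<epsilon>") (simp_all add: powr_of_real del: of_real_diff)
  qed
  also have "\<dots> = complex_of_real (LINT \<epsilon>|lborel. indicator {0<..} \<epsilon> * (\<epsilon> powr (s - 1) * measure \<mu> (diag_compl \<epsilon>)))"
    by (rule integral_complex_of_real)
  finally show ?thesis unfolding zeta_def * by (simp only: of_real_mult)
qed

end

section \<open>Consequences of couplings of small cost\<close>

lemma ennreal_tendsto_0I_iff:
  fixes X :: "'a \<Rightarrow> ennreal"
  shows "(X \<longlongrightarrow> 0) F \<longleftrightarrow> (\<forall>e>0. \<forall>\<^sub>F n in F. X n < ennreal e)"
proof
  assume "(X \<longlongrightarrow> 0) F"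
  then show "\<forall>e>0. \<forall>\<^sub>F n in F. X n < ennreal e"
    by (auto simp: order_tendsto_iff)
next
  assume *: "\<forall>e>0. \<forall>\<^sub>F n in F. X n < ennreal e"
  show "(X \<longlongrightarrow> 0) F"
  proof (rule order_tendstoI)
    fix a :: ennreal assume "0 < a"
    then obtain e where "0 < e" "ennreal e < a"
      using dense[of 0 a] by (metis ennreal_cases ennreal_less_zero_iff less_top not_less_iff_gr_or_eq top.not_eq_extremum)
    with * have "\<forall>\<^sub>F n in F. X n < ennreal e" by blast
    then show "\<forall>\<^sub>F n in F. X n < a"
      by eventually_elim (use \<open>ennreal e < a\<close> in auto)
  qed auto
qed

lemma ennroot_less_iff:
  assumes "0 < r" "0 < e"
  shows "ennroot r a < ennreal e \<longleftrightarrow> a < ennreal (e powr r)"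
proof (cases "a = \<infinity>")
  case False
  then obtain x where x: "a = ennreal x" "0 \<le> x" by (cases a) auto
  have "x powr (1 / r) < e \<longleftrightarrow> x < e powr r"
  proof
    assume "x powr (1 / r) < e"
    then have "(x powr (1 / r)) powr r < e powr r" using assms by (intro powr_less_mono2) auto
    then show "x < e powr r" using assms x by (simp add: powr_powr)
  next
    assume "x < e powr r"
    then have "x powr (1 / r) < (e powr r) powr (1 / r)" using assms x by (intro powr_less_mono2) auto
    then show "x powr (1 / r) < e" using assms x by (simp add: powr_powr)
  qed
  then show ?thesis using x by (simp add: ennroot_def ennreal_less_iff)
qed (auto simp: ennroot_def)

text \<open>The root is increasing and \<open>ennroot r a < ennreal e\<close> unfolds to
  \<open>a < ennreal (e powr r)\<close>, also for infinite \<open>a\<close>. Hence convergence in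
  \<open>dpers\<close> can be tested on the infimum of costs, without the root.\<close>

lemma tendsto_ennroot_0_iff:
  assumes "0 < r"
  shows "((\<lambda>n. ennroot r (X n)) \<longlongrightarrow> 0) F \<longleftrightarrow> (X \<longlongrightarrow> 0) F"
  unfolding ennreal_tendsto_0I_iff
proof safe
  fix e :: real assume "0 < e"
  { assume *: "\<forall>e>0. \<forall>\<^sub>F n in F. ennroot r (X n) < ennreal e"
    then have "\<forall>\<^sub>F n in F. ennroot r (X n) < ennreal (e powr (1 / r))" using \<open>0 < e\<close> by simp
    then show "\<forall>\<^sub>F n in F. X n < ennreal e"
      using assms \<open>0 < e\<close> by (simp add: ennroot_less_iff powr_powr) }
  { assume *: "\<forall>e>0. \<forall>\<^sub>F n in F. X n < ennreal e"
    then have "\<forall>\<^sub>F n in F. X n < ennreal (e powr r)" using \<open>0 < e\<close> by simp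
    then show "\<forall>\<^sub>F n in F. ennroot r (X n) < ennreal e"
      using assms \<open>0 < e\<close> by (simp add: ennroot_less_iff) }
qed

definition cost :: "real \<Rightarrow> ((real \<times> real) \<times> (real \<times> real)) measure \<Rightarrow> ennreal" where
  "cost r \<pi> = (\<integral>\<^sup>+ (z, w). ennreal (dinf z w powr r) \<partial>\<pi>)"

text \<open>Near-optimal couplings are all that the estimates ask for; no minimiser is
  constructed.\<close>

lemma eventually_coupling_if_dpers_tendsto_0:
  assumes "0 < r" "(\<lambda>n. dpers r (M n) \<mu>) \<longlonglongrightarrow> 0" "0 < e"
  shows "\<forall>\<^sub>F n in sequentially. \<exists>\<pi>\<in>couplings (M n) \<mu>. cost r \<pi> < ennreal e"
proof -
  have "(\<lambda>n. INF \<pi>\<in>couplings (M n) \<mu>. cost r \<pi>) \<longlonglongrightarrow> 0"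
    using assms(2) unfolding dpers_def tendsto_ennroot_0_iff[OF assms(1)] cost_def .
  then have "\<forall>\<^sub>F n in sequentially. (INF \<pi>\<in>couplings (M n) \<mu>. cost r \<pi>) < ennreal e"
    using assms(3) unfolding ennreal_tendsto_0I_iff by blast
  then show ?thesis by (simp add: INF_less_iff)
qed

section \<open>Marginals of couplings with the diagonal as reservoir\<close>

abbreviation bar_pairs :: "((real \<times> real) \<times> (real \<times> real)) measure" where
  "bar_pairs \<equiv> restrict_space borel (halfplane_bar \<times> halfplane_bar)"

lemma space_bar_pairs: "space bar_pairs = halfplane_bar \<times> halfplane_bar"
  by (simp add: space_restrict_space)

lemma Times_in_sets_bar_pairs:
  assumes "A \<in> sets borel" "B \<in> sets borel" "A \<subseteq> halfplane_bar" "B \<subseteq> halfplane_bar"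
  shows "A \<times> B \<in> sets bar_pairs"
  by (subst sets_restrict_space_iff) (use assms sets_halfplane in \<open>auto intro: borel_Times\<close>)

lemma measurable_bar_pairs_fst_snd:
  "fst \<in> measurable bar_pairs borel" "snd \<in> measurable bar_pairs borel"
  by (intro measurable_restrict_space1 borel_measurable_continuous_onI continuous_intros)+

lemma measurable_swap_bar_pairs: "prod.swap \<in> measurable bar_pairs bar_pairs"
  unfolding prod.swap_def
  by (intro measurable_restrict_space3 borel_measurable_continuous_onI continuous_intros) auto

lemma borel_measurable_cost [measurable]:
  "(\<lambda>(z, w). ennreal (dinf z w powr r)) \<in> borel_measurable bar_pairs"
proof -
  have "(\<lambda>w. ennreal (dinf (fst w) (snd w) powr r)) \<in> borel_measurable borel"
    using borel_measurable_dinf(2) unfolding case_prod_unfold by measurable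
  then show ?thesis by (auto simp: case_prod_unfold intro: measurable_restrict_space1)
qed

lemma couplings_sets:
  assumes "\<pi> \<in> couplings \<mu> \<nu>"
  shows "sets \<pi> = sets bar_pairs" "space \<pi> = halfplane_bar \<times> halfplane_bar"
proof -
  show *: "sets \<pi> = sets bar_pairs" using assms by (auto simp: couplings_def)
  show "space \<pi> = halfplane_bar \<times> halfplane_bar"
    using sets_eq_imp_space_eq[OF *] by (simp add: space_bar_pairs)
qed

text \<open>Makes every one-sided estimate for a coupling two-sided.\<close>

lemma swap_in_couplings:
  assumes "\<pi> \<in> couplings \<mu> \<nu>"
  shows "distr \<pi> bar_pairs prod.swap \<in> couplings \<nu> \<mu>"
    and "cost r (distr \<pi> bar_pairs prod.swap) = cost r \<pi>"
proof -
  note s = couplings_sets[OF assms]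
  have m: "prod.swap \<in> measurable \<pi> bar_pairs"
    unfolding measurable_cong_sets[OF s(1) refl] by (rule measurable_swap_bar_pairs)
  show "distr \<pi> bar_pairs prod.swap \<in> couplings \<nu> \<mu>"
    unfolding couplings_def
  proof (intro CollectI conjI ballI impI)
    fix A :: "(real \<times> real) set" assume A: "A \<in> sets borel" "A \<subseteq> halfplane"
    have "A \<subseteq> halfplane_bar" using A halfplane_subset_bar by auto
    then have in_R: "A \<times> halfplane_bar \<in> sets bar_pairs" "halfplane_bar \<times> A \<in> sets bar_pairs"
      using A by (auto intro: Times_in_sets_bar_pairs)
    have "prod.swap -` (A \<times> halfplane_bar) \<inter> space \<pi> = halfplane_bar \<times> A"
      "prod.swap -` (halfplane_bar \<times> A) \<inter> space \<pi> = A \<times> halfplane_bar"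
      using \<open>A \<subseteq> halfplane_bar\<close> by (auto simp: s(2))
    then show "emeasure (distr \<pi> bar_pairs prod.swap) (A \<times> halfplane_bar) = emeasure \<nu> A"
      "emeasure (distr \<pi> bar_pairs prod.swap) (halfplane_bar \<times> A) = emeasure \<mu> A"
      using assms A by (simp_all add: emeasure_distr[OF m] in_R couplings_def)
  qed simp
  show "cost r (distr \<pi> bar_pairs prod.swap) = cost r \<pi>"
    unfolding cost_def
    by (subst nn_integral_distr[OF m]) (auto simp: case_prod_unfold dinf_commute
        borel_measurable_cost[unfolded case_prod_unfold])
qed

text \<open>A coupling has no prescribed marginal over the diagonal. Cutting away the pairs that
  start there leaves a measure whose image under \<open>fst\<close> is exactly
  \<open>\<mu>\<close>.\<close>

lemma distr_coupling_fst:
  assumes \<pi>: "\<pi> \<in> couplings \<mu> \<nu>" and sets_\<mu>: "sets \<mu> = sets (restrict_space borel halfplane)"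
  shows "fst \<in> measurable (restrict_space \<pi> (halfplane \<times> halfplane_bar)) \<mu>"
    and "distr (restrict_space \<pi> (halfplane \<times> halfplane_bar)) \<mu> fst = \<mu>"
    and "halfplane \<times> halfplane_bar \<in> sets \<pi>"
    and "space \<pi> = halfplane_bar \<times> halfplane_bar"
proof -
  let ?H = "halfplane \<times> halfplane_bar"
  note s = couplings_sets[OF \<pi>]
  show sp: "space \<pi> = halfplane_bar \<times> halfplane_bar" by (rule s(2))
  show H: "?H \<in> sets \<pi>"
    unfolding s(1) using halfplane_subset_bar by (intro Times_in_sets_bar_pairs) auto
  have "fst \<in> measurable \<pi> borel"
    unfolding measurable_cong_sets[OF s(1) refl] by (rule measurable_bar_pairs_fst_snd)
  then have "fst \<in> measurable (restrict_space \<pi> ?H) borel"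
    by (rule measurable_restrict_space1)
  then have "fst \<in> measurable (restrict_space \<pi> ?H) (restrict_space borel halfplane)"
    by (intro measurable_restrict_space2) (auto simp: space_restrict_space)
  then show m: "fst \<in> measurable (restrict_space \<pi> ?H) \<mu>"
    unfolding measurable_cong_sets[OF refl sets_\<mu>] .
  show "distr (restrict_space \<pi> ?H) \<mu> fst = \<mu>"
  proof (rule measure_eqI)
    fix A assume "A \<in> sets (distr (restrict_space \<pi> ?H) \<mu> fst)"
    then have A: "A \<in> sets \<mu>" by simp
    then have A': "A \<in> sets borel" "A \<subseteq> halfplane"
      unfolding sets_\<mu> by (auto simp: sets_restrict_space_iff)
    have eq: "fst -` A \<inter> space (restrict_space \<pi> ?H) = A \<times> halfplane_bar"
      using A' halfplane_subset_bar by (auto simp: space_restrict_space sp)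
    have "emeasure (restrict_space \<pi> ?H) (A \<times> halfplane_bar) = emeasure \<pi> (A \<times> halfplane_bar)"
      using H A' by (intro emeasure_restrict_space) (auto simp: sets.sets_into_space Int_absorb2)
    also have "\<dots> = emeasure \<mu> A"
      using \<pi> A' by (auto simp: couplings_def)
    finally show "emeasure (distr (restrict_space \<pi> ?H) \<mu> fst) A = emeasure \<mu> A"
      by (simp add: emeasure_distr[OF m A] eq)
  qed simp
qed

text \<open>Vanishing on the diagonal makes the integrand blind to the part of the coupling with
  uncontrolled first marginal, so the integral may be taken over all of
  \<open>\<pi>\<close>.\<close>

lemma
  fixes f :: "real \<times> real \<Rightarrow> ennreal" and g :: "real \<times> real \<Rightarrow> real"
  assumes \<pi>: "\<pi> \<in> couplings \<mu> \<nu>" and sets_\<mu>: "sets \<mu> = sets (restrict_space borel halfplane)"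
  shows nn_integral_coupling_fst: "f \<in> borel_measurable \<mu> \<Longrightarrow> (\<And>z. z \<in> diagonal \<Longrightarrow> f z = 0) \<Longrightarrow>
      (\<integral>\<^sup>+ w. f (fst w) \<partial>\<pi>) = (\<integral>\<^sup>+ z. f z \<partial>\<mu>)"
    and integrable_coupling_fst: "integrable \<mu> g \<Longrightarrow> (\<And>z. z \<in> diagonal \<Longrightarrow> g z = 0) \<Longrightarrow>
      integrable \<pi> (\<lambda>w. g (fst w))"
    and integral_coupling_fst: "integrable \<mu> g \<Longrightarrow> (\<And>z. z \<in> diagonal \<Longrightarrow> g z = 0) \<Longrightarrow>
      (LINT w|\<pi>. g (fst w)) = (LINT z|\<mu>. g z)"
proof -
  let ?H = "halfplane \<times> halfplane_bar"
  let ?N = "restrict_space \<pi> ?H"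
  note c = distr_coupling_fst[OF \<pi> sets_\<mu>]
  have H: "?H \<inter> space \<pi> \<in> sets \<pi>" using c(3) by (simp add: sets.Int_space_eq2)
  have out: "z \<in> diagonal" if "z \<in> halfplane_bar" "z \<notin> halfplane" for z
    using that by (auto simp: halfplane_bar_def)
  { assume f: "f \<in> borel_measurable \<mu>" "\<And>z. z \<in> diagonal \<Longrightarrow> f z = 0"
    have "(\<integral>\<^sup>+ z. f z \<partial>\<mu>) = (\<integral>\<^sup>+ z. f z \<partial>distr ?N \<mu> fst)" by (simp only: c(2))
    also have "\<dots> = (\<integral>\<^sup>+ w. f (fst w) \<partial>?N)"
      by (intro nn_integral_distr c(1)) (simp add: f)
    also have "\<dots> = (\<integral>\<^sup>+ w. f (fst w) * indicator ?H w \<partial>\<pi>)"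
      by (rule nn_integral_restrict_space[OF H])
    also have "\<dots> = (\<integral>\<^sup>+ w. f (fst w) \<partial>\<pi>)"
    proof (rule nn_integral_cong)
      fix w assume "w \<in> space \<pi>"
      then show "f (fst w) * indicator ?H w = f (fst w)"
        using out[of "fst w"] f(2)[of "fst w"] by (cases "fst w \<in> halfplane") (auto simp: c(4) indicator_def)
    qed
    finally show "(\<integral>\<^sup>+ w. f (fst w) \<partial>\<pi>) = (\<integral>\<^sup>+ z. f z \<partial>\<mu>)" by simp }
  { assume g: "integrable \<mu> g" "\<And>z. z \<in> diagonal \<Longrightarrow> g z = 0"
    have eq: "indicator ?H w *\<^sub>R g (fst w) = g (fst w)" if "w \<in> space \<pi>" for w
      using that out[of "fst w"] g(2)[of "fst w"]
      by (cases "fst w \<in> halfplane") (auto simp: indicator_def c(4))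
    have "integrable (distr ?N \<mu> fst) g" using g(1) by (simp only: c(2))
    then have "integrable ?N (\<lambda>w. g (fst w))"
      using c(1) g(1) by (subst (asm) integrable_distr_eq) auto
    then have "integrable \<pi> (\<lambda>w. indicator ?H w *\<^sub>R g (fst w))"
      unfolding integrable_restrict_space[OF H] .
    then show "integrable \<pi> (\<lambda>w. g (fst w))"
      by (subst (asm) Bochner_Integration.integrable_cong[OF refl eq])
    have "(LINT z|\<mu>. g z) = (LINT z|distr ?N \<mu> fst. g z)" by (simp only: c(2))
    also have "\<dots> = (LINT w|?N. g (fst w))"
      using c(1) g(1) by (intro integral_distr) auto
    also have "\<dots> = (LINT w|\<pi>. indicator ?H w *\<^sub>R g (fst w))"
      by (rule integral_restrict_space[OF H])
    also have "\<dots> = (LINT w|\<pi>. g (fst w))"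
      by (intro Bochner_Integration.integral_cong refl eq)
    finally show "(LINT w|\<pi>. g (fst w)) = (LINT z|\<mu>. g z)" by simp }
qed

text \<open>The preceding statements for the swapped coupling; Borel measurability on the plane
  serves the change of variables under the swap.\<close>

lemma
  fixes f :: "real \<times> real \<Rightarrow> ennreal" and g :: "real \<times> real \<Rightarrow> real"
  assumes \<pi>: "\<pi> \<in> couplings \<mu> \<nu>" and sets_\<nu>: "sets \<nu> = sets (restrict_space borel halfplane)"
  shows nn_integral_coupling_snd: "f \<in> borel_measurable borel \<Longrightarrow> (\<And>z. z \<in> diagonal \<Longrightarrow> f z = 0) \<Longrightarrow>
      (\<integral>\<^sup>+ w. f (snd w) \<partial>\<pi>) = (\<integral>\<^sup>+ z. f z \<partial>\<nu>)"
    and integrable_coupling_snd: "g \<in> borel_measurable borel \<Longrightarrow> integrable \<nu> g \<Longrightarrow>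
      (\<And>z. z \<in> diagonal \<Longrightarrow> g z = 0) \<Longrightarrow> integrable \<pi> (\<lambda>w. g (snd w))"
    and integral_coupling_snd: "g \<in> borel_measurable borel \<Longrightarrow> integrable \<nu> g \<Longrightarrow>
      (\<And>z. z \<in> diagonal \<Longrightarrow> g z = 0) \<Longrightarrow> (LINT w|\<pi>. g (snd w)) = (LINT z|\<nu>. g z)"
proof -
  note c = swap_in_couplings[OF \<pi>]
  have m: "prod.swap \<in> measurable \<pi> bar_pairs"
    unfolding measurable_cong_sets[OF couplings_sets(1)[OF \<pi>] refl] by (rule measurable_swap_bar_pairs)
  { assume f: "f \<in> borel_measurable borel" "\<And>z. z \<in> diagonal \<Longrightarrow> f z = 0"
    have "f \<in> borel_measurable \<nu>"
      unfolding measurable_cong_sets[OF sets_\<nu> refl] by (intro measurable_restrict_space1 f)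
    have "(\<integral>\<^sup>+ w. f (fst w) \<partial>distr \<pi> bar_pairs prod.swap) = (\<integral>\<^sup>+ z. f z \<partial>\<nu>)"
      by (rule nn_integral_coupling_fst[OF c(1) sets_\<nu>]) (fact+)
    then show "(\<integral>\<^sup>+ w. f (snd w) \<partial>\<pi>) = (\<integral>\<^sup>+ z. f z \<partial>\<nu>)"
      by (subst (asm) nn_integral_distr[OF m])
         (auto intro: measurable_compose[OF measurable_bar_pairs_fst_snd(1) f(1)]) }
  { assume g: "g \<in> borel_measurable borel" "integrable \<nu> g" "\<And>z. z \<in> diagonal \<Longrightarrow> g z = 0"
    note m' = measurable_compose[OF measurable_bar_pairs_fst_snd(1) g(1)]
    have "integrable (distr \<pi> bar_pairs prod.swap) (\<lambda>w. g (fst w))"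
      by (rule integrable_coupling_fst[OF c(1) sets_\<nu>]) (fact+)
    then show "integrable \<pi> (\<lambda>w. g (snd w))"
      by (subst (asm) integrable_distr_eq[OF m m']) auto
    have "(LINT w|distr \<pi> bar_pairs prod.swap. g (fst w)) = (LINT z|\<nu>. g z)"
      by (rule integral_coupling_fst[OF c(1) sets_\<nu>]) (fact+)
    then show "(LINT w|\<pi>. g (snd w)) = (LINT z|\<nu>. g z)"
      by (subst (asm) integral_distr[OF m m']) auto }
qed

text \<open>Either \<open>d \<le> t * b\<close>, and the first term alone dominates, or
  \<open>b < d / t\<close>, and the second does. The point is that the factor of
  \<open>b powr r\<close> tends to 1 with \<open>t\<close>, which a plain convexity constant
  \<open>2 powr (r - 1)\<close> would not do.\<close>

lemma powr_le_add_powr: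
  fixes a b d r t :: real
  assumes "0 \<le> a" "0 \<le> b" "0 \<le> d" "a \<le> b + d" "0 < t" "0 < r"
  shows "a powr r \<le> (1 + t) powr r * b powr r + (1 + 1 / t) powr r * d powr r"
proof (cases "d \<le> t * b")
  case True
  then have "a \<le> (1 + t) * b" using assms by (simp add: algebra_simps)
  then have "a powr r \<le> ((1 + t) * b) powr r" using assms by (intro powr_mono2) auto
  also have "\<dots> = (1 + t) powr r * b powr r" using assms by (simp add: powr_mult)
  finally show ?thesis by (simp add: add_increasing2)
next
  case False
  then have "b \<le> d / t" using assms by (simp add: field_simps)
  then have "a \<le> (1 + 1 / t) * d" using assms by (simp add: algebra_simps)
  then have "a powr r \<le> ((1 + 1 / t) * d) powr r" using assms by (intro powr_mono2) auto
  also have "\<dots> = (1 + 1 / t) powr r * d powr r" using assms by (simp add: powr_mult)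
  finally show ?thesis by (simp add: add_increasing)
qed

section \<open>Sequences with a common tail bound and estimates for one coupling\<close>

locale tail_bounded_seq =
  fixes p q C :: real and M :: "nat \<Rightarrow> (real \<times> real) measure" and \<mu> :: "(real \<times> real) measure"
  assumes M: "\<And>n. tail_bounded p q C (M n)" and \<mu>: "tail_bounded p q C \<mu>"
begin

sublocale seq: tail_bounded p q C "M n" for n by (rule M)
sublocale lim: tail_bounded p q C \<mu> by (rule \<mu>)

abbreviation masses_tendsto :: "real \<Rightarrow> real \<Rightarrow> bool" where
  "masses_tendsto x \<epsilon> \<equiv> \<epsilon> > 0 \<longrightarrow>
       (\<lambda>n. emeasure (M n) (diag_compl \<epsilon>)) \<longlonglongrightarrow> emeasure \<mu> (diag_compl \<epsilon>)
       \<and> (\<lambda>n. emeasure (M n) (quadrant x \<epsilon>)) \<longlonglongrightarrow> emeasure \<mu> (quadrant x \<epsilon>)"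

abbreviation zetas_tendsto :: "real \<Rightarrow> bool" where
  "zetas_tendsto x \<equiv> \<forall>K. compact K \<and> K \<subseteq> {s. p < Re s \<and> Re s < q} \<longrightarrow>
       uniform_limit K (\<lambda>n. zeta_at x (M n)) (zeta_at x \<mu>) sequentially
       \<and> uniform_limit K (\<lambda>n. zeta (M n)) (zeta \<mu>) sequentially"

end

locale tail_bounded_coupling =
  fst: tail_bounded p q C \<mu> + snd: tail_bounded p q C \<nu> for p q C \<mu> \<nu> +
  fixes \<pi> r \<eta>
  assumes coupling: "\<pi> \<in> couplings \<mu> \<nu>" and r: "p < r" "r < q"
    and \<eta>: "0 < \<eta>" and cost_less: "cost r \<pi> < ennreal \<eta>"
begin

lemma r_pos: "0 < r"
  using r fst.p_ge_1 by linarith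

lemma swap: "tail_bounded_coupling p q C \<nu> \<mu> (distr \<pi> bar_pairs prod.swap) r \<eta>"
  using swap_in_couplings[OF coupling] cost_less r \<eta> fst.tail_bounded_axioms snd.tail_bounded_axioms
  by (simp add: tail_bounded_coupling_def tail_bounded_coupling_axioms_def)

lemma borel_measurable_fst_snd:
  fixes f :: "real \<times> real \<Rightarrow> 'b :: topological_space"
  assumes "f \<in> borel_measurable borel"
  shows "(\<lambda>w. f (fst w)) \<in> borel_measurable \<pi>" "(\<lambda>w. f (snd w)) \<in> borel_measurable \<pi>"
  unfolding measurable_cong_sets[OF couplings_sets(1)[OF coupling] refl]
  by (intro measurable_compose[OF _ assms] measurable_bar_pairs_fst_snd)+

lemma borel_measurable_dinf_powr:
  "(\<lambda>w. ennreal (dinf (fst w) (snd w) powr r)) \<in> borel_measurable \<pi>"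
  unfolding measurable_cong_sets[OF couplings_sets(1)[OF coupling] refl]
  using borel_measurable_cost[of r] by (simp add: case_prod_unfold)

lemma cost_le: "(\<integral>\<^sup>+ w. ennreal (dinf (fst w) (snd w) powr r) \<partial>\<pi>) \<le> ennreal \<eta>"
  using cost_less by (simp add: cost_def case_prod_unfold)

lemma dist_diag_diagonal: "z \<in> diagonal \<Longrightarrow> dist_diag z = 0"
  by (auto simp: diagonal_def dist_diag_eq)

lemma not_diag_compl_diagonal: "z \<in> diagonal \<Longrightarrow> z \<notin> diag_compl \<epsilon>"
  by (auto simp: diagonal_def diag_compl_eq halfplane_eq)

text \<open>Integrates a pointwise comparison over the coupling, the deficit being paid by the cost.
  Moments and masses are both compared through this inequality; \<open>w\<close> ranges over the
  closed half-plane because the coupling lives there.\<close>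

lemma nn_integral_le:
  assumes f: "f \<in> borel_measurable borel" "\<And>z. z \<in> diagonal \<Longrightarrow> f z = 0"
    and g: "g \<in> borel_measurable borel" "\<And>z. z \<in> diagonal \<Longrightarrow> g z = 0"
    and le: "\<And>z w. w \<in> halfplane_bar \<Longrightarrow> f z \<le> g w + ennreal K * ennreal (dinf z w powr r)"
  shows "(\<integral>\<^sup>+ z. f z \<partial>\<mu>) \<le> (\<integral>\<^sup>+ z. g z \<partial>\<nu>) + ennreal K * ennreal \<eta>"
proof -
  note [measurable] = borel_measurable_fst_snd[OF g(1)] borel_measurable_dinf_powr
  have "(\<integral>\<^sup>+ z. f z \<partial>\<mu>) = (\<integral>\<^sup>+ w. f (fst w) \<partial>\<pi>)"
    using f fst.measurable_of_borel by (intro nn_integral_coupling_fst[OF coupling fst.sets_eq, symmetric]) auto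
  also have "\<dots> \<le> (\<integral>\<^sup>+ w. g (snd w) + ennreal K * ennreal (dinf (fst w) (snd w) powr r) \<partial>\<pi>)"
    using le couplings_sets(2)[OF coupling] by (intro nn_integral_mono) auto
  also have "\<dots> = (\<integral>\<^sup>+ w. g (snd w) \<partial>\<pi>) + ennreal K * (\<integral>\<^sup>+ w. ennreal (dinf (fst w) (snd w) powr r) \<partial>\<pi>)"
    by (subst nn_integral_add, measurable, subst nn_integral_cmult) measurable
  also have "(\<integral>\<^sup>+ w. g (snd w) \<partial>\<pi>) = (\<integral>\<^sup>+ z. g z \<partial>\<nu>)"
    by (intro nn_integral_coupling_snd[OF coupling snd.sets_eq] g)
  finally show ?thesis
    by (rule order_trans) (intro add_left_mono mult_left_mono cost_le, simp)
qed

lemma moment_le: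
  assumes "0 < t"
  shows "(LINT z|\<mu>. dist_diag z powr r)
    \<le> (1 + t) powr r * (LINT z|\<nu>. dist_diag z powr r) + (1 + 1 / t) powr r * \<eta>"
proof -
  let ?c = "(1 + t) powr r" and ?K = "(1 + 1 / t) powr r"
  have "(\<integral>\<^sup>+ z. ennreal (dist_diag z powr r) \<partial>\<mu>)
      \<le> (\<integral>\<^sup>+ z. ennreal (?c * dist_diag z powr r) \<partial>\<nu>) + ennreal ?K * ennreal \<eta>"
  proof (rule nn_integral_le)
    fix z w
    have "dist_diag z powr r \<le> ?c * dist_diag w powr r + ?K * dinf z w powr r"
      using assms r_pos by (intro powr_le_add_powr dist_diag_le_add_dinf) auto
    then show "ennreal (dist_diag z powr r) \<le> ennreal (?c * dist_diag w powr r) + ennreal ?K * ennreal (dinf z w powr r)"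
      by (simp add: ennreal_mult[symmetric] ennreal_plus[symmetric] ennreal_leI del: ennreal_plus)
  qed (use r_pos in \<open>simp_all add: dist_diag_diagonal\<close>)
  also have "(\<integral>\<^sup>+ z. ennreal (?c * dist_diag z powr r) \<partial>\<nu>) = ennreal (?c * (LINT z|\<nu>. dist_diag z powr r))"
    using snd.integrable_dist_diag_powr[OF r] by (subst nn_integral_eq_integral) auto
  also have "ennreal (?c * (LINT z|\<nu>. dist_diag z powr r)) + ennreal ?K * ennreal \<eta>
      = ennreal (?c * (LINT z|\<nu>. dist_diag z powr r) + ?K * \<eta>)"
    using \<eta> by (subst ennreal_plus) (auto simp: ennreal_mult)
  finally show ?thesis
    using \<eta> by (simp only: nn_integral_eq_integral[OF fst.integrable_dist_diag_powr[OF r]] AE_I2 powr_ge_zero)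
      (subst (asm) ennreal_le_iff, auto intro!: add_nonneg_nonneg mult_nonneg_nonneg integral_nonneg)
qed

text \<open>Markov's inequality for the cost: a point of \<open>A\<close> whose partner misses
  \<open>B\<close> has been moved by at least \<open>d\<close>, so such pairs have mass at most
  \<open>\<eta> / d powr r\<close>.\<close>

lemma measure_le:
  assumes A: "A \<in> sets borel" "A \<subseteq> diag_compl \<delta>" "0 < \<delta>"
    and B: "B \<in> sets borel" "B \<subseteq> diag_compl \<delta>'" "0 < \<delta>'"
    and d: "0 < d" "\<And>z w. z \<in> A \<Longrightarrow> w \<in> halfplane_bar \<Longrightarrow> dinf z w < d \<Longrightarrow> w \<in> B"
  shows "measure \<mu> A \<le> measure \<nu> B + \<eta> / d powr r"
proof -
  have "(\<integral>\<^sup>+ z. indicator A z \<partial>\<mu>) \<le> (\<integral>\<^sup>+ z. indicator B z \<partial>\<nu>) + ennreal (1 / d powr r) * ennreal \<eta>"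
  proof (rule nn_integral_le)
    fix z w assume w: "w \<in> halfplane_bar"
    show "(indicator A z :: ennreal) \<le> indicator B w + ennreal (1 / d powr r) * ennreal (dinf z w powr r)"
    proof (cases "z \<in> A \<and> w \<notin> B")
      case True
      then have "d powr r \<le> dinf z w powr r"
        using d(2)[of z w] w d(1) r_pos by (intro powr_mono2) force+
      then have "1 \<le> 1 / d powr r * dinf z w powr r"
        using d by (simp add: field_simps)
      then have "1 \<le> ennreal (1 / d powr r * dinf z w powr r)"
        using ennreal_leI by fastforce
      then show ?thesis using True by (simp add: ennreal_mult[symmetric])
    qed (auto simp: indicator_def)
  qed (use A B not_diag_compl_diagonal in \<open>auto simp: indicator_def\<close>)
  then have "emeasure \<mu> A \<le> emeasure \<nu> B + ennreal (1 / d powr r) * ennreal \<eta>"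
    using A B diag_compl_subset fst.in_sets[of A] snd.in_sets[of B] by (metis nn_integral_indicator subset_trans)
  then show ?thesis
    using \<eta> unfolding fst.emeasure_eq_measure_if[OF A(3,2)] snd.emeasure_eq_measure_if[OF B(3,2)]
    by (simp add: ennreal_mult[symmetric] ennreal_plus[symmetric] ennreal_le_iff del: ennreal_plus)
qed

text \<open>A pair closer than \<open>d\<close> contributes less than \<open>e\<close>, and only if
  one of its points is in \<open>diag_compl \<delta>\<close>; this is where the two finite masses
  enter. A pair farther apart contributes at most \<open>2 * B\<close>, which is at most
  \<open>2 * B\<close> times \<open>(dinf / d) powr r\<close> and is charged to the cost.\<close>

lemma integral_diff_le:
  assumes f: "test_fun f" and B: "\<And>z. \<bar>f z\<bar> \<le> B" and \<delta>: "0 < \<delta>" "\<And>z. z \<notin> diag_compl \<delta> \<Longrightarrow> f z = 0"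
    and d: "0 < d" "\<And>z w. dinf z w < d \<Longrightarrow> \<bar>f z - f w\<bar> < e"
  shows "\<bar>(LINT z|\<mu>. f z) - (LINT z|\<nu>. f z)\<bar>
    \<le> e * (measure \<mu> (diag_compl \<delta>) + measure \<nu> (diag_compl \<delta>)) + 2 * B / d powr r * \<eta>"
proof -
  have f0: "f z = 0" if "z \<in> diagonal" for z
    using \<delta>(2) not_diag_compl_diagonal[OF that] by blast
  have B0: "0 \<le> B" using B[of 0] by linarith
  \<comment> \<open>Positivity of \<open>e\<close> is contained in the modulus of continuity,
    evaluated at two equal points.\<close>
  have e0: "0 < e" using d(2)[of 0 0] d(1) by (simp add: dinf_def)
  note mf = test_fun_measurable[OF f]
  have int: "integrable \<pi> (\<lambda>w. f (fst w))" "integrable \<pi> (\<lambda>w. f (snd w))"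
    by (intro integrable_coupling_fst[OF coupling fst.sets_eq]
        integrable_coupling_snd[OF coupling snd.sets_eq] f0 mf
        fst.integrable_test_fun snd.integrable_test_fun f; assumption)+
  let ?D = "indicator (diag_compl \<delta>) :: _ \<Rightarrow> ennreal"
  have mD: "?D \<in> borel_measurable borel" by auto
  have "(LINT z|\<mu>. f z) - (LINT z|\<nu>. f z) = (LINT w|\<pi>. f (fst w)) - (LINT w|\<pi>. f (snd w))"
    using f0 mf fst.integrable_test_fun snd.integrable_test_fun f
    by (subst integral_coupling_fst[OF coupling fst.sets_eq], simp, simp,
        subst integral_coupling_snd[OF coupling snd.sets_eq]) auto
  also have "\<dots> = (LINT w|\<pi>. f (fst w) - f (snd w))"
    using int by simp
  finally have "ennreal \<bar>(LINT z|\<mu>. f z) - (LINT z|\<nu>. f z)\<bar> \<le> (\<integral>\<^sup>+ w. ennreal \<bar>f (fst w) - f (snd w)\<bar> \<partial>\<pi>)"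
    using integral_norm_bound_ennreal[of \<pi> "\<lambda>w. f (fst w) - f (snd w)"] int by simp
  also have "\<dots> \<le> (\<integral>\<^sup>+ w. (ennreal e * ?D (fst w) + ennreal e * ?D (snd w))
      + ennreal (2 * B / d powr r) * ennreal (dinf (fst w) (snd w) powr r) \<partial>\<pi>)"
  proof (rule nn_integral_mono)
    fix w :: "(real \<times> real) \<times> (real \<times> real)"
    show "ennreal \<bar>f (fst w) - f (snd w)\<bar> \<le> (ennreal e * ?D (fst w) + ennreal e * ?D (snd w))
      + ennreal (2 * B / d powr r) * ennreal (dinf (fst w) (snd w) powr r)"
    proof (cases "dinf (fst w) (snd w) < d")
      case True
      show ?thesis
      proof (cases "fst w \<in> diag_compl \<delta> \<or> snd w \<in> diag_compl \<delta>")
        case T: True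
        have "ennreal \<bar>f (fst w) - f (snd w)\<bar> \<le> ennreal e"
          using d(2)[OF True] by (intro ennreal_leI) auto
        also have "ennreal e \<le> ennreal e * ?D (fst w) + ennreal e * ?D (snd w)"
          using T by (auto simp: indicator_def)
        finally show ?thesis by (simp add: add_increasing2)
      next
        case False
        then show ?thesis using \<delta>(2) by simp
      qed
    next
      case False
      have "\<bar>f (fst w) - f (snd w)\<bar> \<le> 2 * B" using B[of "fst w"] B[of "snd w"] by linarith
      also have "\<dots> \<le> 2 * B * (dinf (fst w) (snd w) powr r / d powr r)"
      proof -
        have "d powr r \<le> dinf (fst w) (snd w) powr r"
          using d False r_pos by (intro powr_mono2) auto
        then have le: "1 \<le> dinf (fst w) (snd w) powr r / d powr r" using d by simp
        show ?thesis using mult_left_mono[OF le, of "2 * B"] B0 by simp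
      qed
      also have "\<dots> = 2 * B / d powr r * dinf (fst w) (snd w) powr r" by simp
      finally have "ennreal \<bar>f (fst w) - f (snd w)\<bar> \<le> ennreal (2 * B / d powr r * dinf (fst w) (snd w) powr r)"
        by (rule ennreal_leI)
      also have "\<dots> = ennreal (2 * B / d powr r) * ennreal (dinf (fst w) (snd w) powr r)"
        using B0 by (intro ennreal_mult) auto
      finally show ?thesis by (simp add: add_increasing)
    qed
  qed
  also have "\<dots> = (ennreal e * (\<integral>\<^sup>+ w. ?D (fst w) \<partial>\<pi>) + ennreal e * (\<integral>\<^sup>+ w. ?D (snd w) \<partial>\<pi>))
      + ennreal (2 * B / d powr r) * (\<integral>\<^sup>+ w. ennreal (dinf (fst w) (snd w) powr r) \<partial>\<pi>)"
  proof -
    note [measurable] = borel_measurable_fst_snd[OF mD] borel_measurable_dinf_powr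
    have "(\<integral>\<^sup>+ w. ennreal (2 * B / d powr r) * ennreal (dinf (fst w) (snd w) powr r) \<partial>\<pi>)
        = ennreal (2 * B / d powr r) * (\<integral>\<^sup>+ w. ennreal (dinf (fst w) (snd w) powr r) \<partial>\<pi>)"
      by (rule nn_integral_cmult) measurable
    then show ?thesis by (simp add: nn_integral_add nn_integral_cmult)
  qed
  also have "(\<integral>\<^sup>+ w. ?D (fst w) \<partial>\<pi>) = emeasure \<mu> (diag_compl \<delta>)"
    using not_diag_compl_diagonal[of _ \<delta>] fst.measurable_of_borel[OF mD]
    by (subst nn_integral_coupling_fst[OF coupling fst.sets_eq]) (auto simp: indicator_def)
  also have "(\<integral>\<^sup>+ w. ?D (snd w) \<partial>\<pi>) = emeasure \<nu> (diag_compl \<delta>)"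
    using not_diag_compl_diagonal[of _ \<delta>] mD
    by (subst nn_integral_coupling_snd[OF coupling snd.sets_eq]) (auto simp: indicator_def)
  also have "(ennreal e * emeasure \<mu> (diag_compl \<delta>) + ennreal e * emeasure \<nu> (diag_compl \<delta>))
      + ennreal (2 * B / d powr r) * (\<integral>\<^sup>+ w. ennreal (dinf (fst w) (snd w) powr r) \<partial>\<pi>)
     \<le> (ennreal e * emeasure \<mu> (diag_compl \<delta>) + ennreal e * emeasure \<nu> (diag_compl \<delta>))
      + ennreal (2 * B / d powr r) * ennreal \<eta>"
    by (intro add_left_mono mult_left_mono cost_le) auto
  also have "\<dots> = ennreal (e * (measure \<mu> (diag_compl \<delta>) + measure \<nu> (diag_compl \<delta>)) + 2 * B / d powr r * \<eta>)"
  proof -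
    have "ennreal e * ennreal x + ennreal e * ennreal y + ennreal K * ennreal \<eta> = ennreal (e * (x + y) + K * \<eta>)"
      if "0 \<le> x" "0 \<le> y" "0 \<le> K" for x y K
      using that e0 \<eta> by (simp add: distrib_left ennreal_mult)
    from this[of "measure \<mu> (diag_compl \<delta>)" "measure \<nu> (diag_compl \<delta>)" "2 * B / d powr r"] show ?thesis
      unfolding fst.emeasure_eq_measure_if[OF \<delta>(1) order_refl] snd.emeasure_eq_measure_if[OF \<delta>(1) order_refl]
      using B0 by auto
  qed
  finally show ?thesis
    using e0 B0 \<eta> by (subst (asm) ennreal_le_iff) (auto intro!: add_nonneg_nonneg mult_nonneg_nonneg)
qed

end

section \<open>Limits forced by couplings of small cost\<close>

context tail_bounded_seq
begin

lemma eventually_coupling: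
  assumes "p < r" "r < q" "(\<lambda>n. dpers r (M n) \<mu>) \<longlonglongrightarrow> 0" "0 < \<eta>"
  shows "\<forall>\<^sub>F n in sequentially. \<exists>\<pi>. tail_bounded_coupling p q C (M n) \<mu> \<pi> r \<eta>"
proof -
  have "0 < r" using assms(1) lim.p_ge_1 by linarith
  from eventually_coupling_if_dpers_tendsto_0[OF this assms(3,4)] show ?thesis
  proof eventually_elim
    case (elim n)
    then show ?case using assms M[of n] \<mu>
      by (auto simp: tail_bounded_coupling_def tail_bounded_coupling_axioms_def)
  qed
qed

lemma vague_converges_if_dpers:
  assumes r: "p < r" "r < q" and lim: "(\<lambda>n. dpers r (M n) \<mu>) \<longlonglongrightarrow> 0"
  shows "vague_converges M \<mu>"
proof -
  have "(\<lambda>n. LINT z|M n. f z) \<longlonglongrightarrow> (LINT z|\<mu>. f z)" if f: "test_fun f" for f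
  proof -
    obtain B where B: "\<And>z. \<bar>f z\<bar> \<le> B" using test_fun_bounded[OF f] by blast
    have B0: "0 \<le> B" using B[of 0] by linarith
    obtain \<delta> where \<delta>: "\<delta> > 0" "\<And>z. z \<notin> diag_compl \<delta> \<Longrightarrow> f z = 0"
      using test_fun_support[OF f] by blast
    define m where "m = 2 * (\<bar>C\<bar> * envelope p q \<delta>) + 1"
    have m0: "0 < m" unfolding m_def by (intro add_nonneg_pos mult_nonneg_nonneg) auto
    show ?thesis
    proof (rule tendstoI)
      fix e :: real assume e: "0 < e"
      obtain d where d: "d > 0" "\<And>z w. dinf z w < d \<Longrightarrow> \<bar>f z - f w\<bar> < e / 2 / m"
        using test_fun_uniformly_continuous[OF f, of "e / 2 / m"] e m0 by auto
      \<comment> \<open>Cancels the factor \<open>2 * B / d powr r\<close> of the estimate; the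
        summand 1 allows \<open>B = 0\<close>.\<close>
      define \<eta> where "\<eta> = e / 4 / (2 * B + 1) * d powr r"
      have \<eta>: "0 < \<eta>" using e B0 d by (auto simp: \<eta>_def intro!: mult_pos_pos divide_pos_pos)
      show "\<forall>\<^sub>F n in sequentially. dist (LINT z|M n. f z) (LINT z|\<mu>. f z) < e"
        using eventually_coupling[OF r lim \<eta>]
      proof eventually_elim
        case (elim n)
        then obtain \<pi> where "tail_bounded_coupling p q C (M n) \<mu> \<pi> r \<eta>" by blast
        then interpret tail_bounded_coupling p q C "M n" \<mu> \<pi> r \<eta> .
        have "\<bar>(LINT z|M n. f z) - (LINT z|\<mu>. f z)\<bar>
          \<le> e / 2 / m * (measure (M n) (diag_compl \<delta>) + measure \<mu> (diag_compl \<delta>)) + 2 * B / d powr r * \<eta>"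
          by (rule integral_diff_le[OF f B \<delta> d])
        also have "measure (M n) (diag_compl \<delta>) + measure \<mu> (diag_compl \<delta>) \<le> m"
          using seq.measure_diag_compl_le[OF \<delta>(1), of n] lim.measure_diag_compl_le[OF \<delta>(1)]
          by (simp add: m_def)
        also have "e / 2 / m * m = e / 2" using m0 by simp
        also have "2 * B / d powr r * \<eta> = e / 4 * (2 * B / (2 * B + 1))"
          using d B0 unfolding \<eta>_def by (simp add: divide_simps)
        also have "e / 4 * (2 * B / (2 * B + 1)) \<le> e / 4 * 1"
          using e B0 by (intro mult_left_mono) auto
        also have "e / 2 + e / 4 * 1 < e" using e by simp
        finally show ?case using m0 e by (simp add: dist_real_def divide_right_mono mult_left_mono)
      qed
    qed
  qed
  then show ?thesis
    by (subst vague_converges_iff) (auto simp: seq.space_eq lim.space_eq)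
qed

text \<open>First \<open>t\<close> is taken so small that the factor \<open>(1 + t) powr r\<close>
  costs at most \<open>e / 2\<close> on any moment below \<open>J\<close>, then
  \<open>\<eta>\<close> absorbs the large constant \<open>(1 + 1 / t) powr r\<close>. The uniform
  moment bound is needed because the reverse inequality has the moment of \<open>M n\<close> on the
  right.\<close>

lemma moment_tendsto_if_dpers:
  assumes r: "p < r" "r < q" and lim: "(\<lambda>n. dpers r (M n) \<mu>) \<longlonglongrightarrow> 0"
  shows "(\<lambda>n. LINT z|M n. dist_diag z powr r) \<longlonglongrightarrow> (LINT z|\<mu>. dist_diag z powr r)"
proof (rule tendstoI)
  fix e :: real assume e: "0 < e"
  define J where "J = \<bar>lim.moment_bound r\<bar> + 1"
  have J: "0 < J" unfolding J_def by linarith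
  have "((\<lambda>t::real. (1 + t) powr r) \<longlongrightarrow> (1 + 0) powr r) (at_right 0)"
    by (intro tendsto_intros) auto
  then have "\<forall>\<^sub>F t in at_right (0::real). (1 + t) powr r < 1 + e / 2 / J"
    using e J by (intro order_tendstoD(2)) auto
  then have "\<forall>\<^sub>F t in at_right (0::real). (1 + t) powr r < 1 + e / 2 / J \<and> 0 < t"
    using eventually_at_right_less[of 0] by eventually_elim auto
  then obtain t where t: "0 < t" "(1 + t) powr r < 1 + e / 2 / J"
    using eventually_happens'[OF trivial_limit_at_right_real[of "0::real"]] by blast
  define \<eta> where "\<eta> = e / 4 / (1 + 1 / t) powr r"
  have K: "0 < (1 + 1 / t) powr r" using add_pos_pos[of 1 "1 / t"] t by simp
  have \<eta>: "0 < \<eta>" using e K by (simp add: \<eta>_def)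
  have *: "a - b < e" if "a \<le> (1 + t) powr r * b + (1 + 1 / t) powr r * \<eta>" "0 \<le> b" "b \<le> lim.moment_bound r"
    for a b
  proof -
    have "(1 + t) powr r * b \<le> (1 + e / 2 / J) * b" using t that by (intro mult_right_mono) auto
    also have "\<dots> = b + e / 2 / J * b" by (simp add: algebra_simps)
    also have "e / 2 / J * b \<le> e / 2 / J * J" using that e J by (intro mult_left_mono) (auto simp: J_def)
    also have "\<dots> = e / 2" using J by simp
    finally have "(1 + t) powr r * b \<le> b + e / 2" by simp
    moreover have "(1 + 1 / t) powr r * \<eta> = e / 4" using K by (simp add: \<eta>_def)
    ultimately show ?thesis using that(1) e by linarith
  qed
  show "\<forall>\<^sub>F n in sequentially. dist (LINT z|M n. dist_diag z powr r) (LINT z|\<mu>. dist_diag z powr r) < e"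
    using eventually_coupling[OF r lim \<eta>]
  proof eventually_elim
    case (elim n)
    then obtain \<pi> where \<pi>: "tail_bounded_coupling p q C (M n) \<mu> \<pi> r \<eta>" by blast
    have "(LINT z|M n. dist_diag z powr r) - (LINT z|\<mu>. dist_diag z powr r) < e"
      by (intro * tail_bounded_coupling.moment_le[OF \<pi> t(1)] lim.integral_dist_diag_powr_le r integral_nonneg) auto
    moreover have "(LINT z|\<mu>. dist_diag z powr r) - (LINT z|M n. dist_diag z powr r) < e"
      by (intro * tail_bounded_coupling.moment_le[OF tail_bounded_coupling.swap[OF \<pi>] t(1)]
          seq.integral_dist_diag_powr_le r integral_nonneg) auto
    ultimately show ?case by (simp add: dist_real_def abs_less_iff)
  qed
qed

lemma zeta_tendsto_if_dpers:
  assumes "p < r" "r < q" and "(\<lambda>n. dpers r (M n) \<mu>) \<longlonglongrightarrow> 0"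
  shows "(\<lambda>n. zeta (M n) (complex_of_real r)) \<longlonglongrightarrow> zeta \<mu> (complex_of_real r)"
  unfolding seq.zeta_of_real[OF assms(1,2)] lim.zeta_of_real[OF assms(1,2)]
  by (intro tendsto_of_real moment_tendsto_if_dpers assms)

text \<open>A portmanteau argument by hand. \<open>A\<close> is squeezed between \<open>L k\<close>,
  which increases to the interior, and its neighbourhood \<open>U k\<close>, which decreases to
  \<open>A\<close> by closedness; a null boundary makes both masses tend to that of
  \<open>A\<close>, and mass crossing the gap \<open>d k\<close> is paid for by the cost.\<close>

lemma emeasure_tendsto_if_dpers:
  assumes r: "p < r" "r < q" and lim: "(\<lambda>n. dpers r (M n) \<mu>) \<longlonglongrightarrow> 0"
    and A: "closed A" "A \<subseteq> diag_compl \<delta>" "0 < \<delta>" and null: "emeasure \<mu> (A - interior A) = 0"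
  shows "(\<lambda>n. emeasure (M n) A) \<longlonglongrightarrow> emeasure \<mu> A"
proof -
  \<comment> \<open>Radii at most \<open>\<delta> / 2\<close> keep the neighbourhoods in
    \<open>diag_compl (\<delta> / 2)\<close>, hence of finite mass, as continuity from above
    requires.\<close>
  define d where "d k = \<delta> / 2 / real (Suc k)" for k
  have d: "0 < d k" for k using A by (simp add: d_def)
  have d_le: "d k \<le> \<delta> / 2" for k
    using divide_left_mono[of 1 "real (Suc k)" "\<delta> / 2"] A by (simp add: d_def)
  have d_dec: "d l \<le> d k" if "k \<le> l" for k l
    unfolding d_def using A that by (intro divide_left_mono) auto
  have d_lim: "\<exists>k. d k < e" if "0 < e" for e
  proof -
    have "(\<lambda>k. \<delta> / 2 * inverse (real (Suc k))) \<longlonglongrightarrow> \<delta> / 2 * 0"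
      by (intro tendsto_intros LIMSEQ_inverse_real_of_nat)
    then have "\<forall>\<^sub>F k in sequentially. d k < e"
      using that by (intro order_tendstoD(2)) (auto simp: d_def field_simps)
    then show ?thesis using eventually_happens'[OF sequentially_bot] by blast
  qed
  define U where "U k = {w \<in> halfplane_bar. \<exists>z\<in>A. dinf z w < d k}" for k
  define L where "L k = {z \<in> A. \<forall>w. dinf z w < d k \<longrightarrow> w \<in> A}" for k
  have op: "open {w. dinf z w < c}" for z c
    unfolding dinf_def by (intro open_Collect_less continuous_intros)
  have U_eq: "U k = halfplane_bar \<inter> (\<Union>z\<in>A. {w. dinf z w < d k})" for k
    by (auto simp: U_def)
  have L_eq: "L k = A - (\<Union>w\<in>-A. {z. dinf w z < d k})" for k
    by (auto simp: L_def dinf_commute)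
  have UB: "U k \<in> sets borel" "U k \<subseteq> diag_compl (\<delta> / 2)" for k
  proof -
    have "open (\<Union>z\<in>A. {w. dinf z w < d k})" by (intro open_UN ballI op)
    then show "U k \<in> sets borel" unfolding U_eq by auto
    show "U k \<subseteq> diag_compl (\<delta> / 2)"
    proof
      fix w assume "w \<in> U k"
      then obtain z where z: "w \<in> halfplane_bar" "z \<in> A" "dinf z w < d k" by (auto simp: U_def)
      then have "\<delta> \<le> dist_diag z" using A by (auto simp: diag_compl_eq)
      then have "\<delta> / 2 \<le> dist_diag w" using z d_le[of k] dist_diag_le_add_dinf[of z w] by linarith
      then show "w \<in> diag_compl (\<delta> / 2)" using z A by (simp add: diag_compl_iff)
    qed
  qed
  have LB: "L k \<in> sets borel" "L k \<subseteq> diag_compl \<delta>" for k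
  proof -
    have "open (\<Union>w\<in>-A. {z. dinf w z < d k})" by (intro open_UN ballI op)
    then show "L k \<in> sets borel" using A unfolding L_eq by auto
    show "L k \<subseteq> diag_compl \<delta>" using A by (auto simp: L_def)
  qed
  have AB: "A \<in> sets borel" using A by auto
  have [simp]: "A \<subseteq> halfplane" "interior A \<subseteq> halfplane" "\<And>k. U k \<subseteq> halfplane" "\<And>k. L k \<subseteq> halfplane"
    using A LB UB diag_compl_subset interior_subset[of A] by blast+
  have "(\<Inter>k. U k) = A"
  proof
    show "A \<subseteq> (\<Inter>k. U k)"
    proof (intro subsetI INT_I)
      fix z k assume "z \<in> A"
      then have "z \<in> halfplane_bar" using \<open>A \<subseteq> halfplane\<close> halfplane_subset_bar by blast
      moreover have "dinf z z < d k" using d by (simp add: dinf_def)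
      ultimately show "z \<in> U k" using \<open>z \<in> A\<close> by (auto simp: U_def)
    qed
    show "(\<Inter>k. U k) \<subseteq> A"
    proof
      fix w assume w: "w \<in> (\<Inter>k. U k)"
      have "w \<in> closure A"
        unfolding closure_approachable
      proof (intro allI impI)
        fix e :: real assume "0 < e"
        then obtain k where k: "d k < e / 2" using d_lim[of "e / 2"] by auto
        from w have "w \<in> U k" by blast
        then obtain z where "z \<in> A" "dinf z w < d k" unfolding U_def by blast
        then show "\<exists>y\<in>A. dist y w < e" using k dist_le_dinf[of z w] by (intro bexI[of _ z]) auto
      qed
      then show "w \<in> A" using A by simp
    qed
  qed
  moreover have "(\<lambda>k. measure \<mu> (U k)) \<longlonglongrightarrow> measure \<mu> (\<Inter>k. U k)"
  proof (rule Lim_measure_decseq)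
    show "range U \<subseteq> sets \<mu>" by (intro image_subsetI lim.in_sets UB(1)) simp
    show "decseq U" using d_dec unfolding decseq_def U_def by (fastforce intro: less_le_trans)
    show "emeasure \<mu> (U k) \<noteq> \<infinity>" for k
      using lim.finite_if_subset[OF _ UB(2)[of k]] A by auto
  qed
  ultimately have limU: "(\<lambda>k. measure \<mu> (U k)) \<longlonglongrightarrow> measure \<mu> A" by simp
  have "(\<Union>k. L k) = interior A"
  proof
    show "(\<Union>k. L k) \<subseteq> interior A"
    proof
      fix z assume "z \<in> (\<Union>k. L k)"
      then obtain k where k: "\<And>w. dinf z w < d k \<Longrightarrow> w \<in> A" by (auto simp: L_def)
      have "ball z (d k) \<subseteq> A"
      proof
        fix w assume "w \<in> ball z (d k)"
        then have "dinf z w < d k" using dinf_le_dist[of z w] by simp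
        then show "w \<in> A" by (rule k)
      qed
      then show "z \<in> interior A" using d[of k] by (auto simp: mem_interior)
    qed
    show "interior A \<subseteq> (\<Union>k. L k)"
    proof
      fix z assume "z \<in> interior A"
      then obtain e where e: "0 < e" "ball z e \<subseteq> A" by (auto simp: mem_interior)
      then obtain k where "d k < e / 2" using d_lim[of "e / 2"] by auto
      then have "w \<in> A" if "dinf z w < d k" for w
        using that dist_le_dinf[of z w] by (intro subsetD[OF e(2)]) simp
      moreover have "z \<in> A" using e by auto
      ultimately show "z \<in> (\<Union>k. L k)" by (auto simp: L_def)
    qed
  qed
  moreover have "(\<lambda>k. measure \<mu> (L k)) \<longlonglongrightarrow> measure \<mu> (\<Union>k. L k)"
  proof (rule Lim_measure_incseq)
    show "range L \<subseteq> sets \<mu>" by (intro image_subsetI lim.in_sets LB(1)) simp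
    show "incseq L" using d_dec unfolding incseq_def L_def by (fastforce intro: less_le_trans)
    show "emeasure \<mu> (\<Union>k. L k) \<noteq> \<infinity>"
      using lim.finite_if_subset[OF A(3), of "\<Union>k. L k"] LB(2) by (auto simp: less_top)
  qed
  moreover have "measure \<mu> (interior A) = measure \<mu> A"
  proof -
    have "emeasure \<mu> A = emeasure \<mu> (interior A) + emeasure \<mu> (A - interior A)"
    proof (subst plus_emeasure)
      show "interior A \<in> sets \<mu>" by (intro lim.in_sets) auto
      show "A - interior A \<in> sets \<mu>"
        by (intro lim.in_sets sets.Diff AB subset_trans[OF Diff_subset \<open>A \<subseteq> halfplane\<close>]) auto
    qed (use interior_subset[of A] in \<open>auto intro: arg_cong[where f = "emeasure \<mu>"]\<close>)
    then show ?thesis using null by (simp add: measure_def)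
  qed
  ultimately have limL: "(\<lambda>k. measure \<mu> (L k)) \<longlonglongrightarrow> measure \<mu> A" by simp
  have "(\<lambda>n. measure (M n) A) \<longlonglongrightarrow> measure \<mu> A"
  proof (rule tendstoI)
    fix e :: real assume e: "0 < e"
    have "\<forall>\<^sub>F k in sequentially. measure \<mu> (U k) < measure \<mu> A + e / 2 \<and> measure \<mu> A - e / 2 < measure \<mu> (L k)"
      using e by (intro eventually_conj order_tendstoD(2)[OF limU] order_tendstoD(1)[OF limL]) auto
    then obtain k where k: "measure \<mu> (U k) < measure \<mu> A + e / 2" "measure \<mu> A - e / 2 < measure \<mu> (L k)"
      using eventually_happens'[OF sequentially_bot] by blast
    define \<eta> where "\<eta> = e / 2 * d k powr r"
    have \<eta>: "0 < \<eta>" "\<eta> / d k powr r = e / 2" using e d[of k] by (auto simp: \<eta>_def)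
    show "\<forall>\<^sub>F n in sequentially. dist (measure (M n) A) (measure \<mu> A) < e"
      using eventually_coupling[OF r lim \<eta>(1)]
    proof eventually_elim
      case (elim n)
      then obtain \<pi> where \<pi>: "tail_bounded_coupling p q C (M n) \<mu> \<pi> r \<eta>" by blast
      have "measure (M n) A \<le> measure \<mu> (U k) + \<eta> / d k powr r"
        by (rule tail_bounded_coupling.measure_le[OF \<pi> AB A(2,3) UB _ d])
           (use A(3) in \<open>auto simp: U_def\<close>)
      moreover have "measure \<mu> (L k) \<le> measure (M n) A + \<eta> / d k powr r"
        by (rule tail_bounded_coupling.measure_le[OF tail_bounded_coupling.swap[OF \<pi>] LB A(3) AB A(2,3) d])
           (auto simp: L_def)
      ultimately show ?case using k \<eta> by (auto simp: dist_real_def)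
    qed
  qed
  then show ?thesis
    unfolding seq.emeasure_eq_measure_if[OF A(3,2)] lim.emeasure_eq_measure_if[OF A(3,2)]
    by (rule tendsto_ennrealI)
qed

end

section \<open>Almost every quadrant and level has null boundary\<close>

context tail_bounded
begin

text \<open>For fixed \<open>z\<close> the parameters \<open>w = (x, \<epsilon>)\<close> whose
  boundary meets \<open>z\<close> lie on three lines, a null set. Exchanging the integrals, almost
  every parameter has boundary lines of \<open>\<mu>\<close>-mass 0.\<close>

lemma AE_null_lines:
  "AE w in lborel. emeasure \<mu> {z \<in> halfplane. fst z = fst w \<or> snd z = fst w + snd w \<or> dist_diag z = snd w} = 0"
proof -
  interpret pair_sigma_finite \<mu> "lborel :: (real \<times> real) measure"
    by (intro pair_sigma_finite.intro sigma_finite sigma_finite_lborel)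
  let ?P = "\<lambda>z w. fst z = fst w \<or> snd z = fst w + snd w \<or> dist_diag z = snd (w :: real \<times> real)"
  have "emeasure lborel {w :: real \<times> real. ?P z w} = 0" for z
  proof -
    have "negligible {w :: real \<times> real. (1, 0) \<bullet> w = fst z}" "negligible {w :: real \<times> real. (1, 1) \<bullet> w = snd z}"
      "negligible {w :: real \<times> real. (0, 1) \<bullet> w = dist_diag z}"
      by (intro negligible_hyperplane; simp add: zero_prod_def)+
    then have "negligible ({w :: real \<times> real. (1, 0) \<bullet> w = fst z} \<union> {w. (1, 1) \<bullet> w = snd z} \<union> {w. (0, 1) \<bullet> w = dist_diag z})"
      by (intro negligible_Un)
    moreover have "{w :: real \<times> real. ?P z w} = \<dots>"
      by (auto simp: inner_prod_def)
    ultimately have "negligible {w :: real \<times> real. ?P z w}" by simp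
    then show ?thesis
      by (simp add: negligible_iff_emeasure0)
  qed
  moreover have "(\<integral>\<^sup>+ w. indicator {v. ?P (fst v) (snd v)} (z, w) \<partial>lborel) = emeasure lborel {w. ?P z w}" for z
  proof -
    have "{w. ?P z w} \<in> sets lborel" by measurable
    moreover have "(\<lambda>w. indicator {v. ?P (fst v) (snd v)} (z, w)) = (indicator {w. ?P z w} :: _ \<Rightarrow> ennreal)"
      by (auto simp: indicator_def)
    ultimately show ?thesis by simp
  qed
  ultimately have "(\<integral>\<^sup>+ z. (\<integral>\<^sup>+ w. indicator {v. ?P (fst v) (snd v)} (z, w) \<partial>lborel) \<partial>\<mu>) = 0"
    by simp
  then have "(\<integral>\<^sup>+ w. (\<integral>\<^sup>+ z. indicator {v. ?P (fst v) (snd v)} (z, w) \<partial>\<mu>) \<partial>lborel) = 0"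
    by (subst Fubini') simp_all
  then have "AE w in lborel. (\<integral>\<^sup>+ z. indicator {v. ?P (fst v) (snd v)} (z, w) \<partial>\<mu>) = 0"
    by (subst (asm) nn_integral_0_iff_AE) simp_all
  then show ?thesis
  proof eventually_elim
    case (elim w)
    have "{z \<in> halfplane. ?P z w} \<in> sets borel" by measurable
    then have "{z \<in> halfplane. ?P z w} \<in> sets \<mu>" by (rule in_sets) auto
    then have "emeasure \<mu> {z \<in> halfplane. ?P z w} = (\<integral>\<^sup>+ z. indicator {z \<in> halfplane. ?P z w} z \<partial>\<mu>)"
      by (rule nn_integral_indicator[symmetric])
    also have "\<dots> = (\<integral>\<^sup>+ z. indicator {v. ?P (fst v) (snd v)} (z, w) \<partial>\<mu>)"
      by (intro nn_integral_cong) (auto simp: indicator_def space_eq)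
    finally show ?case using elim by simp
  qed
qed

end

section \<open>Mellin transforms\<close>

text \<open>Outside the exceptional parameters of \<open>AE_null_lines\<close>, what the closed sets
  lose on passing to an open subset is contained in the null lines.\<close>

lemma (in tail_bounded_seq) AE_tendsto_if_dpers:
  assumes r: "p < r" "r < q" and lim: "(\<lambda>n. dpers r (M n) \<mu>) \<longlonglongrightarrow> 0"
  shows "AE (x, \<epsilon>) in lborel. masses_tendsto x \<epsilon>"
  using lim.AE_null_lines
proof eventually_elim
  case (elim w)
  obtain x \<epsilon> where w: "w = (x, \<epsilon>)" by (cases w)
  let ?N = "{z \<in> halfplane. fst z = x \<or> snd z = x + \<epsilon> \<or> dist_diag z = \<epsilon>}"
  have "?N \<in> sets borel" by measurable
  then have N: "?N \<in> null_sets \<mu>"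
    using elim by (intro null_setsI lim.in_sets) (auto simp: w)
  have null: "emeasure \<mu> (A - interior A) = 0" if "A \<subseteq> halfplane" "open B" "B \<subseteq> A" "A - B \<subseteq> ?N" for A B
  proof -
    have "A - interior A \<subseteq> ?N" using that interior_maximal[OF that(3,2)] by blast
    then have "emeasure \<mu> (A - interior A) \<le> emeasure \<mu> ?N"
      using null_setsD2[OF N] by (rule emeasure_mono)
    then show ?thesis unfolding null_setsD1[OF N] by simp
  qed
  show ?case
    unfolding w prod.case
  proof (intro impI conjI)
    assume \<epsilon>: "0 < \<epsilon>"
    have "emeasure \<mu> (diag_compl \<epsilon> - interior (diag_compl \<epsilon>)) = 0"
    proof (rule null)
      show "open {z :: real \<times> real. 2 * \<epsilon> < snd z - fst z}"
        by (intro open_Collect_less continuous_intros)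
    qed (use \<epsilon> in \<open>auto simp: diag_compl_eq' halfplane_eq dist_diag_eq\<close>)
    then show "(\<lambda>n. emeasure (M n) (diag_compl \<epsilon>)) \<longlonglongrightarrow> emeasure \<mu> (diag_compl \<epsilon>)"
      by (rule emeasure_tendsto_if_dpers[OF r lim closed_diag_compl[OF \<epsilon>] order_refl \<epsilon>])
    have "emeasure \<mu> (quadrant x \<epsilon> - interior (quadrant x \<epsilon>)) = 0"
    proof (rule null)
      show "open ({..<x} \<times> {x + \<epsilon><..})" by (intro open_Times) auto
    qed (use \<epsilon> in \<open>auto simp: quadrant_def halfplane_eq\<close>)
    then show "(\<lambda>n. emeasure (M n) (quadrant x \<epsilon>)) \<longlonglongrightarrow> emeasure \<mu> (quadrant x \<epsilon>)"
      using \<epsilon> by (intro emeasure_tendsto_if_dpers[OF r lim closed_quadrant quadrant_subset_diag_compl]) auto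
  qed
qed

definition mellin :: "(real \<Rightarrow> real) \<Rightarrow> complex \<Rightarrow> complex" where
  "mellin H s = (LINT \<epsilon>:{0<..}|lborel. complex_of_real \<epsilon> powr (s - 1) * complex_of_real (H \<epsilon>))"

lemma mellin_cong: "(\<And>\<epsilon>. 0 < \<epsilon> \<Longrightarrow> H \<epsilon> = H' \<epsilon>) \<Longrightarrow> mellin H s = mellin H' s"
  unfolding mellin_def by (intro set_lebesgue_integral_cong) auto

text \<open>Abstracts the tail masses \<open>diag_compl\<close> and the quadrant masses at fixed
  \<open>x\<close>, so that the Mellin arguments are given once for both.\<close>

locale enveloped =
  fixes p q K :: real and H :: "real \<Rightarrow> real"
  assumes H_borel [measurable]: "H \<in> borel_measurable borel"
    and H_nonneg: "\<And>\<epsilon>. 0 < \<epsilon> \<Longrightarrow> 0 \<le> H \<epsilon>"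
    and H_le: "\<And>\<epsilon>. 0 < \<epsilon> \<Longrightarrow> H \<epsilon> \<le> K * envelope p q \<epsilon>"
begin

lemma K_envelope_nonneg: "0 < \<epsilon> \<Longrightarrow> 0 \<le> K * envelope p q \<epsilon>"
  using H_nonneg[of \<epsilon>] H_le[of \<epsilon>] by linarith

lemma mellin_integrand_borel_measurable [measurable]:
  "(\<lambda>\<epsilon>. indicator {0<..} \<epsilon> *\<^sub>R (complex_of_real \<epsilon> powr (s - 1) * complex_of_real (H \<epsilon>))) \<in> borel_measurable borel"
proof -
  have "(\<lambda>\<epsilon>. indicator {0<..} \<epsilon> *\<^sub>R (complex_of_real \<epsilon> powr (s - 1))) \<in> borel_measurable borel"
    by (intro borel_measurable_continuous_on_indicator continuous_intros) auto
  then have "(\<lambda>\<epsilon>. (indicator {0<..} \<epsilon> *\<^sub>R (complex_of_real \<epsilon> powr (s - 1))) * complex_of_real (H \<epsilon>)) \<in> borel_measurable borel"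
    by measurable
  then show ?thesis by simp
qed

lemma norm_mellin_integrand_le:
  assumes "0 < \<epsilon>"
  shows "norm (complex_of_real \<epsilon> powr (s - 1) * complex_of_real (H \<epsilon>)) \<le> K * (\<epsilon> powr (Re s - 1) * envelope p q \<epsilon>)"
proof -
  have "norm (complex_of_real \<epsilon> powr (s - 1) * complex_of_real (H \<epsilon>)) = \<epsilon> powr (Re s - 1) * H \<epsilon>"
    using assms H_nonneg by (simp add: norm_mult norm_powr_real_powr)
  also have "\<dots> \<le> \<epsilon> powr (Re s - 1) * (K * envelope p q \<epsilon>)"
    using assms by (intro mult_left_mono H_le) auto
  finally show ?thesis by (simp add: ac_simps)
qed

lemma set_integrable_mellin:
  assumes "p < Re s" "Re s < q"
  shows "set_integrable lborel {0<..} (\<lambda>\<epsilon>. complex_of_real \<epsilon> powr (s - 1) * complex_of_real (H \<epsilon>))"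
  unfolding set_integrable_def
proof (rule Bochner_Integration.integrable_bound)
  show "integrable lborel (\<lambda>\<epsilon>. K * (indicator {0<..} \<epsilon> * (\<epsilon> powr (Re s - 1) * envelope p q \<epsilon>)))"
    using integrable_powr_envelope[OF assms] by (intro integrable_mult_right) auto
  show "AE \<epsilon> in lborel. norm (indicat_real {0<..} \<epsilon> *\<^sub>R (complex_of_real \<epsilon> powr (s - 1) * complex_of_real (H \<epsilon>)))
      \<le> norm (K * (indicator {0<..} \<epsilon> * (\<epsilon> powr (Re s - 1) * envelope p q \<epsilon>)))"
  proof (rule AE_I2)
    fix \<epsilon> :: real
    show "norm (indicat_real {0<..} \<epsilon> *\<^sub>R (complex_of_real \<epsilon> powr (s - 1) * complex_of_real (H \<epsilon>)))
      \<le> norm (K * (indicator {0<..} \<epsilon> * (\<epsilon> powr (Re s - 1) * envelope p q \<epsilon>)))"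
      using norm_mellin_integrand_le[of \<epsilon> s] by (cases "0 < \<epsilon>") auto
  qed
qed measurable

end

text \<open>The smaller exponent dominates up to 1 and the larger one beyond. Thus two powers bound
  the modulus of \<open>\<epsilon> powr (s - 1)\<close> for all \<open>s\<close> with real part in
  an interval.\<close>

lemma powr_le_add_powr_interval:
  fixes \<epsilon> :: real
  assumes "0 < \<epsilon>" "a \<le> c" "c \<le> b"
  shows "\<epsilon> powr c \<le> \<epsilon> powr a + \<epsilon> powr b"
proof (cases "\<epsilon> \<le> 1")
  case True
  then have "\<epsilon> powr c \<le> \<epsilon> powr a" using assms by (intro powr_mono') auto
  then show ?thesis by (simp add: add_increasing2)
next
  case False
  then have "\<epsilon> powr c \<le> \<epsilon> powr b" using assms by (intro powr_mono) auto
  then show ?thesis by (simp add: add_increasing)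
qed

text \<open>The real parts on \<open>S\<close> range between two attained values \<open>a\<close>
  and \<open>b\<close> inside the strip. Replacing the power by the sum of the two extreme ones
  gives a majorant \<open>D n\<close> of the difference that does not depend on \<open>s\<close>, so
  a single dominated convergence is uniform on \<open>S\<close>.\<close>

lemma uniform_limit_mellin:
  assumes H: "\<And>n. enveloped p q K (Hn n)" "enveloped p q K H"
    and conv: "AE \<epsilon> in lborel. 0 < \<epsilon> \<longrightarrow> (\<lambda>n. Hn n \<epsilon>) \<longlonglongrightarrow> H \<epsilon>"
    and S: "compact S" "S \<subseteq> {s. p < Re s \<and> Re s < q}"
  shows "uniform_limit S (\<lambda>n s. s * mellin (Hn n) s) (\<lambda>s. s * mellin H s) sequentially"
proof (cases "S = {}")
  case False
  interpret n: enveloped p q K "Hn n" for n by (rule H)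
  interpret l: enveloped p q K H by (rule H)
  obtain s0 where s0: "s0 \<in> S" "\<And>s. s \<in> S \<Longrightarrow> Re s0 \<le> Re s"
    using continuous_attains_inf[OF S(1) False continuous_on_Re[OF continuous_on_id]] by auto
  obtain s1 where s1: "s1 \<in> S" "\<And>s. s \<in> S \<Longrightarrow> Re s \<le> Re s1"
    using continuous_attains_sup[OF S(1) False continuous_on_Re[OF continuous_on_id]] by auto
  define a b where "a = Re s0" "b = Re s1"
  have ab: "p < a" "a < q" "p < b" "b < q" using s0(1) s1(1) S(2) by (auto simp: a_b_def)
  obtain R where R: "0 < R" "\<And>s. s \<in> S \<Longrightarrow> norm s \<le> R"
    using compact_imp_bounded[OF S(1)] by (auto simp: bounded_pos)
  define w where "w \<epsilon> = 2 * K * (indicator {0<..} \<epsilon> * (\<epsilon> powr (a - 1) * envelope p q \<epsilon>)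
     + indicator {0<..} \<epsilon> * (\<epsilon> powr (b - 1) * envelope p q \<epsilon>))" for \<epsilon>
  define D where "D n \<epsilon> = indicator {0<..} \<epsilon> * ((\<epsilon> powr (a - 1) + \<epsilon> powr (b - 1)) * \<bar>Hn n \<epsilon> - H \<epsilon>\<bar>)" for n \<epsilon>
  have w: "integrable lborel w"
    unfolding w_def[abs_def] using ab
    by (intro integrable_mult_right Bochner_Integration.integrable_add integrable_powr_envelope) auto
  have D_le: "norm (D n \<epsilon>) \<le> w \<epsilon>" for n \<epsilon>
  proof (cases "0 < \<epsilon>")
    case True
    have "\<bar>Hn n \<epsilon> - H \<epsilon>\<bar> \<le> 2 * K * envelope p q \<epsilon>"
      using n.H_le[OF True, of n] n.H_nonneg[OF True, of n] l.H_le[OF True] l.H_nonneg[OF True] by simp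
    then have "(\<epsilon> powr (a - 1) + \<epsilon> powr (b - 1)) * \<bar>Hn n \<epsilon> - H \<epsilon>\<bar>
        \<le> (\<epsilon> powr (a - 1) + \<epsilon> powr (b - 1)) * (2 * K * envelope p q \<epsilon>)"
      by (intro mult_left_mono) auto
    then show ?thesis using True by (simp add: D_def w_def algebra_simps)
  qed (auto simp: D_def w_def)
  have D_int: "integrable lborel (D n)" for n
  proof (rule Bochner_Integration.integrable_bound[OF w])
    show "D n \<in> borel_measurable lborel" unfolding D_def[abs_def] by measurable
    show "AE \<epsilon> in lborel. norm (D n \<epsilon>) \<le> norm (w \<epsilon>)"
      by (intro AE_I2 order_trans[OF D_le]) simp
  qed
  have "(\<lambda>n. LINT \<epsilon>|lborel. D n \<epsilon>) \<longlonglongrightarrow> (LINT \<epsilon>|(lborel :: real measure). (0::real))"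
  proof (rule integral_dominated_convergence[where w = w and s = D and f = "\<lambda>_. 0"])
    show "D n \<in> borel_measurable lborel" for n using D_int[of n] by auto
    show "AE \<epsilon> in lborel. (\<lambda>n. D n \<epsilon>) \<longlonglongrightarrow> 0"
      using conv
    proof eventually_elim
      case (elim \<epsilon>)
      show ?case
      proof (cases "0 < \<epsilon>")
        case True
        with elim have "(\<lambda>n. \<bar>Hn n \<epsilon> - H \<epsilon>\<bar>) \<longlonglongrightarrow> 0"
          by (simp add: LIM_zero_iff tendsto_rabs_zero_iff)
        then have "(\<lambda>n. indicator {0<..} \<epsilon> * ((\<epsilon> powr (a - 1) + \<epsilon> powr (b - 1)) * \<bar>Hn n \<epsilon> - H \<epsilon>\<bar>)) \<longlonglongrightarrow> 0"
          by (intro tendsto_mult_right_zero)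
        then show ?thesis unfolding D_def .
      qed (simp add: D_def)
    qed
  qed (use w D_le in auto)
  then have D_lim: "(\<lambda>n. R * (LINT \<epsilon>|lborel. D n \<epsilon>)) \<longlonglongrightarrow> 0"
    by (intro tendsto_mult_right_zero) simp
  have bound: "norm (s * mellin (Hn n) s - s * mellin H s) \<le> R * (LINT \<epsilon>|lborel. D n \<epsilon>)" if s: "s \<in> S" for n s
  proof -
    have strip: "p < Re s" "Re s < q" using s S by auto
    have "mellin (Hn n) s - mellin H s =
        (LINT \<epsilon>:{0<..}|lborel. complex_of_real \<epsilon> powr (s - 1) * complex_of_real (Hn n \<epsilon>)
          - complex_of_real \<epsilon> powr (s - 1) * complex_of_real (H \<epsilon>))"
      unfolding mellin_def using n.set_integrable_mellin[OF strip, of n] l.set_integrable_mellin[OF strip]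
      by (intro set_integral_diff(2)[symmetric])
    also have "norm \<dots> \<le> (LINT \<epsilon>|lborel. D n \<epsilon>)"
      unfolding set_lebesgue_integral_def
    proof (rule Bochner_Integration.integral_norm_bound_integral)
      show "integrable lborel (\<lambda>\<epsilon>. indicat_real {0<..} \<epsilon> *\<^sub>R (complex_of_real \<epsilon> powr (s - 1) * complex_of_real (Hn n \<epsilon>)
          - complex_of_real \<epsilon> powr (s - 1) * complex_of_real (H \<epsilon>)))"
        using set_integral_diff(1)[OF n.set_integrable_mellin[OF strip, of n] l.set_integrable_mellin[OF strip]]
        by (simp add: set_integrable_def)
      show "integrable lborel (D n)" by (rule D_int)
      fix \<epsilon> :: real
      show "norm (indicat_real {0<..} \<epsilon> *\<^sub>R (complex_of_real \<epsilon> powr (s - 1) * complex_of_real (Hn n \<epsilon>)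
          - complex_of_real \<epsilon> powr (s - 1) * complex_of_real (H \<epsilon>))) \<le> D n \<epsilon>"
      proof (cases "0 < \<epsilon>")
        case True
        have "norm (complex_of_real \<epsilon> powr (s - 1) * complex_of_real (Hn n \<epsilon>)
          - complex_of_real \<epsilon> powr (s - 1) * complex_of_real (H \<epsilon>)) =
          norm (complex_of_real \<epsilon> powr (s - 1) * complex_of_real (Hn n \<epsilon> - H \<epsilon>))"
          by (simp add: right_diff_distrib)
        also have "\<dots> = \<epsilon> powr (Re s - 1) * \<bar>Hn n \<epsilon> - H \<epsilon>\<bar>"
          using True by (simp only: norm_mult norm_of_real) (simp add: norm_powr_real_powr)
        also have "\<dots> \<le> (\<epsilon> powr (a - 1) + \<epsilon> powr (b - 1)) * \<bar>Hn n \<epsilon> - H \<epsilon>\<bar>"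
          using True s0(2)[OF s] s1(2)[OF s]
          by (intro mult_right_mono powr_le_add_powr_interval) (auto simp: a_b_def)
        finally show ?thesis using True by (simp add: D_def)
      qed (auto simp: D_def)
    qed
    finally have le: "norm (mellin (Hn n) s - mellin H s) \<le> (LINT \<epsilon>|lborel. D n \<epsilon>)" .
    have "norm (s * mellin (Hn n) s - s * mellin H s) = norm s * norm (mellin (Hn n) s - mellin H s)"
      by (simp add: norm_mult right_diff_distrib[symmetric])
    also have "\<dots> \<le> R * (LINT \<epsilon>|lborel. D n \<epsilon>)"
      using R(2)[OF s] le R(1) by (intro mult_mono) auto
    finally show ?thesis .
  qed
  show ?thesis
  proof (rule uniform_limitI)
    fix e :: real assume "0 < e"
    with D_lim have "\<forall>\<^sub>F n in sequentially. R * (LINT \<epsilon>|lborel. D n \<epsilon>) < e"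
      by (rule order_tendstoD(2))
    then show "\<forall>\<^sub>F n in sequentially. \<forall>s\<in>S. dist (s * mellin (Hn n) s) (s * mellin H s) < e"
      by eventually_elim (auto simp: dist_norm intro: le_less_trans[OF bound])
  qed
qed simp

lemma zeta_eq_mellin: "zeta \<mu> s = s * mellin (\<lambda>\<epsilon>. measure \<mu> (diag_compl \<epsilon>)) s"
  by (simp add: zeta_def mellin_def)

text \<open>For positive \<open>\<epsilon>\<close> nothing changes, but the half-quadrant version is
  Borel in \<open>\<epsilon>\<close> on the whole line, as \<open>enveloped\<close> demands.\<close>

lemma zeta_at_eq_mellin: "zeta_at x \<mu> s = s * mellin (\<lambda>\<epsilon>. measure \<mu> (half_quadrant x (x + \<epsilon>))) s"
proof -
  have "zeta_at x \<mu> s = s * mellin (\<lambda>\<epsilon>. measure \<mu> (quadrant x \<epsilon>)) s"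
    by (simp add: zeta_at_def mellin_def)
  then show ?thesis by (simp add: half_quadrant_eq cong: mellin_cong)
qed

context tail_bounded
begin

text \<open>The constant is the one dictated by quadrants, where \<open>\<epsilon>\<close> is
  halved, so that both families share it.\<close>

lemma enveloped_diag_compl: "enveloped p q (\<bar>C\<bar> * 2 powr q) (\<lambda>\<epsilon>. measure \<mu> (diag_compl \<epsilon>))"
proof
  show "(\<lambda>\<epsilon>. measure \<mu> (diag_compl \<epsilon>)) \<in> borel_measurable borel"
    unfolding measure_def by measurable
  fix \<epsilon> :: real assume "0 < \<epsilon>"
  then have "measure \<mu> (diag_compl \<epsilon>) \<le> \<bar>C\<bar> * envelope p q \<epsilon>" by (rule measure_diag_compl_le)
  also have "\<dots> \<le> (\<bar>C\<bar> * envelope p q \<epsilon>) * 2 powr q"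
    using mult_left_mono[of 1 "2 powr q" "\<bar>C\<bar> * envelope p q \<epsilon>"] ge_one_powr_ge_zero[of 2 q] p_ge_1 p_less_q
    by simp
  finally show "measure \<mu> (diag_compl \<epsilon>) \<le> \<bar>C\<bar> * 2 powr q * envelope p q \<epsilon>" by (simp add: ac_simps)
qed auto

lemma envelope_half_le: "0 < \<epsilon> \<Longrightarrow> envelope p q (\<epsilon> / 2) \<le> 2 powr q * envelope p q \<epsilon>"
proof -
  assume "0 < \<epsilon>"
  then have eq: "(\<epsilon> / 2) powr (- a) = 2 powr a * \<epsilon> powr (- a)" for a
    by (simp add: powr_divide powr_minus_divide)
  have "2 powr p * \<epsilon> powr (- p) \<le> 2 powr q * \<epsilon> powr (- p)"
    using p_less_q by (intro mult_right_mono powr_mono) auto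
  then show ?thesis
    unfolding envelope_def eq by (auto simp: min_mult_distrib_left min_le_iff_disj)
qed

lemma enveloped_half_quadrant:
  "enveloped p q (\<bar>C\<bar> * 2 powr q) (\<lambda>\<epsilon>. measure \<mu> (half_quadrant x (x + \<epsilon>)))"
proof
  have "(\<lambda>\<epsilon>. (x, x + \<epsilon>)) \<in> borel_measurable borel"
    by (intro borel_measurable_continuous_onI continuous_intros)
  from measurable_compose[OF this borel_measurable_emeasure_half_quadrant]
  show "(\<lambda>\<epsilon>. measure \<mu> (half_quadrant x (x + \<epsilon>))) \<in> borel_measurable borel"
    unfolding measure_def by simp
  fix \<epsilon> :: real assume \<epsilon>: "0 < \<epsilon>"
  have "measure \<mu> (half_quadrant x (x + \<epsilon>)) \<le> \<bar>C\<bar> * envelope p q (\<epsilon> / 2)"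
    using \<epsilon> measure_quadrant_le[of \<epsilon> x] by (simp add: half_quadrant_eq)
  also have "\<dots> \<le> \<bar>C\<bar> * (2 powr q * envelope p q \<epsilon>)"
    using \<epsilon> by (intro mult_left_mono envelope_half_le) auto
  finally show "measure \<mu> (half_quadrant x (x + \<epsilon>)) \<le> \<bar>C\<bar> * 2 powr q * envelope p q \<epsilon>"
    by (simp add: ac_simps)
qed auto

end

text \<open>A null set of pairs has null sections over almost every \<open>x\<close>; for such
  \<open>x\<close> the masses converge for almost every \<open>\<epsilon>\<close>, which is what
  dominated convergence in \<open>uniform_limit_mellin\<close> takes.\<close>

lemma (in tail_bounded_seq) AE_uniform_limit_zeta:
  assumes conv: "AE (x, \<epsilon>) in lborel. masses_tendsto x \<epsilon>"
  shows "AE x in lborel. zetas_tendsto x"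
proof -
  have "AE x in lborel. AE \<epsilon> in lborel. masses_tendsto x \<epsilon>"
    using lborel_pair.AE_pair[OF conv[folded lborel_prod]] by simp
  then show ?thesis
  proof eventually_elim
    case (elim x)
    have "AE \<epsilon> in lborel. 0 < \<epsilon> \<longrightarrow> (\<lambda>n. measure (M n) (diag_compl \<epsilon>)) \<longlonglongrightarrow> measure \<mu> (diag_compl \<epsilon>)"
      using elim
    proof (eventually_elim, intro impI)
      fix \<epsilon> :: real
      assume "masses_tendsto x \<epsilon>" "\<epsilon> > 0"
      then show "(\<lambda>n. measure (M n) (diag_compl \<epsilon>)) \<longlonglongrightarrow> measure \<mu> (diag_compl \<epsilon>)"
        unfolding measure_def using lim.emeasure_diag_compl_finite[of \<epsilon>] by (intro tendsto_enn2real) auto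
    qed
    moreover have "AE \<epsilon> in lborel. 0 < \<epsilon> \<longrightarrow>
        (\<lambda>n. measure (M n) (half_quadrant x (x + \<epsilon>))) \<longlonglongrightarrow> measure \<mu> (half_quadrant x (x + \<epsilon>))"
      using elim
    proof (eventually_elim, intro impI)
      fix \<epsilon> :: real
      assume "masses_tendsto x \<epsilon>" "\<epsilon> > 0"
      then show "(\<lambda>n. measure (M n) (half_quadrant x (x + \<epsilon>))) \<longlonglongrightarrow> measure \<mu> (half_quadrant x (x + \<epsilon>))"
        unfolding measure_def half_quadrant_eq[OF \<open>\<epsilon> > 0\<close>]
        using lim.finite_if_subset[of "\<epsilon> / 2" "quadrant x \<epsilon>"] quadrant_subset_diag_compl[of \<epsilon> x]
        by (intro tendsto_enn2real) auto
    qed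
    ultimately show ?case
      unfolding zeta_eq_mellin zeta_at_eq_mellin
      by (auto intro!: uniform_limit_mellin[where p = p and q = q and K = "\<bar>C\<bar> * 2 powr q"]
          seq.enveloped_diag_compl lim.enveloped_diag_compl seq.enveloped_half_quadrant lim.enveloped_half_quadrant)
  qed
qed

section \<open>Levy's continuity theorem on a vertical line\<close>

context enveloped
begin

abbreviation weighted :: "real \<Rightarrow> real \<Rightarrow> real" where
  "weighted \<sigma> \<epsilon> \<equiv> indicator {0<..} \<epsilon> * (\<epsilon> powr (\<sigma> - 1) * H \<epsilon>)"

lemma weighted_nonneg: "0 \<le> weighted \<sigma> \<epsilon>"
  using H_nonneg[of \<epsilon>] by (cases "0 < \<epsilon>") auto

lemma integrable_weighted:
  assumes "p < \<sigma>" "\<sigma> < q"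
  shows "integrable lborel (weighted \<sigma>)"
proof (rule Bochner_Integration.integrable_bound)
  show "integrable lborel (\<lambda>\<epsilon>. K * (indicator {0<..} \<epsilon> * (\<epsilon> powr (\<sigma> - 1) * envelope p q \<epsilon>)))"
    using integrable_powr_envelope[OF assms] by (intro integrable_mult_right) auto
  show "AE \<epsilon> in lborel. norm (weighted \<sigma> \<epsilon>) \<le> norm (K * (indicator {0<..} \<epsilon> * (\<epsilon> powr (\<sigma> - 1) * envelope p q \<epsilon>)))"
  proof (rule AE_I2)
    fix \<epsilon> :: real
    have "\<epsilon> powr (\<sigma> - 1) * H \<epsilon> \<le> \<epsilon> powr (\<sigma> - 1) * (K * envelope p q \<epsilon>)" if "0 < \<epsilon>"
      using that by (intro mult_left_mono H_le) auto
    then show "norm (weighted \<sigma> \<epsilon>) \<le> norm (K * (indicator {0<..} \<epsilon> * (\<epsilon> powr (\<sigma> - 1) * envelope p q \<epsilon>)))"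
      using H_nonneg[of \<epsilon>] K_envelope_nonneg[of \<epsilon>] by (cases "0 < \<epsilon>") (auto simp: mult.left_commute[of K])
  qed
qed measurable

definition total :: "real \<Rightarrow> real" where
  "total \<sigma> = (LINT \<epsilon>|lborel. weighted \<sigma> \<epsilon>)"

lemma total_nonneg: "0 \<le> total \<sigma>"
  unfolding total_def by (intro Bochner_Integration.integral_nonneg weighted_nonneg)

text \<open>For positive \<open>\<epsilon>\<close> the imaginary part of the exponent contributes
  \<open>\<epsilon> powr (\<i> * t) = iexp (t * ln \<epsilon>)\<close>: on a vertical line the
  Mellin transform is a Fourier transform in \<open>ln \<epsilon>\<close>.\<close>

lemma mellin_eq_integral:
  "mellin H (complex_of_real \<sigma> + \<i> * complex_of_real t) = (CLINT \<epsilon>|lborel. weighted \<sigma> \<epsilon> *\<^sub>R iexp (t * ln \<epsilon>))"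
  unfolding mellin_def set_lebesgue_integral_def
proof (intro Bochner_Integration.integral_cong refl)
  fix \<epsilon> :: real
  show "indicat_real {0<..} \<epsilon> *\<^sub>R (complex_of_real \<epsilon> powr (complex_of_real \<sigma> + \<i> * complex_of_real t - 1) * complex_of_real (H \<epsilon>))
    = weighted \<sigma> \<epsilon> *\<^sub>R iexp (t * ln \<epsilon>)"
  proof (cases "0 < \<epsilon>")
    case True
    have "complex_of_real \<sigma> + \<i> * complex_of_real t - 1 = complex_of_real (\<sigma> - 1) + \<i> * complex_of_real t" by simp
    then have "complex_of_real \<epsilon> powr (complex_of_real \<sigma> + \<i> * complex_of_real t - 1)
        = complex_of_real \<epsilon> powr complex_of_real (\<sigma> - 1) * complex_of_real \<epsilon> powr (\<i> * complex_of_real t)"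
      by (simp only: powr_add)
    also have "complex_of_real \<epsilon> powr complex_of_real (\<sigma> - 1) = complex_of_real (\<epsilon> powr (\<sigma> - 1))"
      using True by (intro powr_of_real) auto
    also have "complex_of_real \<epsilon> powr (\<i> * complex_of_real t) = iexp (t * ln \<epsilon>)"
      using True by (simp add: powr_def Ln_of_real ac_simps)
    finally show ?thesis using True by (simp add: scaleR_conv_of_real ac_simps)
  qed simp
qed

text \<open>The factor \<open>\<epsilon> powr (\<sigma> - 1) * H \<epsilon>\<close>, normalised and read on a logarithmic scale, has the
  Mellin transform of \<open>H\<close> on the line \<open>Re s = \<sigma>\<close> as its characteristic function.\<close>

definition log_distribution :: "real \<Rightarrow> real measure" where
  "log_distribution \<sigma> = distr (density lborel (\<lambda>\<epsilon>. ennreal (weighted \<sigma> \<epsilon> / total \<sigma>))) borel ln"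

lemma real_distribution_log_distribution:
  assumes "p < \<sigma>" "\<sigma> < q" "0 < total \<sigma>"
  shows "real_distribution (log_distribution \<sigma>)"
proof -
  let ?D = "density lborel (\<lambda>\<epsilon>. ennreal (weighted \<sigma> \<epsilon> / total \<sigma>))"
  have "emeasure ?D (space ?D) = (\<integral>\<^sup>+ \<epsilon>. ennreal (weighted \<sigma> \<epsilon> / total \<sigma>) \<partial>lborel)"
    by (subst emeasure_density) auto
  also have "\<dots> = ennreal (LINT \<epsilon>|lborel. weighted \<sigma> \<epsilon> / total \<sigma>)"
    using weighted_nonneg[where \<sigma> = \<sigma>] total_nonneg[of \<sigma>] integrable_weighted[OF assms(1,2)]
    by (intro nn_integral_eq_integral integrable_divide AE_I2 divide_nonneg_nonneg) auto
  also have "(LINT \<epsilon>|lborel. weighted \<sigma> \<epsilon> / total \<sigma>) = 1"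
    using assms(3) by (simp add: total_def)
  finally have "prob_space ?D" by (intro prob_spaceI) simp
  then have "prob_space (log_distribution \<sigma>)"
    unfolding log_distribution_def by (intro prob_space.prob_space_distr) auto
  then show ?thesis
    by (simp add: real_distribution_def real_distribution_axioms_def log_distribution_def)
qed

text \<open>Positivity of \<open>total \<sigma>\<close> is not assumed: if it is 0, the density is 0
  and the right-hand side is multiplied by \<open>inverse 0 = 0\<close>.\<close>

lemma integral_log_distribution:
  fixes f :: "real \<Rightarrow> 'a :: {banach, second_countable_topology}"
  assumes [measurable]: "f \<in> borel_measurable borel"
  shows "integral\<^sup>L (log_distribution \<sigma>) f = (LINT \<epsilon>|lborel. weighted \<sigma> \<epsilon> *\<^sub>R f (ln \<epsilon>)) /\<^sub>R total \<sigma>"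
proof -
  have "integral\<^sup>L (log_distribution \<sigma>) f = (LINT \<epsilon>|lborel. (weighted \<sigma> \<epsilon> / total \<sigma>) *\<^sub>R f (ln \<epsilon>))"
    unfolding log_distribution_def using weighted_nonneg[where \<sigma> = \<sigma>] total_nonneg[of \<sigma>]
    by (subst integral_distr, simp, simp, subst integral_density)
       (auto intro!: AE_I2 divide_nonneg_nonneg)
  also have "\<dots> = (LINT \<epsilon>|lborel. inverse (total \<sigma>) *\<^sub>R (weighted \<sigma> \<epsilon> *\<^sub>R f (ln \<epsilon>)))"
    by (simp add: divide_inverse ac_simps)
  also have "\<dots> = (LINT \<epsilon>|lborel. weighted \<sigma> \<epsilon> *\<^sub>R f (ln \<epsilon>)) /\<^sub>R total \<sigma>"
    by (rule integral_scaleR_right)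
  finally show ?thesis .
qed

lemma char_log_distribution:
  "char (log_distribution \<sigma>) t = mellin H (complex_of_real \<sigma> + \<i> * complex_of_real t) /\<^sub>R total \<sigma>"
proof -
  have "(\<lambda>x. iexp (t * x)) \<in> borel_measurable borel"
    by (intro borel_measurable_continuous_onI continuous_intros)
  from integral_log_distribution[OF this, of \<sigma>] show ?thesis
    by (simp only: char_def mellin_eq_integral)
qed

lemma total_eq: "complex_of_real (total \<sigma>) = mellin H (complex_of_real \<sigma>)"
  using mellin_eq_integral[of \<sigma> 0]
  by (simp add: total_def scaleR_conv_of_real flip: integral_complex_of_real)

end

text \<open>Convergence on the line is convergence of characteristic functions once the masses are
  normalised, hence weak convergence, which is then tested with \<open>\<psi>\<close> read on the
  logarithmic scale.\<close>

lemma mellin_tendsto_imp_integral_tendsto: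
  assumes H: "\<And>n. enveloped p q K (Hn n)" "enveloped p q K H"
    and \<sigma>: "p < \<sigma>" "\<sigma> < q"
    and conv: "\<And>t. (\<lambda>n. mellin (Hn n) (complex_of_real \<sigma> + \<i> * complex_of_real t))
      \<longlonglongrightarrow> mellin H (complex_of_real \<sigma> + \<i> * complex_of_real t)"
    and \<psi>: "continuous_on UNIV \<psi>" "0 < a" "\<And>\<epsilon>. \<epsilon> \<notin> {a..b} \<Longrightarrow> \<psi> \<epsilon> = 0"
  shows "(\<lambda>n. LINT \<epsilon>|lborel. \<psi> \<epsilon> * Hn n \<epsilon>) \<longlonglongrightarrow> (LINT \<epsilon>|lborel. \<psi> \<epsilon> * H \<epsilon>)"
proof -
  interpret n: enveloped p q K "Hn n" for n by (rule H)
  interpret l: enveloped p q K H by (rule H)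
  \<comment> \<open>The exponential factor undoes the weight
    \<open>\<epsilon> powr (\<sigma> - 1)\<close> of the distribution. It is bounded where it
    matters because \<open>\<psi>\<close> vanishes outside \<open>{a..b}\<close> with
    \<open>a > 0\<close>.\<close>
  define \<phi> where "\<phi> u = \<psi> (exp u) * exp ((1 - \<sigma>) * u)" for u
  have \<phi>_cont: "continuous_on UNIV \<phi>"
    unfolding \<phi>_def by (intro continuous_intros continuous_on_compose2[OF \<psi>(1)]) auto
  have \<phi>_0: "\<phi> u = 0" if "u \<notin> {ln a..ln b}" for u
  proof -
    have "exp u \<notin> {a..b}"
    proof
      assume *: "exp u \<in> {a..b}"
      then have "ln a \<le> ln (exp u)" "ln (exp u) \<le> ln b"
        using \<psi>(2) by (auto simp del: ln_exp intro!: ln_mono)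
      then show False using that by simp
    qed
    then show ?thesis by (simp add: \<phi>_def \<psi>(3))
  qed
  have "bounded (\<phi> ` {ln a..ln b})"
    by (intro compact_imp_bounded compact_continuous_image continuous_on_subset[OF \<phi>_cont]) auto
  then obtain B where B: "\<And>u. u \<in> {ln a..ln b} \<Longrightarrow> norm (\<phi> u) \<le> B" "0 < B"
    unfolding bounded_pos by blast
  have \<phi>_B: "norm (\<phi> u) \<le> B" for u
    using B \<phi>_0[of u] by (cases "u \<in> {ln a..ln b}") auto
  have \<phi>_borel: "\<phi> \<in> borel_measurable borel" using \<phi>_cont by (rule borel_measurable_continuous_onI)
  have \<psi>_eq: "\<psi> \<epsilon> * h = (indicator {0<..} \<epsilon> * (\<epsilon> powr (\<sigma> - 1) * h)) * \<phi> (ln \<epsilon>)" for \<epsilon> h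
  proof (cases "0 < \<epsilon>")
    case True
    have "\<epsilon> powr (\<sigma> - 1) * exp ((1 - \<sigma>) * ln \<epsilon>) = 1"
      using True by (simp add: powr_def exp_add[symmetric] algebra_simps)
    then show ?thesis using True by (simp add: \<phi>_def)
  next
    case False
    then have "\<epsilon> \<notin> {a..b}" using \<psi>(2) by auto
    then show ?thesis using False \<psi>(3) by simp
  qed
  \<comment> \<open>The normalising masses are the transforms at \<open>t = 0\<close>, so their
    convergence is part of the hypothesis.\<close>
  have "(\<lambda>n. complex_of_real (n.total n \<sigma>)) \<longlonglongrightarrow> complex_of_real (l.total \<sigma>)"
    using conv[of 0] unfolding n.total_eq l.total_eq by simp
  then have total: "(\<lambda>n. n.total n \<sigma>) \<longlonglongrightarrow> l.total \<sigma>"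
    using tendsto_Re by fastforce
  show ?thesis
  proof (cases "l.total \<sigma> = 0")
    case True
    \<comment> \<open>A limit without mass cannot be normalised. Here the integrals are bounded by
      \<open>B\<close> times the total mass, which itself tends to 0.\<close>
    have le: "norm (LINT \<epsilon>|lborel. \<psi> \<epsilon> * h \<epsilon>) \<le> enveloped.total h \<sigma> * B" if h: "enveloped p q K h" for h
    proof -
      interpret h: enveloped p q K h by (rule h)
      have "norm (LINT \<epsilon>|lborel. \<psi> \<epsilon> * h \<epsilon>) \<le> (LINT \<epsilon>|lborel. h.weighted \<sigma> \<epsilon> * B)"
        unfolding \<psi>_eq
      proof (rule Bochner_Integration.integral_norm_bound_integral)
        show "integrable lborel (\<lambda>\<epsilon>. h.weighted \<sigma> \<epsilon> * B)"
          by (intro integrable_mult_left h.integrable_weighted \<sigma>)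
        show le: "norm (h.weighted \<sigma> \<epsilon> * \<phi> (ln \<epsilon>)) \<le> h.weighted \<sigma> \<epsilon> * B" for \<epsilon>
          using mult_left_mono[OF \<phi>_B[of "ln \<epsilon>"] h.weighted_nonneg[where \<sigma> = \<sigma> and \<epsilon> = \<epsilon>]]
          unfolding real_norm_def by (subst abs_mult, subst abs_of_nonneg[OF h.weighted_nonneg])
        show "integrable lborel (\<lambda>\<epsilon>. h.weighted \<sigma> \<epsilon> * \<phi> (ln \<epsilon>))"
        proof (rule Bochner_Integration.integrable_bound)
          show "integrable lborel (\<lambda>\<epsilon>. h.weighted \<sigma> \<epsilon> * B)"
            by (intro integrable_mult_left h.integrable_weighted \<sigma>)
          show "AE \<epsilon> in lborel. norm (h.weighted \<sigma> \<epsilon> * \<phi> (ln \<epsilon>)) \<le> norm (h.weighted \<sigma> \<epsilon> * B)"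
            by (intro AE_I2 order_trans[OF le]) simp
        qed (use \<phi>_borel in measurable)
      qed
      then show ?thesis by (simp add: h.total_def)
    qed
    have "(\<lambda>n. n.total n \<sigma> * B) \<longlonglongrightarrow> 0 * B" using total True by (intro tendsto_intros) simp
    then have "(\<lambda>n. n.total n \<sigma> * B) \<longlonglongrightarrow> 0" by simp
    then have "(\<lambda>n. LINT \<epsilon>|lborel. \<psi> \<epsilon> * Hn n \<epsilon>) \<longlonglongrightarrow> 0"
      by (rule Lim_null_comparison[rotated]) (intro always_eventually allI le H)
    moreover have "(LINT \<epsilon>|lborel. \<psi> \<epsilon> * H \<epsilon>) = 0" using le[OF H(2)] True by simp
    ultimately show ?thesis by simp
  next
    case False
    then have pos: "0 < l.total \<sigma>" using l.total_nonneg[of \<sigma>] by simp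
    then have "\<forall>\<^sub>F n in sequentially. 0 < n.total n \<sigma>" using total by (intro order_tendstoD(1)) auto
    \<comment> \<open>Levy's theorem asks every member to be a probability distribution; the first
      \<open>N\<close> members, whose mass may be 0, are dropped.\<close>
    then obtain N where N: "\<And>n. n \<ge> N \<Longrightarrow> 0 < n.total n \<sigma>" by (auto simp: eventually_sequentially)
    let ?L = "\<lambda>n. n.log_distribution (n + N) \<sigma>"
    note rd = n.real_distribution_log_distribution[OF \<sigma> N] l.real_distribution_log_distribution[OF \<sigma> pos]
    have total': "(\<lambda>n. n.total (n + N) \<sigma>) \<longlonglongrightarrow> l.total \<sigma>"
      using total by (rule LIMSEQ_ignore_initial_segment)
    have "weak_conv_m ?L (l.log_distribution \<sigma>)"
    proof (rule levy_continuity)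
      fix t
      show "(\<lambda>n. char (?L n) t) \<longlonglongrightarrow> char (l.log_distribution \<sigma>) t"
        unfolding n.char_log_distribution l.char_log_distribution
        using LIMSEQ_ignore_initial_segment[OF conv, of N] total' pos
        by (intro tendsto_intros) auto
    qed (use rd in auto)
    then have "(\<lambda>n. integral\<^sup>L (?L n) \<phi>) \<longlonglongrightarrow> integral\<^sup>L (l.log_distribution \<sigma>) \<phi>"
      using rd \<phi>_B \<phi>_cont
      by (intro weak_conv_imp_integral_bdd_continuous_conv[where B = B])
         (auto simp: continuous_on_eq_continuous_at)
    then have "(\<lambda>n. n.total (n + N) \<sigma> *\<^sub>R integral\<^sup>L (?L n) \<phi>) \<longlonglongrightarrow> l.total \<sigma> *\<^sub>R integral\<^sup>L (l.log_distribution \<sigma>) \<phi>"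
      by (intro tendsto_intros total')
    moreover have "n.total (n + N) \<sigma> *\<^sub>R integral\<^sup>L (?L n) \<phi> = (LINT \<epsilon>|lborel. \<psi> \<epsilon> * Hn (n + N) \<epsilon>)" for n
      using N[of "n + N"] by (simp add: n.integral_log_distribution[OF \<phi>_borel] \<psi>_eq)
    moreover have "l.total \<sigma> *\<^sub>R integral\<^sup>L (l.log_distribution \<sigma>) \<phi> = (LINT \<epsilon>|lborel. \<psi> \<epsilon> * H \<epsilon>)"
      using pos by (simp add: l.integral_log_distribution[OF \<phi>_borel] \<psi>_eq)
    ultimately have "(\<lambda>n. LINT \<epsilon>|lborel. \<psi> \<epsilon> * Hn (n + N) \<epsilon>) \<longlonglongrightarrow> (LINT \<epsilon>|lborel. \<psi> \<epsilon> * H \<epsilon>)"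
      by simp
    then show ?thesis by (rule LIMSEQ_offset)
  qed
qed

section \<open>Vague convergence from masses of quadrants\<close>

lemma half_quadrant_subset: "half_quadrant (fst w) (snd w) \<subseteq> diag_compl (dist_diag w)" if "w \<in> halfplane_bar"
  using that by (auto simp: half_quadrant_def diag_compl_eq dist_diag_eq halfplane_bar_eq halfplane_eq)

text \<open>The indicator selects the corners \<open>w\<close> whose quadrant contains
  \<open>z\<close>. Integrating over \<open>z\<close> therefore produces the masses of quadrants,
  weighted by \<open>f\<close>.\<close>

definition quadrant_integral :: "(real \<times> real \<Rightarrow> real) \<Rightarrow> real \<times> real \<Rightarrow> real" where
  "quadrant_integral f z = (LINT w|lborel. f w * indicator {w. fst z \<le> fst w \<and> snd w \<le> snd z} w)"

context tail_bounded
begin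

lemma measure_half_quadrant_le:
  assumes "w \<in> diag_compl \<delta>" "0 < \<delta>"
  shows "measure \<mu> (half_quadrant (fst w) (snd w)) \<le> measure \<mu> (diag_compl \<delta>)"
proof -
  have w: "w \<in> halfplane_bar" "\<delta> \<le> dist_diag w"
    using assms halfplane_subset_bar by (auto simp: diag_compl_eq)
  have sub: "half_quadrant (fst w) (snd w) \<subseteq> diag_compl \<delta>"
    using half_quadrant_subset[OF w(1)] diag_compl_antimono[OF w(2)] by blast
  have "half_quadrant (fst w) (snd w) \<in> sets borel"
    unfolding half_quadrant_def by measurable
  then have "half_quadrant (fst w) (snd w) \<in> sets \<mu>"
    by (rule in_sets) (auto simp: half_quadrant_def)
  then show ?thesis
    using assms sub by (intro measure_mono_if[of \<delta>]) auto
qed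

lemma borel_measurable_measure_half_quadrant [measurable]:
  "(\<lambda>w. measure \<mu> (half_quadrant (fst w) (snd w))) \<in> borel_measurable borel"
  unfolding measure_def by measurable

lemma integrable_times_half_quadrant:
  assumes "test_fun f"
  shows "integrable lborel (\<lambda>w. f w * measure \<mu> (half_quadrant (fst w) (snd w)))"
proof -
  obtain B where B: "0 \<le> B" "\<And>z. \<bar>f z\<bar> \<le> B" using test_fun_bounded[OF assms] by blast
  obtain \<delta> where \<delta>: "\<delta> > 0" "\<And>z. z \<notin> diag_compl \<delta> \<Longrightarrow> f z = 0" using test_fun_support[OF assms] by blast
  obtain S where S: "compact S" "\<And>z. z \<notin> S \<Longrightarrow> f z = 0" using assms by (auto simp: test_fun_def)
  let ?m = "measure \<mu> (diag_compl \<delta>)"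
  have [measurable]: "f \<in> borel_measurable borel" using test_fun_measurable[OF assms] .
  show ?thesis
  proof (rule Bochner_Integration.integrable_bound)
    have "emeasure lborel S < \<infinity>" using S(1) by (rule emeasure_compact_finite)
    then show "integrable lborel (\<lambda>w. B * ?m * indicator S w)"
      using S(1) by (intro integrable_mult_right integrable_real_indicator) (auto intro: borel_compact)
    show "AE w in lborel. norm (f w * measure \<mu> (half_quadrant (fst w) (snd w))) \<le> norm (B * ?m * indicator S w)"
    proof (rule AE_I2)
      fix w
      show "norm (f w * measure \<mu> (half_quadrant (fst w) (snd w))) \<le> norm (B * ?m * indicator S w)"
      proof (cases "w \<in> S \<and> w \<in> diag_compl \<delta>")
        case True
        then have "\<bar>f w\<bar> * measure \<mu> (half_quadrant (fst w) (snd w)) \<le> B * ?m"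
          using B \<delta>(1) by (intro mult_mono measure_half_quadrant_le) auto
        then show ?thesis using True B by (simp add: abs_mult)
      next
        case False
        then have "f w = 0" using S(2) \<delta>(2) by blast
        then show ?thesis by simp
      qed
    qed
    show "(\<lambda>w. f w * measure \<mu> (half_quadrant (fst w) (snd w))) \<in> borel_measurable lborel"
      using borel_measurable_times[OF test_fun_measurable[OF assms] borel_measurable_measure_half_quadrant] by simp
  qed
qed

text \<open>Fubini for \<open>f w\<close> on the pairs where \<open>z\<close> lies in the quadrant
  of \<open>w\<close>. Absolute integrability holds since such \<open>z\<close> is at least as far
  from the diagonal as \<open>w\<close>, so the pairs stay in a product of two sets of finite
  measure.\<close>

lemma integral_quadrant_integral:
  assumes "test_fun f"
  shows "(LINT z|\<mu>. quadrant_integral f z) = (LINT w|lborel. f w * measure \<mu> (half_quadrant (fst w) (snd w)))"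
    and "integrable \<mu> (quadrant_integral f)"
proof -
  interpret pair_sigma_finite \<mu> "lborel :: (real \<times> real) measure"
    by (intro pair_sigma_finite.intro sigma_finite sigma_finite_lborel)
  obtain B where B: "0 \<le> B" "\<And>z. \<bar>f z\<bar> \<le> B" using test_fun_bounded[OF assms] by blast
  obtain \<delta> where \<delta>: "\<delta> > 0" "\<And>z. z \<notin> diag_compl \<delta> \<Longrightarrow> f z = 0" using test_fun_support[OF assms] by blast
  obtain S where S: "compact S" "\<And>z. z \<notin> S \<Longrightarrow> f z = 0" using assms by (auto simp: test_fun_def)
  have [measurable]: "f \<in> borel_measurable borel" using test_fun_measurable[OF assms] .
  define F where "F z w = f w * indicator {v. fst (fst v) \<le> fst (snd v) \<and> snd (snd v) \<le> snd (fst v)} (z, w)"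
    for z w :: "real \<times> real"
  let ?L = "lborel :: (real \<times> real) measure"
  have int: "integrable (\<mu> \<Otimes>\<^sub>M ?L) (case_prod F)"
  proof (rule Bochner_Integration.integrable_bound)
    have "emeasure (\<mu> \<Otimes>\<^sub>M ?L) (diag_compl \<delta> \<times> S) = emeasure \<mu> (diag_compl \<delta>) * emeasure lborel S"
      using S(1) by (intro lborel.emeasure_pair_measure_Times) (auto intro: borel_compact)
    also have "\<dots> < \<infinity>"
      using emeasure_diag_compl_finite[OF \<delta>(1)] emeasure_compact_finite[OF S(1)]
      by (simp add: ennreal_mult_less_top less_top)
    finally show "integrable (\<mu> \<Otimes>\<^sub>M ?L) (\<lambda>v. B * indicator (diag_compl \<delta> \<times> S) v)"
      using S(1) by (intro integrable_mult_right integrable_real_indicator) (auto intro!: borel_compact pair_measureI)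
    show "case_prod F \<in> borel_measurable (\<mu> \<Otimes>\<^sub>M ?L)"
      unfolding F_def case_prod_unfold by measurable
    show "AE v in \<mu> \<Otimes>\<^sub>M ?L. norm (case_prod F v) \<le> norm (B * indicator (diag_compl \<delta> \<times> S) v)"
    proof (rule AE_I2)
      fix v assume "v \<in> space (\<mu> \<Otimes>\<^sub>M ?L)"
      then obtain z w where v: "v = (z, w)" "z \<in> halfplane"
        by (cases v) (auto simp: space_pair_measure space_eq)
      show "norm (case_prod F v) \<le> norm (B * indicator (diag_compl \<delta> \<times> S) v)"
      proof (cases "F z w = 0")
        case False
        then have w: "fst z \<le> fst w" "snd w \<le> snd z" "f w \<noteq> 0"
          by (auto simp: F_def indicator_def split: if_splits)
        then have "w \<in> S" "w \<in> diag_compl \<delta>" using S(2) \<delta>(2) by blast+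
        then have "z \<in> diag_compl \<delta>" using w \<delta>(1) by (auto simp: diag_compl_eq')
        then show ?thesis using \<open>w \<in> S\<close> B w by (simp add: v F_def)
      qed (simp add: v)
    qed
  qed
  have inner: "(LINT w|lborel. F z w) = quadrant_integral f z" for z
    unfolding F_def quadrant_integral_def
    by (intro Bochner_Integration.integral_cong) (auto simp: indicator_def)
  have "(LINT z|\<mu>. F z w) = f w * measure \<mu> (half_quadrant (fst w) (snd w))" for w
  proof -
    have hq: "half_quadrant (fst w) (snd w) \<in> sets borel" unfolding half_quadrant_def by measurable
    have "(LINT z|\<mu>. F z w) = (LINT z|\<mu>. f w * indicator (half_quadrant (fst w) (snd w)) z)"
      by (intro Bochner_Integration.integral_cong) (auto simp: F_def indicator_def half_quadrant_def space_eq)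
    also have "\<dots> = f w * measure \<mu> (half_quadrant (fst w) (snd w) \<inter> space \<mu>)" by simp
    also have "half_quadrant (fst w) (snd w) \<inter> space \<mu> = half_quadrant (fst w) (snd w)"
      by (auto simp: half_quadrant_def space_eq)
    finally show ?thesis .
  qed
  with inner show "(LINT z|\<mu>. quadrant_integral f z) = (LINT w|lborel. f w * measure \<mu> (half_quadrant (fst w) (snd w)))"
    using Fubini_integral[OF int] by simp
  show "integrable \<mu> (quadrant_integral f)"
    using integrable_fst[OF int] inner by simp
qed

end

text \<open>The integral over corners is taken column by column: for almost every \<open>x\<close>
  the integral over heights converges by the Mellin argument, and the columns are summed by
  dominated convergence.\<close>

lemma (in tail_bounded_seq) integral_quadrant_integral_tendsto:
  assumes conv: "AE x in lborel. zetas_tendsto x"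
    and f: "test_fun f"
  shows "(\<lambda>n. LINT z|M n. quadrant_integral f z) \<longlonglongrightarrow> (LINT z|\<mu>. quadrant_integral f z)"
proof -
  obtain B where B: "0 \<le> B" "\<And>z. \<bar>f z\<bar> \<le> B" using test_fun_bounded[OF f] by blast
  obtain \<delta> where \<delta>: "\<delta> > 0" "\<And>z. z \<notin> diag_compl \<delta> \<Longrightarrow> f z = 0" using test_fun_support[OF f] by blast
  obtain S where S: "compact S" "\<And>z. z \<notin> S \<Longrightarrow> f z = 0" using f by (auto simp: test_fun_def)
  obtain R where R: "\<And>z. z \<in> S \<Longrightarrow> norm z \<le> R"
    using compact_imp_bounded[OF S(1)] unfolding bounded_iff by blast
  \<comment> \<open>One bound for both coordinates and for their difference
    \<open>y - x\<close>.\<close>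
  define b where "b = 2 * \<bar>R\<bar>"
  have supp: "\<bar>x\<bar> \<le> b" "\<bar>y\<bar> \<le> b" "y - x \<in> {2 * \<delta>..b}" if "f (x, y) \<noteq> 0" for x y
  proof -
    have "(x, y) \<in> S" "(x, y) \<in> diag_compl \<delta>" using that S(2) \<delta>(2) by blast+
    then have n: "norm (x, y) \<le> R" "2 * \<delta> \<le> y - x" using R \<delta>(1) by (auto simp: diag_compl_eq')
    have "\<bar>x\<bar> \<le> R" "\<bar>y\<bar> \<le> R" using norm_fst_le[of x y] norm_snd_le[of y x] n by auto
    then show "\<bar>x\<bar> \<le> b" "\<bar>y\<bar> \<le> b" "y - x \<in> {2 * \<delta>..b}" using n by (auto simp: b_def)
  qed
  define m where "m = \<bar>C\<bar> * envelope p q \<delta>"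
  have m: "0 \<le> m" by (simp add: m_def)
  define G where "G \<nu> x y = measure \<nu> (half_quadrant x y)" for \<nu> :: "(real \<times> real) measure" and x y
  have fG: "\<bar>f (x, y) * G \<nu> x y\<bar> \<le> B * m * indicator {-b..b} x * indicator {-b..b} y"
    if "tail_bounded p q C \<nu>" for \<nu> x y
  proof (cases "f (x, y) = 0")
    case False
    then have "(x, y) \<in> diag_compl \<delta>" using \<delta>(2) by blast
    then have "G \<nu> x y \<le> measure \<nu> (diag_compl \<delta>)"
      using tail_bounded.measure_half_quadrant_le[OF that _ \<delta>(1), of "(x, y)"] by (simp add: G_def)
    also have "\<dots> \<le> m" unfolding m_def by (rule tail_bounded.measure_diag_compl_le[OF that \<delta>(1)])
    finally have "\<bar>f (x, y)\<bar> * G \<nu> x y \<le> B * m"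
      using B by (intro mult_mono) (auto simp: G_def)
    then show ?thesis using supp[OF False] by (auto simp: abs_mult G_def abs_le_iff indicator_def)
  qed (use B m in auto)
  have iter: "(LINT z|\<nu>. quadrant_integral f z) = (LINT x|lborel. LINT y|lborel. f (x, y) * G \<nu> x y)"
    "integrable lborel (\<lambda>x. LINT y|lborel. f (x, y) * G \<nu> x y)" if "tail_bounded p q C \<nu>" for \<nu>
  proof -
    have int: "integrable (lborel \<Otimes>\<^sub>M lborel) (\<lambda>w. f w * measure \<nu> (half_quadrant (fst w) (snd w)))"
      unfolding lborel_prod by (rule tail_bounded.integrable_times_half_quadrant[OF that f])
    from lborel_pair.integral_fst'[OF this] lborel_pair.integrable_fst'[OF this]
    show "(LINT z|\<nu>. quadrant_integral f z) = (LINT x|lborel. LINT y|lborel. f (x, y) * G \<nu> x y)"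
      "integrable lborel (\<lambda>x. LINT y|lborel. f (x, y) * G \<nu> x y)"
      by (simp_all add: tail_bounded.integral_quadrant_integral(1)[OF that f] lborel_prod G_def)
  qed
  have "(\<lambda>n. LINT x|lborel. LINT y|lborel. f (x, y) * G (M n) x y) \<longlonglongrightarrow> (LINT x|lborel. LINT y|lborel. f (x, y) * G \<mu> x y)"
  proof (rule integral_dominated_convergence[where w = "\<lambda>x. B * m * (2 * b) * indicator {-b..b} x"])
    show "(\<lambda>x. LINT y|lborel. f (x, y) * G \<mu> x y) \<in> borel_measurable lborel"
      using iter(2)[OF \<mu>] by auto
    show "(\<lambda>x. LINT y|lborel. f (x, y) * G (M n) x y) \<in> borel_measurable lborel" for n
      using iter(2)[OF M[of n]] by auto
    show "integrable lborel (\<lambda>x. B * m * (2 * b) * indicator {-b..b} x)"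
      by (intro integrable_mult_right integrable_real_indicator) (auto simp: emeasure_lborel_Icc_eq)
    show "AE x in lborel. norm (LINT y|lborel. f (x, y) * G (M n) x y) \<le> B * m * (2 * b) * indicator {-b..b} x" for n
    proof (rule AE_I2)
      fix x :: real
      have "ennreal (norm (LINT y|lborel. f (x, y) * G (M n) x y))
          \<le> (\<integral>\<^sup>+ y. ennreal (B * m * indicator {-b..b} x * indicator {-b..b} y) \<partial>lborel)"
      proof (cases "integrable lborel (\<lambda>y. f (x, y) * G (M n) x y)")
        case True
        then have "ennreal (norm (LINT y|lborel. f (x, y) * G (M n) x y)) \<le> (\<integral>\<^sup>+ y. ennreal (norm (f (x, y) * G (M n) x y)) \<partial>lborel)"
          by (rule integral_norm_bound_ennreal)
        also have "\<dots> \<le> (\<integral>\<^sup>+ y. ennreal (B * m * indicator {-b..b} x * indicator {-b..b} y) \<partial>lborel)"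
          using fG[OF M[of n]] by (intro nn_integral_mono ennreal_leI) auto
        finally show ?thesis .
      \<comment> \<open>A column that is not integrable has integral 0 by convention, so the bound
        holds there too.\<close>
      qed (simp add: not_integrable_integral_eq)
      also have "\<dots> = (\<integral>\<^sup>+ y. ennreal (B * m * indicator {-b..b} x) * indicator {-b..b} y \<partial>lborel)"
        by (intro nn_integral_cong) (auto simp: indicator_def)
      also have "\<dots> = ennreal (B * m * indicator {-b..b} x) * ennreal (2 * b)"
        by (subst nn_integral_cmult_indicator) (auto simp: b_def)
      also have "\<dots> = ennreal (B * m * (2 * b) * indicator {-b..b} x)"
        using B m by (subst ennreal_mult[symmetric]) (auto simp: b_def ac_simps)
      finally show "norm (LINT y|lborel. f (x, y) * G (M n) x y) \<le> B * m * (2 * b) * indicator {-b..b} x"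
        using B m by (subst (asm) ennreal_le_iff) (auto simp: b_def)
    qed
    show "AE x in lborel. (\<lambda>n. LINT y|lborel. f (x, y) * G (M n) x y) \<longlonglongrightarrow> (LINT y|lborel. f (x, y) * G \<mu> x y)"
      using conv
    proof eventually_elim
      case (elim x)
      define \<sigma> where "\<sigma> = (p + q) / 2"
      have \<sigma>: "p < \<sigma>" "\<sigma> < q" using lim.p_less_q by (auto simp: \<sigma>_def)
      have shift: "(LINT y|lborel. f (x, y) * G \<nu> x y) = (LINT \<epsilon>|lborel. f (x, x + \<epsilon>) * measure \<nu> (half_quadrant x (x + \<epsilon>)))" for \<nu>
        by (subst lborel_integral_real_affine[of 1 _ x]) (auto simp: G_def)
      show ?case
        unfolding shift
      proof (rule mellin_tendsto_imp_integral_tendsto[where p = p and q = q and K = "\<bar>C\<bar> * 2 powr q" and \<sigma> = \<sigma>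
            and a = "2 * \<delta>" and b = b])
        show "enveloped p q (\<bar>C\<bar> * 2 powr q) (\<lambda>\<epsilon>. measure (M n) (half_quadrant x (x + \<epsilon>)))" for n
          by (rule seq.enveloped_half_quadrant)
        show "enveloped p q (\<bar>C\<bar> * 2 powr q) (\<lambda>\<epsilon>. measure \<mu> (half_quadrant x (x + \<epsilon>)))"
          by (rule lim.enveloped_half_quadrant)
        show "continuous_on UNIV (\<lambda>\<epsilon>. f (x, x + \<epsilon>))"
          by (intro continuous_on_compose2[OF test_fun_continuous[OF f, of UNIV]] continuous_intros) auto
        show "f (x, x + \<epsilon>) = 0" if "\<epsilon> \<notin> {2 * \<delta>..b}" for \<epsilon>
          using that supp(3)[of x "x + \<epsilon>"] by auto
        fix t :: real
        let ?s = "complex_of_real \<sigma> + \<i> * complex_of_real t"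
        have s: "p < Re ?s" "Re ?s < q" using \<sigma> by auto
        \<comment> \<open>\<open>zeta_at\<close> carries the factor \<open>s\<close>, which has to
          be divided out to reach the Mellin transform.\<close>
        have "?s \<noteq> 0" using \<sigma> lim.p_ge_1 by (simp add: complex_eq_iff)
        have "uniform_limit {?s} (\<lambda>n. zeta_at x (M n)) (zeta_at x \<mu>) sequentially"
          by (rule elim[rule_format, THEN conjunct1]) (use s in auto)
        then have "(\<lambda>n. zeta_at x (M n) ?s) \<longlonglongrightarrow> zeta_at x \<mu> ?s"
          by (rule tendsto_uniform_limitI) simp
        then have "(\<lambda>n. zeta_at x (M n) ?s / ?s) \<longlonglongrightarrow> zeta_at x \<mu> ?s / ?s"
          using \<open>?s \<noteq> 0\<close> by (intro tendsto_intros)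
        then show "(\<lambda>n. mellin (\<lambda>\<epsilon>. measure (M n) (half_quadrant x (x + \<epsilon>))) ?s)
          \<longlonglongrightarrow> mellin (\<lambda>\<epsilon>. measure \<mu> (half_quadrant x (x + \<epsilon>))) ?s"
          unfolding zeta_at_eq_mellin using \<open>?s \<noteq> 0\<close> by simp
      qed (use \<sigma> \<delta> in auto)
    qed
  qed
  then show ?thesis using iter(1)[OF \<mu>] iter(1)[OF M] by simp
qed

section \<open>Second differences recover a test function\<close>

lemma test_fun_shift:
  assumes "test_fun f" "0 \<le> h" "0 \<le> k"
  shows "test_fun (\<lambda>w. f (fst w + h, snd w - k))"
proof -
  obtain S where S: "compact S" "S \<subseteq> halfplane" "\<And>z. z \<notin> S \<Longrightarrow> f z = 0" using assms by (auto simp: test_fun_def)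
  show ?thesis
  proof (rule test_funI)
    show "continuous_on UNIV (\<lambda>w. f (fst w + h, snd w - k))"
      by (intro continuous_on_compose2[OF test_fun_continuous[OF assms(1), of UNIV]] continuous_intros) auto
    show "compact ((+) (- h, k) ` S)" by (intro compact_translation S)
    show "(+) (- h, k) ` S \<subseteq> halfplane" using S(2) assms(2,3) by (auto simp: halfplane_eq)
    show "f (fst w + h, snd w - k) = 0" if "w \<notin> (+) (- h, k) ` S" for w
    proof (rule S(3), rule notI)
      assume "(fst w + h, snd w - k) \<in> S"
      then have "(- h, k) + (fst w + h, snd w - k) \<in> (+) (- h, k) ` S" by (rule imageI)
      then show False using that by simp
    qed
  qed
qed

lemma test_fun_add: "test_fun f \<Longrightarrow> test_fun g \<Longrightarrow> test_fun (\<lambda>w. f w + g w)"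
  unfolding test_fun_def
proof (elim conjE exE, intro conjI)
  fix S T assume "compact S" "S \<subseteq> halfplane" "\<forall>z. z \<notin> S \<longrightarrow> f z = 0"
    "compact T" "T \<subseteq> halfplane" "\<forall>z. z \<notin> T \<longrightarrow> g z = 0"
  then show "\<exists>K. compact K \<and> K \<subseteq> halfplane \<and> (\<forall>z. z \<notin> K \<longrightarrow> f z + g z = 0)"
    by (intro exI[of _ "S \<union> T"]) (auto intro: compact_Un)
qed (auto intro: continuous_intros)

lemma test_fun_mult_left: "test_fun f \<Longrightarrow> continuous_on UNIV g \<Longrightarrow> test_fun (\<lambda>w. g w * f w)"
  unfolding test_fun_def by (auto intro!: continuous_intros)

lemma test_fun_uminus: "test_fun f \<Longrightarrow> test_fun (\<lambda>w. - f w)"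
  using test_fun_mult_left[of f "\<lambda>_. - 1"] by simp

lemma integrable_test_fun_lborel:
  assumes "test_fun f"
  shows "integrable lborel f"
proof -
  obtain S where S: "compact S" "\<And>z. z \<notin> S \<Longrightarrow> f z = 0" using assms by (auto simp: test_fun_def)
  have "integrable lborel (\<lambda>z. indicator S z *\<^sub>R f z)"
    by (intro borel_integrable_compact S test_fun_continuous assms)
  moreover have "(\<lambda>z. indicator S z *\<^sub>R f z) = f" using S(2) by (intro ext) (auto simp: indicator_def)
  ultimately show ?thesis by simp
qed

text \<open>Translation invariance of Lebesgue measure moves the shift from \<open>f\<close> to the
  corner of the region of integration.\<close>

lemma quadrant_integral_shift:
  assumes f: "test_fun f"
  shows "quadrant_integral (\<lambda>w. f (fst w + h, snd w - k)) z =
    (LINT w|lborel. f w * indicator {w. fst z + h \<le> fst w \<and> snd w \<le> snd z - k} w)"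
proof -
  have [measurable]: "f \<in> borel_measurable borel" using test_fun_measurable[OF f] .
  let ?F = "\<lambda>w. f w * indicator {w. fst z + h \<le> fst w \<and> snd w \<le> snd z - k} w"
  have "(LINT w|lborel. ?F w) = (LINT w|distr lborel borel ((+) (h, - k)). ?F w)"
    by (simp only: lborel_distr_plus)
  also have "\<dots> = (LINT w|lborel. ?F ((h, - k) + w))"
    by (intro integral_distr) measurable
  also have "\<dots> = quadrant_integral (\<lambda>w. f (fst w + h, snd w - k)) z"
    unfolding quadrant_integral_def
  proof (intro Bochner_Integration.integral_cong refl)
    fix w
    have "(h, - k) + w = (fst w + h, snd w - k)" by (cases w) (simp add: ac_simps)
    then show "?F ((h, - k) + w) = f (fst w + h, snd w - k) * indicator {w. fst z \<le> fst w \<and> snd w \<le> snd z} w"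
      by (auto simp: indicator_def)
  qed
  finally show ?thesis by simp
qed

text \<open>The discrete counterpart of a mixed second derivative. The terms \<open>+ 0\<close> and
  \<open>- 0\<close> give all shifted values the shape to which \<open>test_fun_shift\<close> and
  \<open>quadrant_integral_shift\<close> apply; both shifts go towards the diagonal.\<close>

definition second_difference :: "real \<Rightarrow> (real \<times> real \<Rightarrow> real) \<Rightarrow> real \<times> real \<Rightarrow> real" where
  "second_difference h f w = f w + - f (fst w + h, snd w - 0) + (- f (fst w + 0, snd w - h) + f (fst w + h, snd w - h))"

lemma test_fun_second_difference:
  "test_fun f \<Longrightarrow> 0 \<le> h \<Longrightarrow> test_fun (second_difference h f)"
  unfolding second_difference_def[abs_def]
  by (intro test_fun_add test_fun_uminus test_fun_shift) auto

text \<open>The quadrant integral of the second difference is an unnormalised mean of \<open>f\<close> over a square.\<close>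

lemma quadrant_integral_second_difference:
  assumes f: "test_fun f" and h: "0 \<le> h"
  shows "quadrant_integral (second_difference h f) z =
    (LINT w|lborel. f w * indicator ({fst z..<fst z + h} \<times> {snd z - h<..snd z}) w)"
proof -
  let ?Q = "\<lambda>h k. {w :: real \<times> real. fst z + h \<le> fst w \<and> snd w \<le> snd z - k}"
  have int: "integrable lborel (\<lambda>w. g w * indicator A w)" if "test_fun g" "A \<in> sets borel"
    for g and A :: "(real \<times> real) set"
    using integrable_mult_indicator[OF _ integrable_test_fun_lborel[OF that(1)], of A] that(2)
    by (simp add: ac_simps)
  have Q: "?Q h k \<in> sets borel" for h k by measurable
  have f_eq: "f = (\<lambda>w. f (fst w + 0, snd w - 0))" by simp
  have Q0: "{w :: real \<times> real. fst z \<le> fst w \<and> snd w \<le> snd z} = ?Q 0 0" by simp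
  note sh = test_fun_shift[OF f]
  have "quadrant_integral (second_difference h f) z =
    quadrant_integral f z + - quadrant_integral (\<lambda>w. f (fst w + h, snd w - 0)) z
    + (- quadrant_integral (\<lambda>w. f (fst w + 0, snd w - h)) z + quadrant_integral (\<lambda>w. f (fst w + h, snd w - h)) z)"
  proof -
    have i: "integrable lborel (\<lambda>w. f w * indicator (?Q 0 0) w)"
      "integrable lborel (\<lambda>w. f (fst w + h, snd w - 0) * indicator (?Q 0 0) w)"
      "integrable lborel (\<lambda>w. f (fst w + 0, snd w - h) * indicator (?Q 0 0) w)"
      "integrable lborel (\<lambda>w. f (fst w + h, snd w - h) * indicator (?Q 0 0) w)"
      using h by (intro int f sh Q; simp)+
    have "(\<lambda>w. second_difference h f w * indicator (?Q 0 0) w) =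
      (\<lambda>w. (f w * indicator (?Q 0 0) w - f (fst w + h, snd w - 0) * indicator (?Q 0 0) w)
        - (f (fst w + 0, snd w - h) * indicator (?Q 0 0) w - f (fst w + h, snd w - h) * indicator (?Q 0 0) w))"
      by (auto simp: second_difference_def algebra_simps)
    then show ?thesis
      unfolding quadrant_integral_def Q0
      using i by (simp only: Bochner_Integration.integral_diff Bochner_Integration.integrable_diff)
  qed
  also have "\<dots> = (LINT w|lborel. f w * indicator (?Q 0 0) w) + - (LINT w|lborel. f w * indicator (?Q h 0) w)
    + (- (LINT w|lborel. f w * indicator (?Q 0 h) w) + (LINT w|lborel. f w * indicator (?Q h h) w))"
    by (simp only: quadrant_integral_shift[OF f]) (simp add: quadrant_integral_def)
  also have "\<dots> = (LINT w|lborel. (f w * indicator (?Q 0 0) w - f w * indicator (?Q h 0) w)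
      - (f w * indicator (?Q 0 h) w - f w * indicator (?Q h h) w))"
    by (simp only: Bochner_Integration.integral_diff Bochner_Integration.integrable_diff int[OF f Q])
  \<comment> \<open>Inclusion-exclusion for four nested regions leaves the half-open square of side
    \<open>h\<close> at \<open>z\<close>.\<close>
  also have "\<dots> = (LINT w|lborel. f w * indicator ({fst z..<fst z + h} \<times> {snd z - h<..snd z}) w)"
    using h by (intro Bochner_Integration.integral_cong refl) (auto simp: indicator_def mem_Times_iff)
  finally show ?thesis .
qed

text \<open>The square has area \<open>h\<^sup>2\<close> and all its points are within
  \<open>h < d\<close> of \<open>z\<close>, where \<open>f\<close> varies by less than
  \<open>e\<close>.\<close>

lemma quadrant_integral_second_difference_approx:
  assumes f: "test_fun f" and h: "0 < h" "h < d" and d: "\<And>z w. dinf z w < d \<Longrightarrow> \<bar>f z - f w\<bar> < e"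
  shows "\<bar>quadrant_integral (second_difference h f) z - h\<^sup>2 * f z\<bar> \<le> e * h\<^sup>2"
proof -
  let ?A = "{fst z..<fst z + h} \<times> {snd z - h<..snd z}"
  have A: "?A \<in> sets borel" by (intro borel_Times) auto
  have em: "emeasure lborel ?A = ennreal (h\<^sup>2)"
    using h unfolding lborel_prod[symmetric]
    by (subst lborel.emeasure_pair_measure_Times) (auto simp: ennreal_mult[symmetric] power2_eq_square)
  then have meas: "measure lborel ?A = h\<^sup>2" by (simp add: measure_def)
  have intA: "integrable lborel (indicat_real ?A)" using A em by (intro integrable_real_indicator) auto
  have int_f: "integrable lborel (\<lambda>w. f w * indicator ?A w)"
    using integrable_mult_indicator[OF _ integrable_test_fun_lborel[OF f], of ?A] A by (simp add: ac_simps)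
  have "quadrant_integral (second_difference h f) z - h\<^sup>2 * f z
      = (LINT w|lborel. f w * indicator ?A w) - (LINT w|lborel. f z * indicator ?A w)"
    using h by (simp add: quadrant_integral_second_difference[OF f] meas)
  also have "\<dots> = (LINT w|lborel. f w * indicator ?A w - f z * indicator ?A w)"
    using int_f intA by (intro Bochner_Integration.integral_diff[symmetric] integrable_mult_right)
  finally have eq: "quadrant_integral (second_difference h f) z - h\<^sup>2 * f z
      = (LINT w|lborel. f w * indicator ?A w - f z * indicator ?A w)" .
  have "norm (LINT w|lborel. f w * indicator ?A w - f z * indicator ?A w) \<le> (LINT w|lborel. e * indicator ?A w)"
  proof (rule Bochner_Integration.integral_norm_bound_integral)
    fix w
    have "\<bar>f w - f z\<bar> \<le> e" if "w \<in> ?A"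
    proof -
      have "dinf w z \<le> h" using that by (auto simp: dinf_def)
      then show ?thesis using d[of w z] h by simp
    qed
    then show "norm (f w * indicator ?A w - f z * indicator ?A w) \<le> e * indicator ?A w"
      by (auto simp: indicator_def)
  qed (use int_f intA in \<open>auto intro: Bochner_Integration.integrable_diff integrable_mult_right\<close>)
  also have "\<dots> = e * measure lborel ?A"
    by simp
  finally show ?thesis unfolding eq meas real_norm_def .
qed

lemma quadrant_integral_eq_0:
  assumes "\<And>w. w \<notin> diag_compl \<delta> \<Longrightarrow> f w = 0" "0 < \<delta>" "z \<notin> diag_compl \<delta>"
  shows "quadrant_integral f z = 0"
proof -
  have "f w * indicator {w. fst z \<le> fst w \<and> snd w \<le> snd z} w = 0" for w
    using assms(1)[of w] assms(2,3) by (auto simp: indicator_def diag_compl_eq')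
  then have "(\<lambda>w. f w * indicator {w. fst z \<le> fst w \<and> snd w \<le> snd z} w) = (\<lambda>_. 0)" by (rule ext)
  then show ?thesis by (simp add: quadrant_integral_def del: mult_eq_0_iff)
qed

text \<open>The pointwise error is at most \<open>e * h\<^sup>2\<close> on
  \<open>diag_compl \<delta>\<close> and 0 off it, so the integrated error is finite although
  \<open>\<mu>\<close> may be infinite.\<close>

lemma (in tail_bounded) integral_second_difference_approx:
  assumes f: "test_fun f" and \<delta>: "0 < \<delta>" "\<And>w. w \<notin> diag_compl \<delta> \<Longrightarrow> f w = 0"
    and h: "0 < h" "h < d" and d: "\<And>z w. dinf z w < d \<Longrightarrow> \<bar>f z - f w\<bar> < e"
  shows "\<bar>(LINT z|\<mu>. quadrant_integral (second_difference h f) z) - h\<^sup>2 * (LINT z|\<mu>. f z)\<bar>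
    \<le> e * h\<^sup>2 * measure \<mu> (diag_compl \<delta>)"
proof -
  have g: "test_fun (second_difference h f)" using f h by (intro test_fun_second_difference) auto
  have g0: "second_difference h f w = 0" if "w \<notin> diag_compl \<delta>" for w
  proof -
    \<comment> \<open>Moving right and down decreases \<open>snd - fst\<close>, so a point outside
      \<open>diag_compl \<delta>\<close> stays outside.\<close>
    have f0: "f (fst w + a, snd w - b) = 0" if "0 \<le> a" "0 \<le> b" for a b
      using \<open>w \<notin> diag_compl \<delta>\<close> that \<delta>(1) by (intro \<delta>(2)) (auto simp: diag_compl_eq')
    show ?thesis
      using f0[of 0 0] f0[of h 0] f0[of 0 h] f0[of h h] h by (simp add: second_difference_def)
  qed
  note int = integral_quadrant_integral(2)[OF g] integrable_test_fun[OF f]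
  have "(LINT z|\<mu>. quadrant_integral (second_difference h f) z) - h\<^sup>2 * (LINT z|\<mu>. f z)
     = (LINT z|\<mu>. quadrant_integral (second_difference h f) z - h\<^sup>2 * f z)"
    using int by simp
  moreover have "norm (LINT z|\<mu>. quadrant_integral (second_difference h f) z - h\<^sup>2 * f z) \<le> (LINT z|\<mu>. e * h\<^sup>2 * indicator (diag_compl \<delta>) z)"
  proof (rule Bochner_Integration.integral_norm_bound_integral)
    fix z
    show "norm (quadrant_integral (second_difference h f) z - h\<^sup>2 * f z) \<le> e * h\<^sup>2 * indicator (diag_compl \<delta>) z"
    proof (cases "z \<in> diag_compl \<delta>")
      case True
      then show ?thesis using quadrant_integral_second_difference_approx[OF f h d] by simp
    next
      case False
      then show ?thesis using quadrant_integral_eq_0[OF g0 \<delta>(1)] \<delta>(2) by simp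
    qed
  qed (use int \<delta> in auto)
  moreover have "(LINT z|\<mu>. e * h\<^sup>2 * indicator (diag_compl \<delta>) z) = e * h\<^sup>2 * measure \<mu> (diag_compl \<delta>)"
    using diag_compl_subset[of \<delta>] by (simp add: space_eq Int_absorb2)
  ultimately show ?thesis by simp
qed

text \<open>The step \<open>h\<close> is fixed before \<open>n\<close>. The smoothing error is a
  small multiple of \<open>h\<^sup>2\<close> uniformly over all measures under the tail bound, so
  division by \<open>h\<^sup>2\<close> returns to \<open>f\<close> itself.\<close>

lemma (in tail_bounded_seq) vague_converges_if_zeta_at:
  assumes conv: "AE x in lborel. zetas_tendsto x"
  shows "vague_converges M \<mu>"
proof -
  have "(\<lambda>n. LINT z|M n. f z) \<longlonglongrightarrow> (LINT z|\<mu>. f z)" if f: "test_fun f" for f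
  proof (rule tendstoI)
    fix e :: real assume e: "0 < e"
    obtain \<delta> where \<delta>: "\<delta> > 0" "\<And>z. z \<notin> diag_compl \<delta> \<Longrightarrow> f z = 0" using test_fun_support[OF f] by blast
    define m where "m = \<bar>C\<bar> * envelope p q \<delta> + 1"
    have m: "0 < m" unfolding m_def by (intro add_nonneg_pos mult_nonneg_nonneg) auto
    obtain d where d: "d > 0" "\<And>z w. dinf z w < d \<Longrightarrow> \<bar>f z - f w\<bar> < e / 4 / m"
      using test_fun_uniformly_continuous[OF f, of "e / 4 / m"] e m by auto
    define h where "h = d / 2"
    have h: "0 < h" "h < d" using d(1) by (auto simp: h_def)
    let ?I = "\<lambda>\<nu>. LINT z|\<nu>. quadrant_integral (second_difference h f) z"
    have approx: "\<bar>?I \<nu> - h\<^sup>2 * (LINT z|\<nu>. f z)\<bar> \<le> e / 4 * h\<^sup>2" if "tail_bounded p q C \<nu>" for \<nu>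
    proof -
      have "\<bar>?I \<nu> - h\<^sup>2 * (LINT z|\<nu>. f z)\<bar> \<le> e / 4 / m * h\<^sup>2 * measure \<nu> (diag_compl \<delta>)"
        by (rule tail_bounded.integral_second_difference_approx[OF that f \<delta> h d(2)])
      also have "\<dots> \<le> e / 4 / m * h\<^sup>2 * m"
        using tail_bounded.measure_diag_compl_le[OF that \<delta>(1)] e m by (intro mult_left_mono) (auto simp: m_def)
      also have "\<dots> = e / 4 * h\<^sup>2" using m by simp
      finally show ?thesis .
    qed
    have "(\<lambda>n. ?I (M n)) \<longlonglongrightarrow> ?I \<mu>"
      using f h by (intro integral_quadrant_integral_tendsto[OF conv] test_fun_second_difference) auto
    then have "\<forall>\<^sub>F n in sequentially. dist (?I (M n)) (?I \<mu>) < e / 4 * h\<^sup>2"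
      using e h by (intro tendstoD) auto
    then show "\<forall>\<^sub>F n in sequentially. dist (LINT z|M n. f z) (LINT z|\<mu>. f z) < e"
    proof eventually_elim
      case (elim n)
      have "h\<^sup>2 * \<bar>(LINT z|M n. f z) - (LINT z|\<mu>. f z)\<bar> = \<bar>h\<^sup>2 * (LINT z|M n. f z) - h\<^sup>2 * (LINT z|\<mu>. f z)\<bar>"
        using h by (simp add: abs_mult right_diff_distrib[symmetric])
      also have "\<dots> \<le> 3 * (e / 4 * h\<^sup>2)"
        using approx[OF M[of n]] approx[OF \<mu>] elim unfolding dist_real_def by linarith
      also have "\<dots> < h\<^sup>2 * e" using e h by simp
      finally show ?case using h by (simp add: dist_real_def)
    qed
  qed
  then show ?thesis
    by (subst vague_converges_iff) (auto simp: seq.space_eq lim.space_eq)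
qed

section \<open>Gluing couplings from cells\<close>

definition add_measure :: "'a measure \<Rightarrow> 'a measure \<Rightarrow> 'a measure" where
  "add_measure M N = measure_of (space M) (sets M) (\<lambda>A. emeasure M A + emeasure N A)"

lemma sets_add_measure [simp, measurable_cong]: "sets (add_measure M N) = sets M"
  and space_add_measure [simp]: "space (add_measure M N) = space M"
  by (simp_all add: add_measure_def)

lemma emeasure_add_measure:
  assumes "sets N = sets M" "A \<in> sets M"
  shows "emeasure (add_measure M N) A = emeasure M A + emeasure N A"
  unfolding add_measure_def
proof (rule emeasure_measure_of_sigma)
  show "sigma_algebra (space M) (sets M)" by (rule sets.sigma_algebra_axioms)
  show "positive (sets M) (\<lambda>A. emeasure M A + emeasure N A)" by (simp add: positive_def)
  show "countably_additive (sets M) (\<lambda>A. emeasure M A + emeasure N A)"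
  proof (rule countably_additiveI)
    fix F :: "nat \<Rightarrow> 'a set" assume F: "range F \<subseteq> sets M" "disjoint_family F"
    have "(\<Sum>i. emeasure M (F i) + emeasure N (F i)) = (\<Sum>i. emeasure M (F i)) + (\<Sum>i. emeasure N (F i))"
      by (intro suminf_add[symmetric] summableI)
    also have "\<dots> = emeasure M (\<Union>i. F i) + emeasure N (\<Union>i. F i)"
      using F assms(1) by (simp add: suminf_emeasure)
    finally show "(\<Sum>i. emeasure M (F i) + emeasure N (F i)) = emeasure M (\<Union>i. F i) + emeasure N (\<Union>i. F i)" .
  qed
qed (use assms in auto)

lemma nn_integral_add_measure:
  assumes sets: "sets N = sets M" and f: "f \<in> borel_measurable M"
  shows "(\<integral>\<^sup>+ x. f x \<partial>add_measure M N) = (\<integral>\<^sup>+ x. f x \<partial>M) + (\<integral>\<^sup>+ x. f x \<partial>N)"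
  using f
proof (induction rule: borel_measurable_induct)
  case (cong f g)
  have sp: "space N = space M" using sets by (rule sets_eq_imp_space_eq)
  have "(\<integral>\<^sup>+ x. f x \<partial>add_measure M N) = (\<integral>\<^sup>+ x. g x \<partial>add_measure M N)"
    "(\<integral>\<^sup>+ x. f x \<partial>M) = (\<integral>\<^sup>+ x. g x \<partial>M)" "(\<integral>\<^sup>+ x. f x \<partial>N) = (\<integral>\<^sup>+ x. g x \<partial>N)"
    by (rule nn_integral_cong, simp add: cong(3) sp)+
  with cong show ?case by simp
next
  case (set A)
  then show ?case using sets by (simp add: emeasure_add_measure)
next
  case (mult u c)
  moreover have "u \<in> borel_measurable (add_measure M N)" "u \<in> borel_measurable N"
    using mult sets by (simp_all cong: measurable_cong_sets)
  ultimately show ?case by (simp add: nn_integral_cmult distrib_left)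
next
  case (add u v)
  moreover have "u \<in> borel_measurable (add_measure M N)" "u \<in> borel_measurable N"
    "v \<in> borel_measurable (add_measure M N)" "v \<in> borel_measurable N"
    using add sets by (simp_all cong: measurable_cong_sets)
  ultimately show ?case by (simp add: nn_integral_add ac_simps)
next
  case (seq U)
  have m: "U i \<in> borel_measurable (add_measure M N)" "U i \<in> borel_measurable N" for i
    using seq(1) sets by (simp_all cong: measurable_cong_sets)
  have inc: "incseq (\<lambda>i. \<integral>\<^sup>+ x. U i x \<partial>M)" "incseq (\<lambda>i. \<integral>\<^sup>+ x. U i x \<partial>N)"
    using seq(3) by (auto simp: incseq_def le_fun_def intro!: nn_integral_mono)
  show ?case
    using seq(1,3,4) m inc
    by (simp add: SUP_apply image_comp nn_integral_monotone_convergence_SUP seq.IH ennreal_SUP_add)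
qed

text \<open>The cells \<open>u i\<close> are meant as the pieces of a partition of a cutoff
  function, whence a sum of at most 1 instead of 1. \<open>e\<close> bounds how far mass travels
  inside a cell, \<open>S\<close> the price of sending a unit of mass from a cell to the
  diagonal.\<close>

locale gluing = fst: tail_bounded p q C \<mu> + snd: tail_bounded p q C \<nu> for p q C \<mu> \<nu> +
  fixes I :: "'i set" and u :: "'i \<Rightarrow> real \<times> real \<Rightarrow> real" and \<delta> e S s :: real
  assumes finite_I: "finite I"
    and u_borel [measurable]: "\<And>i. u i \<in> borel_measurable borel"
    and u_nonneg: "\<And>i z. 0 \<le> u i z"
    and u_sum: "\<And>z. (\<Sum>i\<in>I. u i z) \<le> 1"
    and \<delta>: "0 < \<delta>" and u_support: "\<And>i z. i \<in> I \<Longrightarrow> z \<notin> diag_compl \<delta> \<Longrightarrow> u i z = 0"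
    and u_diam: "\<And>i z w. i \<in> I \<Longrightarrow> u i z \<noteq> 0 \<Longrightarrow> u i w \<noteq> 0 \<Longrightarrow> dinf z w \<le> e"
    and S: "\<And>i z. i \<in> I \<Longrightarrow> u i z \<noteq> 0 \<Longrightarrow> dist_diag z powr s \<le> S"
    and s: "p < s" "s < q"
begin

definition m :: "'i \<Rightarrow> real" where "m i = (LINT z|\<mu>. u i z)"
definition m' :: "'i \<Rightarrow> real" where "m' i = (LINT z|\<nu>. u i z)"
definition c :: "'i \<Rightarrow> real" where "c i = min (m i) (m' i) / (m i * m' i)"
text \<open>Density of the exchange with respect to the product measure. In cell \<open>i\<close>
  the product of the two weighted measures has mass \<open>m i * m' i\<close>, and
  \<open>c i\<close> rescales it to the smaller of the two cell masses.\<close>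

definition k :: "real \<times> real \<Rightarrow> real \<times> real \<Rightarrow> real" where "k z w = (\<Sum>i\<in>I. c i * u i z * u i w)"
definition a :: "real \<times> real \<Rightarrow> real" where "a z = 1 - (\<Sum>i\<in>I. c i * m' i * u i z)"
definition b :: "real \<times> real \<Rightarrow> real" where "b z = 1 - (\<Sum>i\<in>I. c i * m i * u i z)"

text \<open>Mass is exchanged between \<open>\<mu>\<close> and \<open>\<nu>\<close> only inside the cells \<open>u i\<close>, as much as the lighter of the two
  permits; what is left over is projected to the diagonal. The division by zero in \<open>c\<close> is harmless:
  no mass is exchanged in a cell that is empty for one of the measures.\<close>

definition coupling :: "((real \<times> real) \<times> (real \<times> real)) measure" where
  "coupling = add_measure
    (add_measure (distr (density (\<mu> \<Otimes>\<^sub>M \<nu>) (\<lambda>(z, w). ennreal (k z w))) bar_pairs (\<lambda>v. v))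
      (distr (density \<mu> (\<lambda>z. ennreal (a z))) bar_pairs (\<lambda>z. (z, diag_proj z))))
    (distr (density \<nu> (\<lambda>w. ennreal (b w))) bar_pairs (\<lambda>w. (diag_proj w, w)))"

lemma s_pos: "0 < s"
  using s fst.p_ge_1 by linarith

lemma u_le_1: "i \<in> I \<Longrightarrow> u i z \<le> 1"
  using member_le_sum[of i I "\<lambda>i. u i z"] u_sum[of z] u_nonneg finite_I by fastforce

lemma m_nonneg: "0 \<le> m i" "0 \<le> m' i"
  unfolding m_def m'_def by (intro Bochner_Integration.integral_nonneg u_nonneg)+

lemma c_nonneg: "0 \<le> c i"
  using m_nonneg by (simp add: c_def)

lemma integrable_u: "i \<in> I \<Longrightarrow> integrable \<mu> (u i)" "i \<in> I \<Longrightarrow> integrable \<nu> (u i)"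
  by (intro fst.integrable_bounded_support[of _ 1 \<delta>] snd.integrable_bounded_support[of _ 1 \<delta>];
      use \<delta> u_support u_nonneg u_le_1 in simp)+

text \<open>If a cell is empty for one measure, then \<open>c i = 0\<close> and the minimum of the
  masses is 0 too, so the identity in the middle survives. The last two bounds say that only the
  surplus of the heavier measure remains unmatched.\<close>

lemma c_m: "c i * m' i \<le> 1" "c i * m i \<le> 1" "c i * m i * m' i = min (m i) (m' i)"
  "m i - c i * m' i * m i \<le> \<bar>m i - m' i\<bar>" "m' i - c i * m i * m' i \<le> \<bar>m i - m' i\<bar>"
proof -
  have *: "c i * m i * m' i = min (m i) (m' i)"
    using m_nonneg[of i] by (auto simp: c_def min_def)
  then show "c i * m i * m' i = min (m i) (m' i)" .
  show "m i - c i * m' i * m i \<le> \<bar>m i - m' i\<bar>" "m' i - c i * m i * m' i \<le> \<bar>m i - m' i\<bar>"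
    using * by (simp_all add: ac_simps)
  show "c i * m' i \<le> 1"
  proof (cases "m i = 0 \<or> m' i = 0")
    case False
    then have "0 < m i" "0 < m' i" using m_nonneg[of i] by auto
    then show ?thesis by (simp add: c_def divide_le_eq)
  qed (auto simp: c_def)
  show "c i * m i \<le> 1"
  proof (cases "m i = 0 \<or> m' i = 0")
    case False
    then have "0 < m i" "0 < m' i" using m_nonneg[of i] by auto
    then show ?thesis by (simp add: c_def divide_le_eq)
  qed (auto simp: c_def)
qed

lemma weight_bounds:
  assumes "\<And>i. 0 \<le> d i" "\<And>i. d i \<le> 1"
  shows "0 \<le> (\<Sum>i\<in>I. d i * u i z)" "(\<Sum>i\<in>I. d i * u i z) \<le> 1"
proof -
  show "0 \<le> (\<Sum>i\<in>I. d i * u i z)" using assms u_nonneg by (intro sum_nonneg mult_nonneg_nonneg)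
  have "(\<Sum>i\<in>I. d i * u i z) \<le> (\<Sum>i\<in>I. u i z)"
    using assms u_nonneg by (intro sum_mono mult_left_le_one_le) auto
  with u_sum[of z] show "(\<Sum>i\<in>I. d i * u i z) \<le> 1" by linarith
qed

lemma a_b_nonneg: "0 \<le> a z" "0 \<le> b z" "a z \<le> 1" "b z \<le> 1"
  using weight_bounds[of "\<lambda>i. c i * m' i" z] weight_bounds[of "\<lambda>i. c i * m i" z] c_m c_nonneg m_nonneg
  by (auto simp: a_def b_def)

lemma k_nonneg: "0 \<le> k z w"
  unfolding k_def using c_nonneg u_nonneg by (intro sum_nonneg mult_nonneg_nonneg)

lemma measurable_a_b [measurable]: "a \<in> borel_measurable borel" "b \<in> borel_measurable borel"
  unfolding a_def b_def by measurable

lemma measurable_k [measurable]: "(\<lambda>(z, w). k z w) \<in> borel_measurable (\<mu> \<Otimes>\<^sub>M \<nu>)"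
  unfolding k_def by measurable

lemma measurable_id_bar_pairs: "(\<lambda>v. v) \<in> measurable (\<mu> \<Otimes>\<^sub>M \<nu>) bar_pairs"
proof (rule measurable_restrict_space2)
  show "(\<lambda>v. v) \<in> space (\<mu> \<Otimes>\<^sub>M \<nu>) \<rightarrow> halfplane_bar \<times> halfplane_bar"
    using halfplane_subset_bar by (auto simp: space_pair_measure fst.space_eq snd.space_eq)
  have "(\<lambda>v. (fst v, snd v)) \<in> measurable (\<mu> \<Otimes>\<^sub>M \<nu>) (borel \<Otimes>\<^sub>M borel)"
    by measurable
  then show "(\<lambda>v. v) \<in> borel_measurable (\<mu> \<Otimes>\<^sub>M \<nu>)"
    by (simp add: borel_prod)
qed

lemma measurable_graph_bar_pairs:
  "(\<lambda>z. (z, diag_proj z)) \<in> measurable \<mu> bar_pairs" "(\<lambda>w. (diag_proj w, w)) \<in> measurable \<nu> bar_pairs"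
proof -
  have m: "(\<lambda>z. (z, diag_proj z)) \<in> borel_measurable borel" "(\<lambda>z. (diag_proj z, z)) \<in> borel_measurable borel"
    unfolding diag_proj_def by (intro borel_measurable_continuous_onI continuous_intros; simp)+
  have sp: "(\<lambda>z. (z, diag_proj z)) \<in> space \<mu> \<rightarrow> halfplane_bar \<times> halfplane_bar"
    "(\<lambda>w. (diag_proj w, w)) \<in> space \<nu> \<rightarrow> halfplane_bar \<times> halfplane_bar"
    by (auto simp: fst.space_eq snd.space_eq halfplane_eq halfplane_bar_eq diag_proj_def)
  show "(\<lambda>z. (z, diag_proj z)) \<in> measurable \<mu> bar_pairs"
    by (rule measurable_restrict_space2[OF sp(1) fst.measurable_of_borel[OF m(1)]])
  show "(\<lambda>w. (diag_proj w, w)) \<in> measurable \<nu> bar_pairs"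
    by (rule measurable_restrict_space2[OF sp(2) snd.measurable_of_borel[OF m(2)]])
qed

lemma sets_coupling: "sets coupling = sets bar_pairs"
  by (simp add: coupling_def)

text \<open>Reduces marginals and cost of the coupling to one double integral and two single ones,
  by choosing \<open>F\<close>.\<close>

lemma nn_integral_coupling:
  assumes F: "F \<in> borel_measurable bar_pairs"
  shows "(\<integral>\<^sup>+ v. F v \<partial>coupling) = (\<integral>\<^sup>+ z. \<integral>\<^sup>+ w. ennreal (k z w) * F (z, w) \<partial>\<nu> \<partial>\<mu>)
    + (\<integral>\<^sup>+ z. ennreal (a z) * F (z, diag_proj z) \<partial>\<mu>) + (\<integral>\<^sup>+ w. ennreal (b w) * F (diag_proj w, w) \<partial>\<nu>)"
proof -
  interpret pair_sigma_finite \<mu> \<nu>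
    by (intro pair_sigma_finite.intro fst.sigma_finite snd.sigma_finite)
  note ms = measurable_id_bar_pairs measurable_graph_bar_pairs
  have F': "F \<in> borel_measurable N" if "sets N = sets bar_pairs" for N
    using F unfolding measurable_cong_sets[OF that refl] .
  note mF = measurable_compose[OF ms(1) F] measurable_compose[OF ms(2) F] measurable_compose[OF ms(3) F]
  have [measurable]: "(\<lambda>z. ennreal (a z)) \<in> borel_measurable \<mu>" "(\<lambda>w. ennreal (b w)) \<in> borel_measurable \<nu>"
    "(\<lambda>v. ennreal (k (fst v) (snd v))) \<in> borel_measurable (\<mu> \<Otimes>\<^sub>M \<nu>)"
    using measurable_a_b measurable_k fst.measurable_of_borel snd.measurable_of_borel
    by (auto simp: case_prod_unfold)
  have "(\<integral>\<^sup>+ v. F v \<partial>coupling) =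
      (\<integral>\<^sup>+ v. F v \<partial>density (\<mu> \<Otimes>\<^sub>M \<nu>) (\<lambda>(z, w). ennreal (k z w)))
    + (\<integral>\<^sup>+ z. F (z, diag_proj z) \<partial>density \<mu> (\<lambda>z. ennreal (a z)))
    + (\<integral>\<^sup>+ w. F (diag_proj w, w) \<partial>density \<nu> (\<lambda>w. ennreal (b w)))"
    unfolding coupling_def by (simp add: nn_integral_add_measure nn_integral_distr F F' ms)
  also have "\<dots> = (\<integral>\<^sup>+ v. ennreal (k (fst v) (snd v)) * F v \<partial>(\<mu> \<Otimes>\<^sub>M \<nu>))
    + (\<integral>\<^sup>+ z. ennreal (a z) * F (z, diag_proj z) \<partial>\<mu>) + (\<integral>\<^sup>+ w. ennreal (b w) * F (diag_proj w, w) \<partial>\<nu>)"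
    using mF by (simp add: nn_integral_density case_prod_unfold)
  also have "(\<integral>\<^sup>+ v. ennreal (k (fst v) (snd v)) * F v \<partial>(\<mu> \<Otimes>\<^sub>M \<nu>)) = (\<integral>\<^sup>+ z. \<integral>\<^sup>+ w. ennreal (k z w) * F (z, w) \<partial>\<nu> \<partial>\<mu>)"
    using mF(1) by (subst snd.sigma_finite[THEN sigma_finite_measure.nn_integral_fst, symmetric]) auto
  finally show ?thesis .
qed

lemma integrable_k: "integrable \<nu> (k z)" "integrable \<mu> (\<lambda>z. k z w)"
  unfolding k_def
  by (intro Bochner_Integration.integrable_sum integrable_mult_left integrable_mult_right integrable_u; assumption)+

text \<open>The marginals of the exchange have densities \<open>1 - a\<close> and
  \<open>1 - b\<close>; thus \<open>a\<close> and \<open>b\<close> are exactly what is left to be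
  sent to the diagonal.\<close>

lemma nn_integral_k:
  "(\<integral>\<^sup>+ w. ennreal (k z w) \<partial>\<nu>) = ennreal (1 - a z)" "(\<integral>\<^sup>+ z. ennreal (k z w) \<partial>\<mu>) = ennreal (1 - b w)"
proof -
  have "(\<integral>\<^sup>+ w. ennreal (k z w) \<partial>\<nu>) = ennreal (LINT w|\<nu>. k z w)"
    using k_nonneg integrable_k by (intro nn_integral_eq_integral) auto
  also have "(LINT w|\<nu>. k z w) = (\<Sum>i\<in>I. c i * u i z * m' i)"
    unfolding k_def using integrable_u by (simp add: m'_def)
  finally show "(\<integral>\<^sup>+ w. ennreal (k z w) \<partial>\<nu>) = ennreal (1 - a z)"
    by (simp add: a_def ac_simps)
  have "(\<integral>\<^sup>+ z. ennreal (k z w) \<partial>\<mu>) = ennreal (LINT z|\<mu>. k z w)"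
    using k_nonneg integrable_k by (intro nn_integral_eq_integral) auto
  also have "(LINT z|\<mu>. k z w) = (\<Sum>i\<in>I. c i * u i w * m i)"
    unfolding k_def using integrable_u by (simp add: m_def ac_simps)
  finally show "(\<integral>\<^sup>+ z. ennreal (k z w) \<partial>\<mu>) = ennreal (1 - b w)"
    by (simp add: b_def ac_simps)
qed

text \<open>On a set inside the open half-plane one of the two diagonal pieces contributes nothing,
  its relevant coordinate being on the diagonal. The exchanged part and the other piece have
  densities adding up to 1.\<close>

lemma coupling_in_couplings: "coupling \<in> couplings \<mu> \<nu>"
  unfolding couplings_def
proof (intro CollectI conjI ballI impI)
  interpret pair_sigma_finite \<mu> \<nu>
    by (intro pair_sigma_finite.intro fst.sigma_finite snd.sigma_finite)
  fix A :: "(real \<times> real) set" assume A: "A \<in> sets borel" "A \<subseteq> halfplane"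
  have Ab: "A \<subseteq> halfplane_bar" using A halfplane_subset_bar by auto
  have in_R: "A \<times> halfplane_bar \<in> sets bar_pairs" "halfplane_bar \<times> A \<in> sets bar_pairs"
    using A Ab by (auto intro: Times_in_sets_bar_pairs)
  have [measurable]: "A \<in> sets \<mu>" "A \<in> sets \<nu>" using A by (auto intro: fst.in_sets snd.in_sets)
  have proj: "diag_proj z \<notin> A" for z using A(2) diag_proj_in_bar(2) by blast
  have add1: "ennreal (1 - a z) + ennreal (a z) = 1" "ennreal (1 - b z) + ennreal (b z) = 1" for z
    using a_b_nonneg[of z] by (simp_all add: ennreal_plus[symmetric] del: ennreal_plus)
  have "emeasure coupling (A \<times> halfplane_bar) = (\<integral>\<^sup>+ v. indicator (A \<times> halfplane_bar) v \<partial>coupling)"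
    using in_R by (simp add: sets_coupling)
  also have "\<dots> = (\<integral>\<^sup>+ z. \<integral>\<^sup>+ w. ennreal (k z w) * indicator (A \<times> halfplane_bar) (z, w) \<partial>\<nu> \<partial>\<mu>)
    + (\<integral>\<^sup>+ z. ennreal (a z) * indicator (A \<times> halfplane_bar) (z, diag_proj z) \<partial>\<mu>)
    + (\<integral>\<^sup>+ w. ennreal (b w) * indicator (A \<times> halfplane_bar) (diag_proj w, w) \<partial>\<nu>)"
    using in_R by (intro nn_integral_coupling) auto
  also have "(\<integral>\<^sup>+ w. ennreal (b w) * indicator (A \<times> halfplane_bar) (diag_proj w, w) \<partial>\<nu>) = 0"
    using proj by (simp add: indicator_def)
  also have "(\<integral>\<^sup>+ z. ennreal (a z) * indicator (A \<times> halfplane_bar) (z, diag_proj z) \<partial>\<mu>) = (\<integral>\<^sup>+ z. ennreal (a z) * indicator A z \<partial>\<mu>)"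
    by (intro nn_integral_cong) (auto simp: indicator_def)
  also have "(\<integral>\<^sup>+ z. \<integral>\<^sup>+ w. ennreal (k z w) * indicator (A \<times> halfplane_bar) (z, w) \<partial>\<nu> \<partial>\<mu>) = (\<integral>\<^sup>+ z. ennreal (1 - a z) * indicator A z \<partial>\<mu>)"
  proof (intro nn_integral_cong)
    fix z
    have "(\<integral>\<^sup>+ w. ennreal (k z w) * indicator (A \<times> halfplane_bar) (z, w) \<partial>\<nu>) = (\<integral>\<^sup>+ w. ennreal (k z w) \<partial>\<nu>) * indicator A z"
      using halfplane_subset_bar
      by (cases "z \<in> A") (auto simp: snd.space_eq intro!: nn_integral_cong)
    then show "(\<integral>\<^sup>+ w. ennreal (k z w) * indicator (A \<times> halfplane_bar) (z, w) \<partial>\<nu>) = ennreal (1 - a z) * indicator A z"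
      by (simp add: nn_integral_k)
  qed
  also have "(\<integral>\<^sup>+ z. ennreal (1 - a z) * indicator A z \<partial>\<mu>) + (\<integral>\<^sup>+ z. ennreal (a z) * indicator A z \<partial>\<mu>) + 0
      = (\<integral>\<^sup>+ z. ennreal (1 - a z) * indicator A z + ennreal (a z) * indicator A z \<partial>\<mu>)"
    unfolding add_0_right by (intro nn_integral_add[symmetric]) measurable
  also have "\<dots> = (\<integral>\<^sup>+ z. indicator A z \<partial>\<mu>)"
    by (simp only: distrib_right[symmetric] add1 mult_1)
  also have "\<dots> = emeasure \<mu> A" by simp
  finally show "emeasure coupling (A \<times> halfplane_bar) = emeasure \<mu> A" .
  have mk: "(\<lambda>v. ennreal (k (fst v) (snd v)) * indicator A (snd v)) \<in> borel_measurable (\<mu> \<Otimes>\<^sub>M \<nu>)"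
    using measurable_k unfolding case_prod_unfold by measurable
  have "emeasure coupling (halfplane_bar \<times> A) = (\<integral>\<^sup>+ v. indicator (halfplane_bar \<times> A) v \<partial>coupling)"
    using in_R by (simp add: sets_coupling)
  also have "\<dots> = (\<integral>\<^sup>+ z. \<integral>\<^sup>+ w. ennreal (k z w) * indicator (halfplane_bar \<times> A) (z, w) \<partial>\<nu> \<partial>\<mu>)
    + (\<integral>\<^sup>+ z. ennreal (a z) * indicator (halfplane_bar \<times> A) (z, diag_proj z) \<partial>\<mu>)
    + (\<integral>\<^sup>+ w. ennreal (b w) * indicator (halfplane_bar \<times> A) (diag_proj w, w) \<partial>\<nu>)"
    using in_R by (intro nn_integral_coupling) auto
  also have "(\<integral>\<^sup>+ z. ennreal (a z) * indicator (halfplane_bar \<times> A) (z, diag_proj z) \<partial>\<mu>) = 0"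
    using proj by (simp add: indicator_def)
  also have "(\<integral>\<^sup>+ w. ennreal (b w) * indicator (halfplane_bar \<times> A) (diag_proj w, w) \<partial>\<nu>) = (\<integral>\<^sup>+ w. ennreal (b w) * indicator A w \<partial>\<nu>)"
    by (intro nn_integral_cong) (auto simp: indicator_def)
  also have "(\<integral>\<^sup>+ z. \<integral>\<^sup>+ w. ennreal (k z w) * indicator (halfplane_bar \<times> A) (z, w) \<partial>\<nu> \<partial>\<mu>)
      = (\<integral>\<^sup>+ z. \<integral>\<^sup>+ w. ennreal (k z w) * indicator A w \<partial>\<nu> \<partial>\<mu>)"
    using halfplane_subset_bar by (intro nn_integral_cong) (auto simp: fst.space_eq indicator_def)
  also have "\<dots> = (\<integral>\<^sup>+ w. \<integral>\<^sup>+ z. ennreal (k z w) * indicator A w \<partial>\<mu> \<partial>\<nu>)"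
    using mk by (intro Fubini'[symmetric]) (simp add: case_prod_unfold)
  also have "\<dots> = (\<integral>\<^sup>+ w. ennreal (1 - b w) * indicator A w \<partial>\<nu>)"
  proof (intro nn_integral_cong)
    fix w
    show "(\<integral>\<^sup>+ z. ennreal (k z w) * indicator A w \<partial>\<mu>) = ennreal (1 - b w) * indicator A w"
      by (cases "w \<in> A") (auto simp: nn_integral_k)
  qed
  also have "(\<integral>\<^sup>+ w. ennreal (1 - b w) * indicator A w \<partial>\<nu>) + 0 + (\<integral>\<^sup>+ w. ennreal (b w) * indicator A w \<partial>\<nu>)
      = (\<integral>\<^sup>+ w. ennreal (1 - b w) * indicator A w + ennreal (b w) * indicator A w \<partial>\<nu>)"
    unfolding add_0_right by (intro nn_integral_add[symmetric]) measurable
  also have "\<dots> = (\<integral>\<^sup>+ w. indicator A w \<partial>\<nu>)"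
    by (simp only: distrib_right[symmetric] add1 mult_1)
  also have "\<dots> = emeasure \<nu> A" by simp
  finally show "emeasure coupling (halfplane_bar \<times> A) = emeasure \<nu> A" .
qed (simp add: sets_coupling)

text \<open>Serves both measures: \<open>d i\<close> is the matched fraction of cell
  \<open>i\<close>, namely \<open>c i * m' i\<close> for \<open>\<mu>\<close> and
  \<open>c i * m i\<close> for \<open>\<nu>\<close>. What remains is the part outside the cutoff,
  kept as an integral, and the unmatched part of the cells, priced at most
  \<open>\<bar>S\<bar>\<close> per unit.\<close>

lemma leftover_le:
  fixes d d' :: "'i \<Rightarrow> real" and N
  assumes N: "tail_bounded p q C N" and int: "\<And>i. i \<in> I \<Longrightarrow> integrable N (u i)"
    and d: "\<And>i. 0 \<le> d i" "\<And>i. d i \<le> 1"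
    and d': "\<And>i. (1 - d i) * (LINT z|N. u i z) \<le> d' i"
  shows "(\<integral>\<^sup>+ z. ennreal (1 - (\<Sum>i\<in>I. d i * u i z)) * ennreal (dist_diag z powr s) \<partial>N)
    \<le> ennreal ((LINT z|N. (1 - (\<Sum>i\<in>I. u i z)) * dist_diag z powr s) + \<bar>S\<bar> * (\<Sum>i\<in>I. d' i))"
proof -
  interpret N: tail_bounded p q C N by (rule N)
  have int1: "integrable N (\<lambda>z. (1 - (\<Sum>i\<in>I. u i z)) * dist_diag z powr s)"
  proof (rule Bochner_Integration.integrable_bound[OF N.integrable_dist_diag_powr[OF s]])
    show "(\<lambda>z. (1 - (\<Sum>i\<in>I. u i z)) * dist_diag z powr s) \<in> borel_measurable N"
      by (intro N.measurable_of_borel) measurable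
    show "AE z in N. norm ((1 - (\<Sum>i\<in>I. u i z)) * dist_diag z powr s) \<le> norm (dist_diag z powr s)"
    proof (rule AE_I2)
      fix z
      show "norm ((1 - (\<Sum>i\<in>I. u i z)) * dist_diag z powr s) \<le> norm (dist_diag z powr s)"
        using u_sum[of z] sum_nonneg[of I "\<lambda>i. u i z"] u_nonneg
        by (simp add: abs_mult mult_left_le_one_le)
    qed
  qed
  have int2: "integrable N (\<lambda>z. \<bar>S\<bar> * (\<Sum>i\<in>I. (1 - d i) * u i z))"
    using int by (intro integrable_mult_right integrable_sum) auto
  have le: "(1 - (\<Sum>i\<in>I. d i * u i z)) * dist_diag z powr s
      \<le> (1 - (\<Sum>i\<in>I. u i z)) * dist_diag z powr s + \<bar>S\<bar> * (\<Sum>i\<in>I. (1 - d i) * u i z)" for z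
  proof -
    \<comment> \<open>Separates mass never covered by cells from mass covered but unmatched.\<close>
    have eq: "(1 - (\<Sum>i\<in>I. d i * u i z)) = (1 - (\<Sum>i\<in>I. u i z)) + (\<Sum>i\<in>I. (1 - d i) * u i z)"
      by (simp add: left_diff_distrib sum_subtractf)
    moreover have "(\<Sum>i\<in>I. (1 - d i) * u i z) * dist_diag z powr s \<le> \<bar>S\<bar> * (\<Sum>i\<in>I. (1 - d i) * u i z)"
      unfolding sum_distrib_left sum_distrib_right
    proof (rule sum_mono)
      fix i assume i: "i \<in> I"
      show "(1 - d i) * u i z * dist_diag z powr s \<le> \<bar>S\<bar> * ((1 - d i) * u i z)"
      proof (cases "u i z = 0")
        case False
        then have "dist_diag z powr s \<le> \<bar>S\<bar>" using S[OF i] by fastforce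
        then have "(1 - d i) * u i z * dist_diag z powr s \<le> (1 - d i) * u i z * \<bar>S\<bar>"
          using d u_nonneg by (intro mult_left_mono mult_nonneg_nonneg) auto
        then show ?thesis by (simp add: ac_simps)
      qed simp
    qed
    ultimately show ?thesis by (subst eq) (simp add: distrib_right)
  qed
  have nonneg: "0 \<le> (1 - (\<Sum>i\<in>I. u i z)) * dist_diag z powr s + \<bar>S\<bar> * (\<Sum>i\<in>I. (1 - d i) * u i z)" for z
    using u_sum[of z] d u_nonneg by (intro add_nonneg_nonneg mult_nonneg_nonneg sum_nonneg) auto
  have "(\<integral>\<^sup>+ z. ennreal (1 - (\<Sum>i\<in>I. d i * u i z)) * ennreal (dist_diag z powr s) \<partial>N)
    \<le> (\<integral>\<^sup>+ z. ennreal ((1 - (\<Sum>i\<in>I. u i z)) * dist_diag z powr s + \<bar>S\<bar> * (\<Sum>i\<in>I. (1 - d i) * u i z)) \<partial>N)"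
    using weight_bounds[OF d] le
    by (intro nn_integral_mono) (simp add: ennreal_mult[symmetric] ennreal_leI)
  also have "\<dots> = ennreal (LINT z|N. (1 - (\<Sum>i\<in>I. u i z)) * dist_diag z powr s + \<bar>S\<bar> * (\<Sum>i\<in>I. (1 - d i) * u i z))"
    using int1 int2 nonneg by (intro nn_integral_eq_integral) auto
  also have "(LINT z|N. (1 - (\<Sum>i\<in>I. u i z)) * dist_diag z powr s + \<bar>S\<bar> * (\<Sum>i\<in>I. (1 - d i) * u i z))
      = (LINT z|N. (1 - (\<Sum>i\<in>I. u i z)) * dist_diag z powr s) + \<bar>S\<bar> * (\<Sum>i\<in>I. (1 - d i) * (LINT z|N. u i z))"
    using int1 int2 int by simp
  also have "ennreal \<dots> \<le> ennreal ((LINT z|N. (1 - (\<Sum>i\<in>I. u i z)) * dist_diag z powr s) + \<bar>S\<bar> * (\<Sum>i\<in>I. d' i))"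
    by (intro ennreal_leI add_left_mono mult_left_mono sum_mono d') auto
  finally show ?thesis .
qed

text \<open>Exchanged mass moves by at most \<open>e\<close> and amounts to the sum of
  \<open>min (m i) (m' i)\<close>. The two diagonal pieces pay \<open>dist_diag\<close> to the power
  \<open>s\<close>, because \<open>diag_proj\<close> is a nearest diagonal point, and are estimated
  by \<open>leftover_le\<close>.\<close>

lemma cost_coupling_le:
  "cost s coupling \<le> ennreal (e powr s * (\<Sum>i\<in>I. m' i))
    + ennreal ((LINT z|\<mu>. (1 - (\<Sum>i\<in>I. u i z)) * dist_diag z powr s) + \<bar>S\<bar> * (\<Sum>i\<in>I. \<bar>m i - m' i\<bar>))
    + ennreal ((LINT z|\<nu>. (1 - (\<Sum>i\<in>I. u i z)) * dist_diag z powr s) + \<bar>S\<bar> * (\<Sum>i\<in>I. \<bar>m i - m' i\<bar>))"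
proof -
  have "cost s coupling = (\<integral>\<^sup>+ z. \<integral>\<^sup>+ w. ennreal (k z w) * ennreal (dinf z w powr s) \<partial>\<nu> \<partial>\<mu>)
    + (\<integral>\<^sup>+ z. ennreal (a z) * ennreal (dinf z (diag_proj z) powr s) \<partial>\<mu>)
    + (\<integral>\<^sup>+ w. ennreal (b w) * ennreal (dinf (diag_proj w) w powr s) \<partial>\<nu>)"
    unfolding cost_def using nn_integral_coupling[OF borel_measurable_cost[of s]] by simp
  also have "\<dots> \<le> ennreal (e powr s * (\<Sum>i\<in>I. m' i))
    + ennreal ((LINT z|\<mu>. (1 - (\<Sum>i\<in>I. u i z)) * dist_diag z powr s) + \<bar>S\<bar> * (\<Sum>i\<in>I. \<bar>m i - m' i\<bar>))
    + ennreal ((LINT z|\<nu>. (1 - (\<Sum>i\<in>I. u i z)) * dist_diag z powr s) + \<bar>S\<bar> * (\<Sum>i\<in>I. \<bar>m i - m' i\<bar>))"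
  proof (intro add_mono)
    have "(\<integral>\<^sup>+ z. \<integral>\<^sup>+ w. ennreal (k z w) * ennreal (dinf z w powr s) \<partial>\<nu> \<partial>\<mu>)
        \<le> (\<integral>\<^sup>+ z. \<integral>\<^sup>+ w. ennreal (e powr s) * ennreal (k z w) \<partial>\<nu> \<partial>\<mu>)"
    proof (intro nn_integral_mono)
      fix z w
      have "k z w * dinf z w powr s \<le> e powr s * k z w"
        unfolding k_def sum_distrib_left sum_distrib_right
      proof (rule sum_mono)
        fix i assume i: "i \<in> I"
        show "c i * u i z * u i w * dinf z w powr s \<le> e powr s * (c i * u i z * u i w)"
        proof (cases "u i z = 0 \<or> u i w = 0")
          case False
          then have "dinf z w powr s \<le> e powr s"
            using u_diam[OF i, of z w] s_pos by (intro powr_mono2) auto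
          then have "c i * u i z * u i w * dinf z w powr s \<le> c i * u i z * u i w * e powr s"
            using c_nonneg u_nonneg by (intro mult_left_mono mult_nonneg_nonneg) auto
          then show ?thesis by (simp add: ac_simps)
        qed auto
      qed
      then show "ennreal (k z w) * ennreal (dinf z w powr s) \<le> ennreal (e powr s) * ennreal (k z w)"
        using k_nonneg by (simp add: ennreal_mult[symmetric] ennreal_leI)
    qed
    also have "\<dots> = (\<integral>\<^sup>+ z. ennreal (e powr s) * ennreal (1 - a z) \<partial>\<mu>)"
    proof (intro nn_integral_cong)
      fix z
      have "(\<lambda>w. k z w) \<in> borel_measurable \<nu>" unfolding k_def by measurable
      then show "(\<integral>\<^sup>+ w. ennreal (e powr s) * ennreal (k z w) \<partial>\<nu>) = ennreal (e powr s) * ennreal (1 - a z)"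
        by (simp add: nn_integral_cmult nn_integral_k)
    qed
    also have "\<dots> = (\<integral>\<^sup>+ z. ennreal (e powr s * (1 - a z)) \<partial>\<mu>)"
      using a_b_nonneg by (simp add: ennreal_mult)
    also have "\<dots> = ennreal (LINT z|\<mu>. e powr s * (1 - a z))"
      using a_b_nonneg integrable_u
      by (intro nn_integral_eq_integral) (auto simp: a_def intro!: integrable_mult_right integrable_sum)
    also have "(LINT z|\<mu>. e powr s * (1 - a z)) = e powr s * (\<Sum>i\<in>I. min (m i) (m' i))"
      using integrable_u c_m(3) by (simp add: a_def m_def[symmetric] ac_simps)
    also have "ennreal \<dots> \<le> ennreal (e powr s * (\<Sum>i\<in>I. m' i))"
      by (intro ennreal_leI mult_left_mono sum_mono) auto
    finally show "(\<integral>\<^sup>+ z. \<integral>\<^sup>+ w. ennreal (k z w) * ennreal (dinf z w powr s) \<partial>\<nu> \<partial>\<mu>) \<le> ennreal (e powr s * (\<Sum>i\<in>I. m' i))" .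
    show "(\<integral>\<^sup>+ z. ennreal (a z) * ennreal (dinf z (diag_proj z) powr s) \<partial>\<mu>)
      \<le> ennreal ((LINT z|\<mu>. (1 - (\<Sum>i\<in>I. u i z)) * dist_diag z powr s) + \<bar>S\<bar> * (\<Sum>i\<in>I. \<bar>m i - m' i\<bar>))"
      unfolding dinf_diag_proj dist_diag_eq[symmetric] a_def
      using c_m c_nonneg m_nonneg
      by (intro leftover_le fst.tail_bounded_axioms integrable_u)
         (auto simp: m_def[symmetric] left_diff_distrib)
    show "(\<integral>\<^sup>+ w. ennreal (b w) * ennreal (dinf (diag_proj w) w powr s) \<partial>\<nu>)
      \<le> ennreal ((LINT z|\<nu>. (1 - (\<Sum>i\<in>I. u i z)) * dist_diag z powr s) + \<bar>S\<bar> * (\<Sum>i\<in>I. \<bar>m i - m' i\<bar>))"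
      unfolding dinf_commute[of "diag_proj _"] dinf_diag_proj dist_diag_eq[symmetric] b_def
      using c_m c_nonneg m_nonneg
      by (intro leftover_le snd.tail_bounded_axioms integrable_u)
         (auto simp: m'_def[symmetric] left_diff_distrib)
  qed
  finally show ?thesis .
qed

end

section \<open>Cutoffs and partitions of unity\<close>

text \<open>For small \<open>t\<close> the power \<open>a\<close> wins by any factor, for large
  \<open>t\<close> the power \<open>b\<close> does, and on the remaining compact range all powers
  are comparable. No relation between \<open>r\<close> and the other exponents is required.\<close>

lemma powr_interpolation:
  fixes a b r s \<eta> :: real
  assumes "a < s" "s < b" "0 < \<eta>"
  obtains K where "0 \<le> K" "\<And>t. 0 \<le> t \<Longrightarrow> t powr s \<le> \<eta> * (t powr a + t powr b) + K * t powr r"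
proof -
  \<comment> \<open>The thresholds at which \<open>t powr (s - a)\<close> and
    \<open>t powr (s - b)\<close> equal \<open>\<eta>\<close>. Their order does not matter: the
    three cases below always cover the half-line.\<close>
  define t0 t1 where "t0 = \<eta> powr (1 / (s - a))" and "t1 = \<eta> powr (1 / (s - b))"
  have t0: "0 < t0" "t0 powr (s - a) = \<eta>" and t1: "0 < t1" "t1 powr (s - b) = \<eta>"
    using assms by (auto simp: t0_def t1_def powr_powr)
  define K where "K = t0 powr (s - r) + t1 powr (s - r)"
  have K: "0 \<le> K" by (simp add: K_def)
  show ?thesis
  proof (rule that[OF K])
    fix t :: real assume "0 \<le> t"
    show "t powr s \<le> \<eta> * (t powr a + t powr b) + K * t powr r"
    proof (cases "t = 0")
      case False
      with \<open>0 \<le> t\<close> have t: "0 < t" by simp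
      have split: "t powr s = t powr (s - c) * t powr c" for c by (simp add: powr_add[symmetric])
      consider "t \<le> t0" | "t1 \<le> t" | "t0 \<le> t" "t \<le> t1" by linarith
      then show ?thesis
      proof cases
        case 1
        then have "t powr (s - a) \<le> \<eta>" using t t0 assms powr_mono2[of "s - a" t t0] by auto
        then have "t powr s \<le> \<eta> * t powr a" unfolding split[of a] by (intro mult_right_mono) auto
        then show ?thesis using K assms by (simp add: distrib_left add_increasing2)
      next
        case 2
        then have "t powr (s - b) \<le> \<eta>" using t1 assms powr_mono2'[of "s - b" t1 t] by auto
        then have "t powr s \<le> \<eta> * t powr b" unfolding split[of b] by (intro mult_right_mono) auto
        then show ?thesis using K assms by (simp add: distrib_left add_increasing add_increasing2)
      next
        case 3
        have "t powr (s - r) \<le> K"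
        proof (cases "r \<le> s")
          case True
          then have "t powr (s - r) \<le> t1 powr (s - r)" using t 3 by (intro powr_mono2) auto
          then show ?thesis by (simp add: K_def add_increasing)
        next
          case False
          then have "t powr (s - r) \<le> t0 powr (s - r)" using t0 3 by (intro powr_mono2') auto
          then show ?thesis by (simp add: K_def add_increasing2)
        qed
        then have "t powr s \<le> K * t powr r" unfolding split[of r] by (intro mult_right_mono) auto
        then show ?thesis using assms by (simp add: add_increasing)
      qed
    qed (use K in simp)
  qed
qed

text \<open>The first factor vanishes for \<open>(snd z - fst z) / 2\<close> up to
  \<open>1 / k\<close> and is 1 from \<open>2 / k\<close> on; the second is 1 for norms up to
  \<open>k - 1\<close> and 0 from \<open>k\<close> on.\<close>

definition cutoff :: "real \<Rightarrow> real \<times> real \<Rightarrow> real" where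
  "cutoff k z = max 0 (min 1 (k * ((snd z - fst z) / 2) - 1)) * max 0 (min 1 (k - norm z))"

lemma cutoff_bounds: "0 \<le> cutoff k z" "cutoff k z \<le> 1"
  by (auto simp: cutoff_def intro!: mult_le_one)

lemma test_fun_cutoff:
  assumes "0 < k"
  shows "test_fun (cutoff k)"
proof (rule test_funI)
  let ?S = "{z. 2 / k \<le> snd z - fst z} \<inter> cball 0 k"
  show "continuous_on UNIV (cutoff k)"
    unfolding cutoff_def[abs_def] by (intro continuous_intros) auto
  show "compact ?S"
    by (intro closed_Int_compact closed_Collect_le continuous_intros compact_cball)
  show "?S \<subseteq> halfplane"
  proof
    fix z assume "z \<in> ?S"
    then have "2 / k \<le> snd z - fst z" by simp
    moreover have "0 < 2 / k" using assms by simp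
    ultimately show "z \<in> halfplane" unfolding halfplane_eq mem_Collect_eq by linarith
  qed
  show "cutoff k z = 0" if "z \<notin> ?S" for z
  proof (cases "norm z \<le> k")
    case True
    then have "snd z - fst z < 2 / k" using that by auto
    then have "k * ((snd z - fst z) / 2) < 1" using assms by (simp add: field_simps)
    then show ?thesis by (simp add: cutoff_def)
  qed (simp add: cutoff_def)
qed

lemma cutoff_tendsto_1:
  assumes "z \<in> halfplane"
  shows "(\<lambda>n. cutoff (real n) z) \<longlonglongrightarrow> 1"
proof -
  have "0 < (snd z - fst z) / 2" using assms by (simp add: halfplane_eq)
  then have "filterlim (\<lambda>n. real n * ((snd z - fst z) / 2)) at_top sequentially"
    by (intro filterlim_at_top_mult_tendsto_pos[OF tendsto_const] filterlim_real_sequentially)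
  then have "\<forall>\<^sub>F n in sequentially. 2 \<le> real n * ((snd z - fst z) / 2)"
    unfolding filterlim_at_top by blast
  moreover have "\<forall>\<^sub>F n in sequentially. norm z + 1 \<le> real n"
    using filterlim_real_sequentially unfolding filterlim_at_top by blast
  ultimately have "\<forall>\<^sub>F n in sequentially. cutoff (real n) z = 1"
    by eventually_elim (simp add: cutoff_def)
  then show ?thesis by (rule tendsto_eventually)
qed

text \<open>Inner regularity of the finite measure with density \<open>dist_diag z powr r\<close>,
  by dominated convergence along \<open>cutoff (real n)\<close>.\<close>

lemma (in tail_bounded) ex_cutoff:
  assumes r: "p < r" "r < q" and "0 < \<eta>"
  shows "\<exists>\<theta>. test_fun \<theta> \<and> (\<forall>z. 0 \<le> \<theta> z \<and> \<theta> z \<le> 1) \<and> (LINT z|\<mu>. (1 - \<theta> z) * dist_diag z powr r) < \<eta>"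
proof -
  have "(\<lambda>n. LINT z|\<mu>. (1 - cutoff (real n) z) * dist_diag z powr r) \<longlonglongrightarrow> (LINT z|\<mu>. 0)"
  proof (rule integral_dominated_convergence)
    show "integrable \<mu> (\<lambda>z. dist_diag z powr r)" by (rule integrable_dist_diag_powr[OF r])
    have "continuous_on UNIV (cutoff k)" for k
      unfolding cutoff_def[abs_def] by (intro continuous_intros) auto
    then have [measurable]: "cutoff k \<in> borel_measurable borel" for k
      by (rule borel_measurable_continuous_onI)
    show "(\<lambda>z. (1 - cutoff (real n) z) * dist_diag z powr r) \<in> borel_measurable \<mu>" for n
      by (intro measurable_of_borel) measurable
    show "AE z in \<mu>. (\<lambda>n. (1 - cutoff (real n) z) * dist_diag z powr r) \<longlonglongrightarrow> 0"
    proof (rule AE_I2)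
      fix z assume "z \<in> space \<mu>"
      then have "(\<lambda>n. (1 - cutoff (real n) z) * dist_diag z powr r) \<longlonglongrightarrow> (1 - 1) * dist_diag z powr r"
        by (intro tendsto_intros cutoff_tendsto_1) (simp add: space_eq)
      then show "(\<lambda>n. (1 - cutoff (real n) z) * dist_diag z powr r) \<longlonglongrightarrow> 0" by simp
    qed
    show "AE z in \<mu>. norm ((1 - cutoff (real n) z) * dist_diag z powr r) \<le> dist_diag z powr r" for n
      using cutoff_bounds by (intro AE_I2) (simp add: abs_mult mult_left_le_one_le)
  qed simp
  then have "\<forall>\<^sub>F n in sequentially. (LINT z|\<mu>. (1 - cutoff (real n) z) * dist_diag z powr r) < \<eta>"
    using \<open>0 < \<eta>\<close> by (intro order_tendstoD(2)) auto
  then have "\<forall>\<^sub>F n in sequentially. (LINT z|\<mu>. (1 - cutoff (real n) z) * dist_diag z powr r) < \<eta> \<and> 0 < n"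
    using eventually_gt_at_top[of 0] by eventually_elim auto
  then obtain n where "(LINT z|\<mu>. (1 - cutoff (real n) z) * dist_diag z powr r) < \<eta>" "0 < n"
    using eventually_happens'[OF sequentially_bot] by blast
  then show ?thesis
    by (intro exI[of _ "cutoff (real n)"]) (simp add: test_fun_cutoff cutoff_bounds)
qed

section \<open>Partitions of unity from tent functions\<close>

definition ramp :: "real \<Rightarrow> real" where "ramp t = min 1 (max 0 t)"

text \<open>A piecewise linear hat on an interval of length 2 starting at \<open>i - N\<close>.
  Written as a difference of consecutive ramps so that sums over \<open>i\<close> telescope; the
  offset \<open>N\<close> lets natural indices reach negative arguments.\<close>

definition tent :: "nat \<Rightarrow> nat \<Rightarrow> real \<Rightarrow> real" where
  "tent N i t = ramp (t + real N - real i) - ramp (t + real N - real (Suc i))"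

lemma tent_nonneg: "0 \<le> tent N i t"
  by (simp add: tent_def ramp_def)

lemma continuous_on_tent: "continuous_on A f \<Longrightarrow> continuous_on A (\<lambda>x. tent N i (f x))"
  unfolding tent_def ramp_def by (intro continuous_intros)

lemma tent_support:
  assumes "tent N i t \<noteq> 0" "tent N i t' \<noteq> 0"
  shows "\<bar>t - t'\<bar> \<le> 2"
  using assms by (auto simp: tent_def ramp_def min_def max_def split: if_splits)

text \<open>The sum telescopes to \<open>ramp (t + N) - ramp (t - N)\<close>; the margin 1 in the
  hypothesis makes the first ramp full.\<close>

lemma sum_tent: "\<bar>t\<bar> + 1 \<le> real N \<Longrightarrow> (\<Sum>i<2 * N. tent N i t) = 1"
  unfolding tent_def by (subst sum_lessThan_telescope') (auto simp: ramp_def)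

text \<open>Products of two tents scaled by \<open>h\<close> tile the plane with supports of
  \<open>dinf\<close>-diameter at most \<open>2 * h\<close>; multiplication by
  \<open>\<theta>\<close> confines them to its support, where finitely many suffice.\<close>

lemma obtain_partition:
  assumes \<theta>: "test_fun \<theta>" "\<And>z. 0 \<le> \<theta> z" and h: "0 < h"
  obtains I :: "(nat \<times> nat) set" and u where "finite I" "\<And>i. test_fun (u i)" "\<And>i z. 0 \<le> u i z"
    "\<And>z. (\<Sum>i\<in>I. u i z) = \<theta> z" "\<And>i z. u i z \<noteq> 0 \<Longrightarrow> \<theta> z \<noteq> 0"
    "\<And>i z w. u i z \<noteq> 0 \<Longrightarrow> u i w \<noteq> 0 \<Longrightarrow> dinf z w \<le> 2 * h"
proof -
  obtain T where T: "compact T" "\<And>z. z \<notin> T \<Longrightarrow> \<theta> z = 0" using \<theta>(1) by (auto simp: test_fun_def)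
  obtain R where R: "\<And>z. z \<in> T \<Longrightarrow> norm z \<le> R"
    using compact_imp_bounded[OF T(1)] unfolding bounded_iff by blast
  \<comment> \<open>Enough tents to cover the coordinates of the support, measured in units of
    \<open>h\<close>, with the margin of \<open>sum_tent\<close>.\<close>
  obtain N :: nat where N: "R / h + 1 \<le> real N" using real_arch_simple by blast
  define u where "u i z = (tent N (fst i) (fst z / h) * tent N (snd i) (snd z / h)) * \<theta> z" for i :: "nat \<times> nat" and z
  have sum: "(\<Sum>i\<in>{..<2 * N} \<times> {..<2 * N}. u i z) = \<theta> z" for z
  proof (cases "z \<in> T")
    case True
    have "\<bar>x / h\<bar> + 1 \<le> real N" if "\<bar>x\<bar> \<le> R" for x
      using N that h divide_right_mono[OF that, of h] by (simp add: abs_divide)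
    moreover have "\<bar>fst z\<bar> \<le> R" "\<bar>snd z\<bar> \<le> R"
      using R[OF True] norm_fst_le[of "fst z" "snd z"] norm_snd_le[of "snd z" "fst z"] by auto
    ultimately have "(\<Sum>i<2 * N. tent N i (fst z / h)) = 1" "(\<Sum>j<2 * N. tent N j (snd z / h)) = 1"
      by (auto intro: sum_tent)
    moreover have "(\<Sum>i\<in>{..<2 * N} \<times> {..<2 * N}. u i z)
        = (\<Sum>i<2 * N. tent N i (fst z / h)) * (\<Sum>j<2 * N. tent N j (snd z / h)) * \<theta> z"
      unfolding sum_product sum.cartesian_product
      by (simp add: u_def sum_distrib_right case_prod_unfold)
    ultimately show ?thesis by simp
  qed (simp add: u_def T(2))
  have "test_fun (u i)" for i
    unfolding u_def[abs_def]
    by (intro test_fun_mult_left[OF \<theta>(1)] continuous_on_mult continuous_on_tent continuous_intros) (use h in auto)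
  moreover have "dinf z w \<le> 2 * h" if "u i z \<noteq> 0" "u i w \<noteq> 0" for i z w
  proof -
    have "\<bar>x - y\<bar> \<le> 2 * h" if "tent N j (x / h) \<noteq> 0" "tent N j (y / h) \<noteq> 0" for x y j
      using tent_support[OF that] h by (simp add: diff_divide_distrib[symmetric] abs_divide divide_le_eq)
    then show ?thesis using that by (auto simp: u_def dinf_def)
  qed
  ultimately show ?thesis
    using sum \<theta>(2) tent_nonneg
    by (intro that[of "{..<2 * N} \<times> {..<2 * N}" u]) (auto simp: u_def)
qed

text \<open>Transfers smallness of the remainder beyond the cutoff from order \<open>r\<close> to
  order \<open>s\<close>: in the terms of order \<open>a\<close> and \<open>b\<close> the factor
  \<open>1 - \<theta>\<close> is bounded by 1 and the uniform moment bounds are used.\<close>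

lemma (in tail_bounded) integral_cutoff_powr_le:
  assumes exps: "p < a" "a < q" "p < b" "b < q" "p < r" "r < q" "p < s" "s < q"
    and \<theta>: "\<theta> \<in> borel_measurable borel" "\<And>z. 0 \<le> \<theta> z \<and> \<theta> z \<le> 1"
    and le: "\<And>t. 0 \<le> t \<Longrightarrow> t powr s \<le> \<eta> * (t powr a + t powr b) + K * t powr r" and \<eta>: "0 \<le> \<eta>"
  shows "(LINT z|\<mu>. (1 - \<theta> z) * dist_diag z powr s)
    \<le> \<eta> * (moment_bound a + moment_bound b) + K * (LINT z|\<mu>. (1 - \<theta> z) * dist_diag z powr r)"
proof -
  note [measurable] = \<theta>(1)
  have int: "integrable \<mu> (\<lambda>z. (1 - \<theta> z) * dist_diag z powr x)" if "p < x" "x < q" for x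
  proof (rule Bochner_Integration.integrable_bound[OF integrable_dist_diag_powr[OF that]])
    show "(\<lambda>z. (1 - \<theta> z) * dist_diag z powr x) \<in> borel_measurable \<mu>"
      by (intro measurable_of_borel) measurable
    show "AE z in \<mu>. norm ((1 - \<theta> z) * dist_diag z powr x) \<le> norm (dist_diag z powr x)"
      using \<theta>(2) by (intro AE_I2) (simp add: abs_mult mult_left_le_one_le)
  qed
  note i = integrable_dist_diag_powr[OF exps(1,2)] integrable_dist_diag_powr[OF exps(3,4)] int[OF exps(5,6)]
  have "(LINT z|\<mu>. (1 - \<theta> z) * dist_diag z powr s)
      \<le> (LINT z|\<mu>. \<eta> * (dist_diag z powr a + dist_diag z powr b) + K * ((1 - \<theta> z) * dist_diag z powr r))"
  proof (rule Bochner_Integration.integral_mono)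
    show "integrable \<mu> (\<lambda>z. (1 - \<theta> z) * dist_diag z powr s)" by (rule int[OF exps(7,8)])
    show "integrable \<mu> (\<lambda>z. \<eta> * (dist_diag z powr a + dist_diag z powr b) + K * ((1 - \<theta> z) * dist_diag z powr r))"
      using i by (intro Bochner_Integration.integrable_add integrable_mult_right)
    fix z
    have "(1 - \<theta> z) * dist_diag z powr s
        \<le> (1 - \<theta> z) * (\<eta> * (dist_diag z powr a + dist_diag z powr b) + K * dist_diag z powr r)"
      using \<theta>(2)[of z] by (intro mult_left_mono le) auto
    also have "\<dots> = (1 - \<theta> z) * (\<eta> * (dist_diag z powr a + dist_diag z powr b)) + K * ((1 - \<theta> z) * dist_diag z powr r)"
      by (simp add: distrib_left ac_simps)
    also have "(1 - \<theta> z) * (\<eta> * (dist_diag z powr a + dist_diag z powr b)) \<le> \<eta> * (dist_diag z powr a + dist_diag z powr b)"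
      using \<theta>(2)[of z] \<eta> by (intro mult_left_le_one_le mult_nonneg_nonneg) auto
    finally show "(1 - \<theta> z) * dist_diag z powr s
      \<le> \<eta> * (dist_diag z powr a + dist_diag z powr b) + K * ((1 - \<theta> z) * dist_diag z powr r)" by simp
  qed
  also have "\<dots> = \<eta> * ((LINT z|\<mu>. dist_diag z powr a) + (LINT z|\<mu>. dist_diag z powr b))
      + K * (LINT z|\<mu>. (1 - \<theta> z) * dist_diag z powr r)"
    using i by simp
  also have "\<dots> \<le> \<eta> * (moment_bound a + moment_bound b) + K * (LINT z|\<mu>. (1 - \<theta> z) * dist_diag z powr r)"
    using \<eta> exps by (intro add_right_mono mult_left_mono add_mono integral_dist_diag_powr_le) auto
  finally show ?thesis .
qed

text \<open>Cutoff and partition are chosen from \<open>\<mu>\<close> alone. Vague convergence then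
  matches the finitely many cell masses, convergence of the moment controls \<open>M n\<close>
  beyond the cutoff, and \<open>gluing\<close> supplies the coupling.\<close>

lemma (in tail_bounded_seq) dpers_tendsto_0:
  assumes vague: "vague_converges M \<mu>" and r: "p < r" "r < q"
    and zeta: "(\<lambda>n. zeta (M n) (complex_of_real r)) \<longlonglongrightarrow> zeta \<mu> (complex_of_real r)"
    and s: "p < s" "s < q"
  shows "(\<lambda>n. dpers s (M n) \<mu>) \<longlonglongrightarrow> 0"
proof -
  have s_pos: "0 < s" and r_pos: "0 < r" using s r lim.p_ge_1 by auto
  have vague': "(\<lambda>n. LINT z|M n. f z) \<longlonglongrightarrow> (LINT z|\<mu>. f z)" if "test_fun f" for f
    using vague that by (subst (asm) vague_converges_iff) (auto simp: seq.space_eq lim.space_eq)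
  have moment: "(\<lambda>n. LINT z|M n. dist_diag z powr r) \<longlonglongrightarrow> (LINT z|\<mu>. dist_diag z powr r)"
    using zeta unfolding seq.zeta_of_real[OF r] lim.zeta_of_real[OF r] by (simp only: tendsto_of_real_iff)
  \<comment> \<open>Exponents in the strip on either side of \<open>s\<close>, as the interpolation
    demands.\<close>
  define a b where "a = (p + min r s) / 2" and "b = (q + max r s) / 2"
  have ab: "p < a" "a < q" "p < b" "b < q" "a < s" "s < b"
    using r s by (auto simp: a_def b_def min_def max_def)
  have "\<forall>\<^sub>F n in sequentially. (INF \<pi>\<in>couplings (M n) \<mu>. cost s \<pi>) < ennreal e" if e: "0 < e" for e
  proof -
    define J where "J = \<bar>lim.moment_bound a + lim.moment_bound b\<bar> + 1"
    have J: "0 < J" unfolding J_def by linarith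
    define \<eta> where "\<eta> = e / 16 / J"
    have \<eta>: "0 < \<eta>" using e J by (simp add: \<eta>_def)
    obtain K where K: "0 \<le> K" "\<And>t. 0 \<le> t \<Longrightarrow> t powr s \<le> \<eta> * (t powr a + t powr b) + K * t powr r"
      using powr_interpolation[OF ab(5,6) \<eta>] by blast
    have K1: "0 < 16 * (K + 1)" using K by simp
    obtain \<theta> where \<theta>: "test_fun \<theta>" "\<And>z. 0 \<le> \<theta> z \<and> \<theta> z \<le> 1"
      "(LINT z|\<mu>. (1 - \<theta> z) * dist_diag z powr r) < e / (16 * (K + 1))"
      using lim.ex_cutoff[OF r, of "e / (16 * (K + 1))"] e K1 by auto
    obtain \<delta> where \<delta>: "0 < \<delta>" "\<And>z. z \<notin> diag_compl \<delta> \<Longrightarrow> \<theta> z = 0" using test_fun_support[OF \<theta>(1)] by blast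
    define m0 where "m0 = (LINT z|\<mu>. \<theta> z) + 1"
    have m0: "0 < m0" unfolding m0_def using \<theta>(2) by (intro add_nonneg_pos Bochner_Integration.integral_nonneg) auto
    \<comment> \<open>Mass at most \<open>m0\<close> moves by at most the cell diameter
      \<open>2 * h\<close>, so the exchange costs at most
      \<open>(2 * h) powr s * m0 = e / 8\<close>.\<close>
    define h where "h = (e / 8 / m0) powr (1 / s) / 2"
    have h: "0 < h" "(2 * h) powr s = e / 8 / m0" using e m0 s_pos by (auto simp: h_def powr_powr)
    obtain I :: "(nat \<times> nat) set" and u where I: "finite I" and u: "\<And>i. test_fun (u i)" "\<And>i z. 0 \<le> u i z"
      "\<And>z. (\<Sum>i\<in>I. u i z) = \<theta> z" "\<And>i z. u i z \<noteq> 0 \<Longrightarrow> \<theta> z \<noteq> 0"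
      "\<And>i z w. u i z \<noteq> 0 \<Longrightarrow> u i w \<noteq> 0 \<Longrightarrow> dinf z w \<le> 2 * h"
      by (rule obtain_partition[OF \<theta>(1) _ h(1)]) (use \<theta>(2) in auto)
    obtain T where T: "compact T" "\<And>z. z \<notin> T \<Longrightarrow> \<theta> z = 0" using \<theta>(1) by (auto simp: test_fun_def)
    have cont_powr: "continuous_on A (\<lambda>z. dist_diag z powr x)" if "0 < x" for A x
      using that by (intro continuous_on_powr' continuous_intros) auto
    have "bounded ((\<lambda>z. dist_diag z powr s) ` T)"
      by (intro compact_imp_bounded compact_continuous_image cont_powr s_pos T)
    then obtain S where S: "\<And>z. z \<in> T \<Longrightarrow> norm (dist_diag z powr s) \<le> S" unfolding bounded_iff by blast
    have S': "dist_diag z powr s \<le> S" if "u i z \<noteq> 0" for i z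
      using S[of z] T(2)[of z] u(4)[OF that] by (cases "z \<in> T") auto
    have "(\<lambda>n. \<Sum>i\<in>I. \<bar>(LINT z|M n. u i z) - (LINT z|\<mu>. u i z)\<bar>) \<longlonglongrightarrow> (\<Sum>i\<in>I. \<bar>(LINT z|\<mu>. u i z) - (LINT z|\<mu>. u i z)\<bar>)"
      by (intro tendsto_intros vague' u)
    then have "(\<lambda>n. \<bar>S\<bar> * (\<Sum>i\<in>I. \<bar>(LINT z|M n. u i z) - (LINT z|\<mu>. u i z)\<bar>)) \<longlonglongrightarrow> 0"
      by (intro tendsto_mult_right_zero) simp
    then have ev1: "\<forall>\<^sub>F n in sequentially. \<bar>S\<bar> * (\<Sum>i\<in>I. \<bar>(LINT z|M n. u i z) - (LINT z|\<mu>. u i z)\<bar>) < e / 8"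
      using e by (intro order_tendstoD(2)) auto
    have tf: "test_fun (\<lambda>z. dist_diag z powr r * \<theta> z)"
      by (intro test_fun_mult_left \<theta> cont_powr r_pos)
    have rest: "(LINT z|\<nu>. (1 - \<theta> z) * dist_diag z powr r) = (LINT z|\<nu>. dist_diag z powr r) - (LINT z|\<nu>. dist_diag z powr r * \<theta> z)"
      if "tail_bounded p q C \<nu>" for \<nu>
    proof -
      have "(LINT z|\<nu>. (1 - \<theta> z) * dist_diag z powr r) = (LINT z|\<nu>. dist_diag z powr r - dist_diag z powr r * \<theta> z)"
        by (simp add: left_diff_distrib mult.commute)
      also have "\<dots> = (LINT z|\<nu>. dist_diag z powr r) - (LINT z|\<nu>. dist_diag z powr r * \<theta> z)"
        by (intro Bochner_Integration.integral_diff tail_bounded.integrable_dist_diag_powr[OF that r]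
            tail_bounded.integrable_test_fun[OF that tf])
      finally show ?thesis .
    qed
    \<comment> \<open>The remainder is the full moment minus the integral of a test function.
      Convergence of both excludes escape of the moment towards the diagonal or to infinity.\<close>
    have "(\<lambda>n. LINT z|M n. (1 - \<theta> z) * dist_diag z powr r) \<longlonglongrightarrow> (LINT z|\<mu>. (1 - \<theta> z) * dist_diag z powr r)"
      unfolding rest[OF M] rest[OF \<mu>] by (intro tendsto_intros moment vague' tf)
    then have ev2: "\<forall>\<^sub>F n in sequentially. (LINT z|M n. (1 - \<theta> z) * dist_diag z powr r) < e / (16 * (K + 1))"
      using \<theta>(3) by (rule order_tendstoD(2))
    have left: "(LINT z|\<nu>. (1 - \<theta> z) * dist_diag z powr s) \<le> e / 8"
      if "tail_bounded p q C \<nu>" "(LINT z|\<nu>. (1 - \<theta> z) * dist_diag z powr r) < e / (16 * (K + 1))" for \<nu>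
    proof -
      have "(LINT z|\<nu>. (1 - \<theta> z) * dist_diag z powr s)
        \<le> \<eta> * (lim.moment_bound a + lim.moment_bound b) + K * (LINT z|\<nu>. (1 - \<theta> z) * dist_diag z powr r)"
        using ab r s \<theta>(2) K(2) \<eta> test_fun_measurable[OF \<theta>(1)]
        by (intro tail_bounded.integral_cutoff_powr_le[OF that(1)]) auto
      also have "\<eta> * (lim.moment_bound a + lim.moment_bound b) \<le> \<eta> * J"
        using \<eta> by (intro mult_left_mono) (auto simp: J_def)
      also have "\<eta> * J = e / 16" using J by (simp add: \<eta>_def)
      also have "K * (LINT z|\<nu>. (1 - \<theta> z) * dist_diag z powr r) \<le> K * (e / (16 * (K + 1)))"
        using K that(2) by (intro mult_left_mono) auto
      also have "K * (e / (16 * (K + 1))) \<le> e / 16"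
        using K e by (simp add: divide_simps)
      finally show ?thesis by simp
    qed
    show ?thesis
      using ev1 ev2
    proof eventually_elim
      case (elim n)
      interpret gluing p q C "M n" \<mu> I u \<delta> "2 * h" S s
      proof (intro gluing.intro gluing_axioms.intro M \<mu> I s \<delta>(1))
        show "u i \<in> borel_measurable borel" for i using test_fun_measurable[OF u(1)] .
        show "u i z = 0" if "z \<notin> diag_compl \<delta>" for i z using u(4) \<delta>(2)[OF that] by blast
      qed (use u \<theta>(2) S' in auto)
      have "cost s coupling \<le> ennreal ((2 * h) powr s * (\<Sum>i\<in>I. m' i))
        + ennreal ((LINT z|M n. (1 - \<theta> z) * dist_diag z powr s) + \<bar>S\<bar> * (\<Sum>i\<in>I. \<bar>m i - m' i\<bar>))
        + ennreal ((LINT z|\<mu>. (1 - \<theta> z) * dist_diag z powr s) + \<bar>S\<bar> * (\<Sum>i\<in>I. \<bar>m i - m' i\<bar>))"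
        using cost_coupling_le by (simp only: u(3))
      also have "\<dots> \<le> ennreal (e / 8) + ennreal (e / 8 + e / 8) + ennreal (e / 8 + e / 8)"
      proof (intro add_mono ennreal_leI)
        have "(\<Sum>i\<in>I. m' i) = (LINT z|\<mu>. (\<Sum>i\<in>I. u i z))"
          unfolding m'_def using integrable_u by (intro Bochner_Integration.integral_sum[symmetric]) auto
        also have "\<dots> \<le> m0" by (simp add: u(3) m0_def)
        finally have "(2 * h) powr s * (\<Sum>i\<in>I. m' i) \<le> e / 8 / m0 * m0"
          unfolding h(2) using e m0 by (intro mult_left_mono) auto
        then show "(2 * h) powr s * (\<Sum>i\<in>I. m' i) \<le> e / 8" using m0 by simp
        show "(LINT z|M n. (1 - \<theta> z) * dist_diag z powr s) \<le> e / 8" by (rule left[OF M elim(2)])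
        show "(LINT z|\<mu>. (1 - \<theta> z) * dist_diag z powr s) \<le> e / 8" by (rule left[OF \<mu> \<theta>(3)])
        show "\<bar>S\<bar> * (\<Sum>i\<in>I. \<bar>m i - m' i\<bar>) \<le> e / 8" "\<bar>S\<bar> * (\<Sum>i\<in>I. \<bar>m i - m' i\<bar>) \<le> e / 8"
          using elim(1) by (simp_all add: m_def m'_def)
      qed
      \<comment> \<open>One eighth for the exchange, and for each measure one for the region beyond
        the cutoff and one for the unmatched cell masses.\<close>
      also have "\<dots> = ennreal (5 * e / 8)" using e by (simp add: ennreal_plus[symmetric] del: ennreal_plus)
      also have "\<dots> < ennreal e" using e by (simp add: ennreal_less_iff)
      finally show ?case using coupling_in_couplings by (auto simp: INF_less_iff)
    qed
  qed
  then show ?thesis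
    unfolding dpers_def tendsto_ennroot_0_iff[OF s_pos] ennreal_tendsto_0I_iff cost_def by blast
qed

section \<open>The equivalence\<close>

lemma envelope_le_1: "p \<le> q \<Longrightarrow> 0 < \<epsilon> \<Longrightarrow> \<epsilon> \<le> 1 \<Longrightarrow> envelope p q \<epsilon> = \<epsilon> powr (- p)"
  unfolding envelope_def by (intro min_absorb1 powr_mono') auto

lemma envelope_ge_1: "p \<le> q \<Longrightarrow> 1 \<le> \<epsilon> \<Longrightarrow> envelope p q \<epsilon> = \<epsilon> powr (- q)"
  unfolding envelope_def by (intro min_absorb2 powr_mono) auto

lemma envelope_antimono: "0 \<le> p \<Longrightarrow> p \<le> q \<Longrightarrow> 0 < \<epsilon> \<Longrightarrow> \<epsilon> \<le> \<delta> \<Longrightarrow> envelope p q \<delta> \<le> envelope p q \<epsilon>"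
  unfolding envelope_def by (intro min.mono powr_mono2') auto

text \<open>\<open>g\<close> may be unbounded at intermediate arguments, but a decreasing
  \<open>F\<close> is at most \<open>F d'\<close>, hence at most \<open>g d'\<close>, beyond
  \<open>d'\<close>. The constant is chosen before \<open>F\<close>, so it serves all tail masses of
  the sequence at once.\<close>

lemma antimono_le_envelope:
  fixes g :: "real \<Rightarrow> real"
  assumes pq: "1 \<le> p" "p < q"
    and g: "g \<in> O[at_right 0](\<lambda>\<epsilon>. \<epsilon> powr (- p))" "g \<in> O[at_top](\<lambda>\<epsilon>. \<epsilon> powr (- q))" "\<And>\<epsilon>. 0 < \<epsilon> \<Longrightarrow> 0 \<le> g \<epsilon>"
  obtains C where "0 \<le> C" "\<And>F \<epsilon>. 0 < \<epsilon> \<Longrightarrow> (\<And>\<delta>. 0 < \<delta> \<Longrightarrow> F \<delta> \<le> ennreal (g \<delta>)) \<Longrightarrow>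
    (\<And>\<delta> \<delta>'. 0 < \<delta> \<Longrightarrow> \<delta> \<le> \<delta>' \<Longrightarrow> F \<delta>' \<le> (F \<delta> :: ennreal)) \<Longrightarrow> F \<epsilon> \<le> ennreal (C * envelope p q \<epsilon>)"
proof -
  obtain c1 where c1: "0 < c1" "\<forall>\<^sub>F \<epsilon> in at_right 0. norm (g \<epsilon>) \<le> c1 * norm (\<epsilon> powr (- p))"
    using g(1) by (rule landau_o.bigE)
  obtain c2 where c2: "0 < c2" "\<forall>\<^sub>F \<epsilon> in at_top. norm (g \<epsilon>) \<le> c2 * norm (\<epsilon> powr (- q))"
    using g(2) by (rule landau_o.bigE)
  obtain d where d: "0 < d" "\<And>\<epsilon>. 0 < \<epsilon> \<Longrightarrow> \<epsilon> < d \<Longrightarrow> norm (g \<epsilon>) \<le> c1 * norm (\<epsilon> powr (- p))"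
    using c1(2) unfolding eventually_at_right_field by auto
  obtain R where R: "\<And>\<epsilon>. R \<le> \<epsilon> \<Longrightarrow> norm (g \<epsilon>) \<le> c2 * norm (\<epsilon> powr (- q))"
    using c2(2) unfolding eventually_at_top_linorder by auto
  \<comment> \<open>The growth bounds hold strictly before \<open>d\<close> and from
    \<open>R\<close> on; the caps at 1 put the two breakpoints on the sides of 1 where
    \<open>envelope\<close> is a single power.\<close>
  define d' R' where "d' = min d 1 / 2" and "R' = max R 1"
  have d': "0 < d'" "d' < d" "d' \<le> 1" and R': "R \<le> R'" "1 \<le> R'" using d(1) by (auto simp: d'_def R'_def)
  define C where "C = c1 + c2 + g d' / envelope p q R'"
  have env: "0 < envelope p q R'" using R' pq by (simp add: envelope_ge_1)
  have gd: "0 \<le> g d' / envelope p q R'" using g(3)[OF d'(1)] env by simp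
  have C: "c1 \<le> C" "c2 \<le> C" "g d' / envelope p q R' \<le> C" "0 \<le> C" using c1(1) c2(1) gd by (auto simp: C_def)
  show ?thesis
  proof (rule that[OF C(4)])
    fix F :: "real \<Rightarrow> ennreal" and \<epsilon> :: real
    assume \<epsilon>: "0 < \<epsilon>" and F: "\<And>\<delta>. 0 < \<delta> \<Longrightarrow> F \<delta> \<le> ennreal (g \<delta>)"
      "\<And>\<delta> \<delta>'. 0 < \<delta> \<Longrightarrow> \<delta> \<le> \<delta>' \<Longrightarrow> F \<delta>' \<le> F \<delta>"
    have bound: "F \<epsilon> \<le> ennreal (C * envelope p q \<epsilon>)" if "F \<epsilon> \<le> ennreal y" "y \<le> c * envelope p q \<epsilon>" "c \<le> C" for c y
    proof -
      have "y \<le> C * envelope p q \<epsilon>" using that(2,3) by (meson envelope_nonneg mult_right_mono order_trans)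
      then show ?thesis using that(1) ennreal_leI order_trans by blast
    qed
    consider "\<epsilon> < d'" | "d' \<le> \<epsilon>" "\<epsilon> \<le> R'" | "R' \<le> \<epsilon>" by linarith
    then show "F \<epsilon> \<le> ennreal (C * envelope p q \<epsilon>)"
    proof cases
      case 1
      then have "g \<epsilon> \<le> c1 * envelope p q \<epsilon>"
        using d(2)[OF \<epsilon>] d' pq \<epsilon> by (simp add: envelope_le_1)
      then show ?thesis using bound[OF F(1)[OF \<epsilon>]] C(1) by blast
    next
      case 2
      have "envelope p q R' \<le> envelope p q \<epsilon>" using 2 \<epsilon> pq by (intro envelope_antimono) auto
      then have "g d' / envelope p q R' * envelope p q R' \<le> g d' / envelope p q R' * envelope p q \<epsilon>"
        using gd by (intro mult_left_mono)
      then have "g d' \<le> g d' / envelope p q R' * envelope p q \<epsilon>" using env by simp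
      moreover have "F \<epsilon> \<le> ennreal (g d')" using F(2)[OF d'(1) 2(1)] F(1)[OF d'(1)] by (rule order_trans)
      ultimately show ?thesis using bound C(3) by blast
    next
      case 3
      then have "g \<epsilon> \<le> c2 * envelope p q \<epsilon>"
        using R[of \<epsilon>] R' pq by (simp add: envelope_ge_1)
      then show ?thesis using bound[OF F(1)[OF \<epsilon>]] C(2) by blast
    qed
  qed
qed

lemma persistence_measures_sets:
  "\<mu> \<in> persistence_measures p \<Longrightarrow> sets \<mu> = sets (restrict_space borel halfplane)"
  by (simp add: persistence_measures_def radon_measures_def)

text \<open>Markov's inequality for \<open>dist_diag z powr p\<close>; finiteness of
  \<open>Pers\<close> excludes the infinite branch of \<open>ennroot\<close>, so the integral is a
  real number.\<close>

lemma emeasure_diag_compl_le_Pers: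
  assumes "\<mu> \<in> persistence_measures p" "0 < p" "0 < \<epsilon>"
  shows "emeasure \<mu> (diag_compl \<epsilon>) \<le> ennreal (enn2real (\<integral>\<^sup>+ z. ennreal (dist_diag z powr p) \<partial>\<mu>) * \<epsilon> powr (- p))"
proof -
  let ?I = "\<integral>\<^sup>+ z. ennreal (dist_diag z powr p) \<partial>\<mu>"
  have sets: "sets \<mu> = sets (restrict_space borel halfplane)" using assms(1) by (rule persistence_measures_sets)
  have fin: "?I < \<top>"
    using assms(1) by (auto simp: persistence_measures_def Pers_def ennroot_def less_top split: if_splits)
  have D: "diag_compl \<epsilon> \<in> sets \<mu>"
    unfolding sets using diag_compl_subset[of \<epsilon>] by (auto simp: sets_restrict_space_iff)
  have meas: "(\<lambda>z. ennreal (dist_diag z powr p)) \<in> borel_measurable \<mu>"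
    unfolding measurable_cong_sets[OF sets refl] by (intro measurable_restrict_space1) measurable
  have "emeasure \<mu> (diag_compl \<epsilon>) = (\<integral>\<^sup>+ z. indicator (diag_compl \<epsilon>) z \<partial>\<mu>)" using D by simp
  also have "\<dots> \<le> (\<integral>\<^sup>+ z. ennreal (\<epsilon> powr (- p)) * ennreal (dist_diag z powr p) \<partial>\<mu>)"
  proof (rule nn_integral_mono)
    fix z
    show "(indicator (diag_compl \<epsilon>) z :: ennreal) \<le> ennreal (\<epsilon> powr (- p)) * ennreal (dist_diag z powr p)"
    proof (cases "z \<in> diag_compl \<epsilon>")
      case True
      then have "\<epsilon> powr p \<le> dist_diag z powr p" using assms by (intro powr_mono2) (auto simp: diag_compl_eq)
      then have "\<epsilon> powr (- p) * \<epsilon> powr p \<le> \<epsilon> powr (- p) * dist_diag z powr p" by (intro mult_left_mono) auto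
      then have "1 \<le> \<epsilon> powr (- p) * dist_diag z powr p" using assms by (simp add: powr_add[symmetric])
      then have "ennreal 1 \<le> ennreal (\<epsilon> powr (- p) * dist_diag z powr p)" by (rule ennreal_leI)
      then show ?thesis using True by (simp add: ennreal_mult)
    qed simp
  qed
  also have "\<dots> = ennreal (\<epsilon> powr (- p)) * ?I" using meas by (rule nn_integral_cmult)
  also have "\<dots> = ennreal (\<epsilon> powr (- p)) * ennreal (enn2real ?I)" using fin by simp
  also have "\<dots> = ennreal (enn2real ?I * \<epsilon> powr (- p))" by (subst ennreal_mult[symmetric]) (auto simp: mult.commute)
  finally show ?thesis .
qed

text \<open>The bound \<open>g\<close> is a hypothesis on the sequence; the limit gets its envelope
  from Markov's inequality with exponents \<open>p\<close> and \<open>q\<close>.\<close>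

lemma persistence_measures_le_envelope:
  assumes "\<mu> \<in> persistence_measures p \<inter> persistence_measures q" "1 \<le> p" "p < q"
  obtains C where "0 \<le> C" "\<And>\<epsilon>. 0 < \<epsilon> \<Longrightarrow> emeasure \<mu> (diag_compl \<epsilon>) \<le> ennreal (C * envelope p q \<epsilon>)"
proof -
  let ?I = "\<lambda>p. enn2real (\<integral>\<^sup>+ z. ennreal (dist_diag z powr p) \<partial>\<mu>)"
  show ?thesis
  proof (rule that[of "?I p + ?I q"])
    fix \<epsilon> :: real assume \<epsilon>: "0 < \<epsilon>"
    have le: "emeasure \<mu> (diag_compl \<epsilon>) \<le> ennreal ((?I p + ?I q) * \<epsilon> powr (- x))" if "x \<in> {p, q}" for x
    proof -
      have "emeasure \<mu> (diag_compl \<epsilon>) \<le> ennreal (?I x * \<epsilon> powr (- x))"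
        using that assms \<epsilon> by (intro emeasure_diag_compl_le_Pers) auto
      also have "\<dots> \<le> ennreal ((?I p + ?I q) * \<epsilon> powr (- x))"
        using that by (intro ennreal_leI mult_right_mono) auto
      finally show ?thesis .
    qed
    show "emeasure \<mu> (diag_compl \<epsilon>) \<le> ennreal ((?I p + ?I q) * envelope p q \<epsilon>)"
      using le[of p] le[of q] by (auto simp: envelope_def min_def)
  qed simp
qed

text \<open>The implications form two cycles through \<open>B\<close> and \<open>E\<close>:
  \<open>A\<close>, \<open>B\<close>, \<open>E\<close> and back, and \<open>E\<close>,
  \<open>C\<close>, \<open>D\<close>, \<open>B\<close>, \<open>E\<close>.\<close>

lemma all_equivalent_5I:
  assumes "A \<Longrightarrow> B" "B \<Longrightarrow> E" "E \<Longrightarrow> A" "E \<Longrightarrow> C" "C \<Longrightarrow> D" "D \<Longrightarrow> B"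
  shows "all_equivalent [A, B, C, D, E]"
proof -
  have "B = A" "C = A" "D = A" "E = A" using assms by blast+
  then show ?thesis by (simp add: all_equivalent_def)
qed

theorem theorem2p45:
  fixes p q :: real
    and M :: "nat \<Rightarrow> (real \<times> real) measure"
    and \<mu> :: "(real \<times> real) measure"
    and g :: "real \<Rightarrow> real"
  assumes "1 \<le> p" and "p < q"
    and "\<And>n. M n \<in> persistence_measures p \<inter> persistence_measures q"
    and "\<And>n. q_tame (M n)"
    and "\<mu> \<in> persistence_measures p \<inter> persistence_measures q"
    and "q_tame \<mu>"
    and "\<And>\<epsilon>. \<epsilon> > 0 \<Longrightarrow> 0 \<le> g \<epsilon>"
    and "\<And>n \<epsilon>. \<epsilon> > 0 \<Longrightarrow> emeasure (M n) (diag_compl \<epsilon>) \<le> ennreal (g \<epsilon>)"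
    and "g \<in> O[at_right 0](\<lambda>\<epsilon>. \<epsilon> powr (- p))"
    and "g \<in> O[at_top](\<lambda>\<epsilon>. \<epsilon> powr (- q))"
  shows "all_equivalent
    [\<exists>r. p < r \<and> r < q \<and> (\<lambda>n. dpers r (M n) \<mu>) \<longlonglongrightarrow> 0,
     \<exists>r. p < r \<and> r < q \<and> vague_converges M \<mu>
       \<and> (\<lambda>n. zeta (M n) (complex_of_real r)) \<longlonglongrightarrow> zeta \<mu> (complex_of_real r),
     AE (x, \<epsilon>) in lborel. \<epsilon> > 0 \<longrightarrow>
       (\<lambda>n. emeasure (M n) (diag_compl \<epsilon>)) \<longlonglongrightarrow> emeasure \<mu> (diag_compl \<epsilon>)
       \<and> (\<lambda>n. emeasure (M n) (quadrant x \<epsilon>)) \<longlonglongrightarrow> emeasure \<mu> (quadrant x \<epsilon>),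
     AE x in lborel. \<forall>K. compact K \<and> K \<subseteq> {s. p < Re s \<and> Re s < q} \<longrightarrow>
       uniform_limit K (\<lambda>n. zeta_at x (M n)) (zeta_at x \<mu>) sequentially
       \<and> uniform_limit K (\<lambda>n. zeta (M n)) (zeta \<mu>) sequentially,
     \<forall>r. p < r \<and> r < q \<longrightarrow> (\<lambda>n. dpers r (M n) \<mu>) \<longlonglongrightarrow> 0]"
proof -
  obtain C1 where C1: "0 \<le> C1" "\<And>F \<epsilon>. 0 < \<epsilon> \<Longrightarrow> (\<And>\<delta>. 0 < \<delta> \<Longrightarrow> F \<delta> \<le> ennreal (g \<delta>)) \<Longrightarrow>
    (\<And>\<delta> \<delta>'. 0 < \<delta> \<Longrightarrow> \<delta> \<le> \<delta>' \<Longrightarrow> F \<delta>' \<le> (F \<delta> :: ennreal)) \<Longrightarrow> F \<epsilon> \<le> ennreal (C1 * envelope p q \<epsilon>)"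
    using antimono_le_envelope[OF assms(1,2,9,10,7)] by blast
  obtain C2 where C2: "0 \<le> C2" "\<And>\<epsilon>. 0 < \<epsilon> \<Longrightarrow> emeasure \<mu> (diag_compl \<epsilon>) \<le> ennreal (C2 * envelope p q \<epsilon>)"
    using persistence_measures_le_envelope[OF assms(5,1,2)] by blast
  have sets_M: "sets (M n) = sets (restrict_space borel halfplane)" for n
    using assms(3)[of n] by (intro persistence_measures_sets[of _ p]) auto
  have sets_\<mu>: "sets \<mu> = sets (restrict_space borel halfplane)"
    using assms(5) by (intro persistence_measures_sets[of _ p]) auto
  have D: "diag_compl \<epsilon> \<in> sets (M n)" for n \<epsilon>
    unfolding sets_M using diag_compl_subset[of \<epsilon>] by (auto simp: sets_restrict_space_iff)
  have weaken: "ennreal (c * envelope p q \<epsilon>) \<le> ennreal ((C1 + C2) * envelope p q \<epsilon>)" if "c \<in> {C1, C2}" for c \<epsilon>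
    using that C1(1) C2(1) by (intro ennreal_leI mult_right_mono) auto
  \<comment> \<open>The sum is one constant for the sequence, bounded through \<open>g\<close>, and
    the limit, bounded through its persistences.\<close>
  interpret tail_bounded_seq p q "C1 + C2" M \<mu>
  proof (intro tail_bounded_seq.intro tail_bounded.intro assms(1,2) sets_M sets_\<mu>)
    fix n and \<epsilon> :: real assume \<epsilon>: "0 < \<epsilon>"
    have "emeasure (M n) (diag_compl \<epsilon>) \<le> ennreal (C1 * envelope p q \<epsilon>)"
    proof (rule C1(2)[OF \<epsilon>])
      show "emeasure (M n) (diag_compl \<delta>) \<le> ennreal (g \<delta>)" if "0 < \<delta>" for \<delta>
        using that by (rule assms(8))
      show "emeasure (M n) (diag_compl \<delta>') \<le> emeasure (M n) (diag_compl \<delta>)" if "\<delta> \<le> \<delta>'" for \<delta> \<delta>'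
        using that by (intro emeasure_mono diag_compl_antimono D)
    qed
    then show "emeasure (M n) (diag_compl \<epsilon>) \<le> ennreal ((C1 + C2) * envelope p q \<epsilon>)"
      using weaken[of C1 \<epsilon>] by simp
    show "emeasure \<mu> (diag_compl \<epsilon>) \<le> ennreal ((C1 + C2) * envelope p q \<epsilon>)"
      using C2(2)[OF \<epsilon>] weaken[of C2 \<epsilon>] by simp
  qed
  define \<sigma> where "\<sigma> = (p + q) / 2"
  have \<sigma>: "p < \<sigma>" "\<sigma> < q" using assms(2) by (auto simp: \<sigma>_def)
  show ?thesis
  proof (rule all_equivalent_5I)
    assume "\<exists>r. p < r \<and> r < q \<and> (\<lambda>n. dpers r (M n) \<mu>) \<longlonglongrightarrow> 0"
    then show "\<exists>r. p < r \<and> r < q \<and> vague_converges M \<mu>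
       \<and> (\<lambda>n. zeta (M n) (complex_of_real r)) \<longlonglongrightarrow> zeta \<mu> (complex_of_real r)"
      using vague_converges_if_dpers zeta_tendsto_if_dpers by blast
  next
    assume "\<exists>r. p < r \<and> r < q \<and> vague_converges M \<mu>
       \<and> (\<lambda>n. zeta (M n) (complex_of_real r)) \<longlonglongrightarrow> zeta \<mu> (complex_of_real r)"
    then show "\<forall>r. p < r \<and> r < q \<longrightarrow> (\<lambda>n. dpers r (M n) \<mu>) \<longlonglongrightarrow> 0"
      using dpers_tendsto_0 by blast
  next
    assume *: "\<forall>r. p < r \<and> r < q \<longrightarrow> (\<lambda>n. dpers r (M n) \<mu>) \<longlonglongrightarrow> 0"
    with \<sigma> show "\<exists>r. p < r \<and> r < q \<and> (\<lambda>n. dpers r (M n) \<mu>) \<longlonglongrightarrow> 0" by blast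
    show "AE (x, \<epsilon>) in lborel. masses_tendsto x \<epsilon>"
      using * \<sigma> by (intro AE_tendsto_if_dpers[OF \<sigma>]) blast
  next
    assume "AE (x, \<epsilon>) in lborel. masses_tendsto x \<epsilon>"
    then show "AE x in lborel. zetas_tendsto x"
      by (rule AE_uniform_limit_zeta)
  next
    assume *: "AE x in lborel. zetas_tendsto x"
    from * have "vague_converges M \<mu>" by (rule vague_converges_if_zeta_at)
    moreover have "(\<lambda>n. zeta (M n) (complex_of_real \<sigma>)) \<longlonglongrightarrow> zeta \<mu> (complex_of_real \<sigma>)"
    proof -
      \<comment> \<open>The convergence of \<open>zeta\<close> does not involve \<open>x\<close>, so
        a single \<open>x\<close> outside the null set is enough; one exists because Lebesgue
        measure is not 0.\<close>
      have "ae_filter (lborel :: real measure) \<noteq> bot" by (simp add: ae_filter_eq_bot_iff)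
      from eventually_happens'[OF this *] have "\<exists>x. zetas_tendsto x"
        by blast
      then obtain x where x: "zetas_tendsto x" ..
      have "uniform_limit {complex_of_real \<sigma>} (\<lambda>n. zeta (M n)) (zeta \<mu>) sequentially"
        by (rule x[rule_format, THEN conjunct2]) (use \<sigma> in auto)
      then show ?thesis by (rule tendsto_uniform_limitI) simp
    qed
    ultimately show "\<exists>r. p < r \<and> r < q \<and> vague_converges M \<mu>
       \<and> (\<lambda>n. zeta (M n) (complex_of_real r)) \<longlonglongrightarrow> zeta \<mu> (complex_of_real r)"
      using \<sigma> by blast
  qed
qed

end
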